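(* Let $A\in\mathbb{R}^{N\times N}$ and let $\sigma^f=(\sigma^f_s)_{s\ge 0}$ be a subordinator with Laplace exponent $f(x)=bx+\int_0^\infty(1-e^{-sx})\,\nu(ds)$, $x>0$, where $b\ge 0$, $\nu$ is a non-negative measure on $(0,\infty)$ with $\int_0^\infty (s\wedge 1)\,\nu(ds)<\infty$ and $\nu(0,\infty)=\infty$, and the tail $s\mapsto\bar\nu(s)=\nu(s,\infty)$ is absolutely continuous on $(0,\infty)$. Let $L_t=\inf\{s>0:\sigma^f_s>t\}$, $t\ge 0$, be the inverse of $\sigma^f$, and define for each $\vec u\in\mathbb{R}^N$ and $t\ge 0$ the linear mapping $$T_t\vec u=\mathbb{E}[e^{L_tA}]\,\vec u .$$ Then: (i) $T_t$ is well-defined (i.e. the expectation is finite) for all $t\ge 0$; (ii) for every $\vec u\in\mathbb{R}^N$, the map $t\mapsto T_t\vec u$ belongs to $AC_{\mathrm{loc}}((0,\infty))$; (iii) for every $\vec u\in\mathbb{R}^N$, the map $t\mapsto T_t\vec u$ uniquely solves $$\mathbb{D}^f_t q(t)=Aq(t),\quad 0<t<\infty,\qquad q(0)=\vec u .$$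
   Context: A subordinator is a non-decreasing Lévy process without killing (started at $0$); $f$ being its Laplace exponent means $\mathbb{E}[e^{-\lambda\sigma^f_s}]=e^{-sf(\lambda)}$ for $s,\lambda>0$. $AC_{\mathrm{loc}}((0,\infty))$ is the set of functions $q$ on $[0,\infty)$ that are absolutely continuous up to time $t$ (on $[0,t]$) for every $t>0$ (componentwise for vector-valued functions). For such $q$ the generalized $f$-Caputo derivative is $$\mathbb{D}^f_tq(t)=\frac{d}{dt}\left(bq(t)+\int_0^t\bar\nu(t-s)\,(q(s)-q(0))\,ds\right),\quad t>0,$$ applied componentwise. Solutions of the fractional differential equation are sought among functions in $AC_{\mathrm{loc}}((0,\infty))$. *)

theory Defs
  imports "HOL-Probability.Probability"
begin

section \<open>Absolutely continuous functions\<close>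

definition abs_continuous_on :: "real set \<Rightarrow> (real \<Rightarrow> real) \<Rightarrow> bool" where
  "abs_continuous_on S f \<longleftrightarrow>
    (\<forall>\<epsilon>>0. \<exists>\<delta>>0. \<forall>(n::nat) u v.
      (\<forall>i<n. u i \<le> v i \<and> {u i..v i} \<subseteq> S) \<longrightarrow>
      disjoint_family_on (\<lambda>i. {u i<..<v i}) {..<n} \<longrightarrow>
      (\<Sum>i<n. v i - u i) < \<delta> \<longrightarrow> (\<Sum>i<n. \<bar>f (v i) - f (u i)\<bar>) < \<epsilon>)"

text \<open>Functions on \<open>[0, \<infinity>)\<close> are total functions on the reals whose values at negative
  arguments are irrelevant.\<close>

definition AC_loc :: "(real \<Rightarrow> real ^ 'n) set" where
  "AC_loc = {q. \<forall>i. \<forall>t>0. abs_continuous_on {0..t} (\<lambda>s. q s $ i)}"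

section \<open>Levy processes and subordinators\<close>

definition levy_process :: "'a measure \<Rightarrow> (real \<Rightarrow> 'a \<Rightarrow> real) \<Rightarrow> bool" where
  "levy_process M X \<longleftrightarrow>
    prob_space M \<and>
    (\<forall>t\<ge>0. X t \<in> borel_measurable M) \<and>
    (AE \<omega> in M. X 0 \<omega> = 0) \<and>
    (\<forall>(n::nat) t. 0 \<le> t 0 \<and> (\<forall>i<n. t i < t (Suc i)) \<longrightarrow>
      prob_space.indep_vars M (\<lambda>_. borel) (\<lambda>i \<omega>. X (t (Suc i)) \<omega> - X (t i) \<omega>) {..<n}) \<and>
    (\<forall>s\<ge>0. \<forall>t\<ge>0. distr M borel (\<lambda>\<omega>. X (s + t) \<omega> - X s \<omega>) = distr M borel (\<lambda>\<omega>. X t \<omega> - X 0 \<omega>)) \<and>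
    (\<forall>t\<ge>0. \<forall>\<epsilon>>0.
      ((\<lambda>s. measure M {\<omega> \<in> space M. \<epsilon> < \<bar>X s \<omega> - X t \<omega>\<bar>}) \<longlongrightarrow> 0) (at t within {0..})) \<and>
    (AE \<omega> in M. (\<forall>t\<ge>0. ((\<lambda>s. X s \<omega>) \<longlongrightarrow> X t \<omega>) (at_right t)) \<and>
                (\<forall>t>0. \<exists>l. ((\<lambda>s. X s \<omega>) \<longlongrightarrow> l) (at_left t)))"

text \<open>There is no killing because the process is real-valued for all times.\<close>

definition subordinator :: "'a measure \<Rightarrow> (real \<Rightarrow> 'a \<Rightarrow> real) \<Rightarrow> bool" where
  "subordinator M \<sigma> \<longleftrightarrow> levy_process M \<sigma> \<and> (AE \<omega> in M. mono_on {0..} (\<lambda>s. \<sigma> s \<omega>))"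

definition laplace_exponent :: "'a measure \<Rightarrow> (real \<Rightarrow> 'a \<Rightarrow> real) \<Rightarrow> (real \<Rightarrow> real) \<Rightarrow> bool" where
  "laplace_exponent M \<sigma> f \<longleftrightarrow>
    (\<forall>s>0. \<forall>x>0. integral\<^sup>L M (\<lambda>\<omega>. exp (- x * \<sigma> s \<omega>)) = exp (- s * f x))"

text \<open>This is a real infimum, hence unspecified if \<open>\<sigma> s \<omega> \<le> t\<close> for all \<open>s > 0\<close>, where it
  would be infinite mathematically; that it is finite almost surely has to be asserted
  separately.\<close>

definition inverse_process :: "(real \<Rightarrow> 'a \<Rightarrow> real) \<Rightarrow> real \<Rightarrow> 'a \<Rightarrow> real" where
  "inverse_process \<sigma> t \<omega> = Inf {s. 0 < s \<and> t < \<sigma> s \<omega>}"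

section \<open>The matrix exponential and the operators $T_t$\<close>

text \<open>Multiplication on \<^typ>\<open>real ^ 'n ^ 'n\<close> is componentwise, so powers of matrices are
  written as iterated matrix products.\<close>

definition matrix_exp :: "real ^ 'n ^ 'n \<Rightarrow> real ^ 'n ^ 'n" where
  "matrix_exp A = (\<Sum>k. (1 / fact k) *\<^sub>R (((**) A) ^^ k) (mat 1))"

text \<open>Path properties hold only almost surely, hence the inverse process need only be measurable
  with respect to the completion of the probability measure.\<close>

definition T_op :: "'a measure \<Rightarrow> (real \<Rightarrow> 'a \<Rightarrow> real) \<Rightarrow> real ^ 'n ^ 'n \<Rightarrow>
    real \<Rightarrow> real ^ 'n \<Rightarrow> real ^ 'n" where
  "T_op M \<sigma> A t u =
    integral\<^sup>L (completion M) (\<lambda>\<omega>. matrix_exp (inverse_process \<sigma> t \<omega> *\<^sub>R A)) *v u"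

section \<open>The generalized Caputo derivative\<close>

definition levy_tail :: "real measure \<Rightarrow> real \<Rightarrow> real" where
  "levy_tail \<nu> s = measure \<nu> {s<..}"

definition has_caputo_derivative ::
    "real \<Rightarrow> real measure \<Rightarrow> (real \<Rightarrow> real ^ 'n) \<Rightarrow> real ^ 'n \<Rightarrow> real \<Rightarrow> bool" where
  "has_caputo_derivative b \<nu> q D t \<longleftrightarrow>
    (\<forall>i. ((\<lambda>t. b * q t $ i + (LINT s:{0..t}|lborel. levy_tail \<nu> (t - s) * (q s $ i - q 0 $ i)))
          has_real_derivative D $ i) (at t))"

definition caputo_solution ::
    "real \<Rightarrow> real measure \<Rightarrow> real ^ 'n ^ 'n \<Rightarrow> real ^ 'n \<Rightarrow> (real \<Rightarrow> real ^ 'n) \<Rightarrow> bool" where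
  "caputo_solution b \<nu> A u q \<longleftrightarrow>
    q \<in> AC_loc \<and> (\<forall>t>0. has_caputo_derivative b \<nu> q (A *v q t) t) \<and> q 0 = u"

end

theory Submission
  imports Defs "HOL-Real_Asymp.Real_Asymp"
begin

text \<open>
  Write \<open>p(s,t)\<close> for the probability of \<open>\<sigma>\<^sub>s \<le> t\<close>, \<open>k\<close> for the tail of the Levy measure and \<open>*\<close> for the
  convolution of functions on the half-line. Up to countably many \<open>s\<close>, the event \<open>L\<^sub>t > s\<close> has
  probability \<open>p(s,t)\<close>, so integrating by parts gives \<open>E h(L\<^sub>t) = h(0) + \<integral> h'(s) p(s,t) ds\<close> for
  smooth \<open>h\<close> of exponential growth. Call the last integral \<open>occ h' t\<close>. It converges because Markov's
  inequality yields \<open>p(s,t) \<le> exp (x t - s f(x))\<close>, and \<open>f\<close> is unbounded since the Levy measure is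
  infinite. Applied to the entries of \<open>exp (s A)\<close>, this shows that \<open>T\<^sub>t\<close> is well defined and reduces
  every claim to the functions \<open>occ h\<close> (\<open>expectation_of_inverse\<close>).

  The Laplace transform of \<open>occ h\<close> at \<open>x\<close> is that of \<open>h\<close> at \<open>f(x)\<close>, divided by \<open>x\<close>; the transform of
  \<open>k\<close> is \<open>f(x)/x - b\<close>. Integration by parts in \<open>s\<close> therefore becomes the identity
  \<open>b occ h + occ h * k = h(0) t + 1 * occ h'\<close> (\<open>occ_identity\<close>), by uniqueness of Laplace transforms.
  For the entries of \<open>A exp (s A) u\<close> it is the integrated Caputo equation
  (\<open>occ_caputo_solution\<close>). For the entries of \<open>exp (s A)\<close> it produces a resolvent kernel: convolving
  it with the homogeneous equation for the difference \<open>d\<close> of two solutions leaves \<open>t * d = 0\<close>, whence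
  \<open>d = 0\<close>, with no growth assumption on \<open>d\<close> (\<open>homogeneous_solution_zero\<close>).

  What remains is absolute continuity. As \<open>h\<close> has exponential growth and \<open>p(s,t)\<close> decays faster, it
  suffices to treat the renewal function \<open>U = occ 1\<close> (\<open>occ_abs_continuous\<close>), which satisfies
  \<open>b U + U * k = t\<close>. For disjoint intervals of small total length let \<open>\<Theta>\<close> be the largest total
  increment of \<open>U\<close> over a leftward translate of these intervals. The equation says that the generator
  \<open>b \<phi>'(x) + \<integral> (\<phi>(x) - \<phi>(x - y)) \<nu>(dy)\<close>, applied to the total increment \<open>\<phi>\<close> as a function of the
  translation, is at most 1. At a maximum, jumps \<open>y \<le> \<eta>\<close> and the drift contribute nonnegative
  amounts, while the jumps \<open>y > \<eta>\<close> contribute \<open>\<Theta> k(\<eta>)\<close> up to an error that is small by the absolute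
  continuity of \<open>k\<close> away from \<open>0\<close>. Hence \<open>\<Theta>\<close> is bounded by about \<open>1 / k(\<eta>)\<close>, which is arbitrarily small
  as \<open>\<nu>\<close> is infinite (\<open>U_abs_continuous\<close>). To give the generator a pointwise meaning, the argument is
  run for moving averages of \<open>U\<close>, with difference quotients in place of derivatives.
\<close>

section \<open>Absolutely continuous and monotone functions\<close>

lemma abs_continuous_onE:
  assumes "abs_continuous_on S f" "0 < \<epsilon>"
  obtains \<delta> where "0 < \<delta>" "\<And>(n::nat) u v. (\<And>i. i < n \<Longrightarrow> u i \<le> v i \<and> {u i..v i} \<subseteq> S) \<Longrightarrow>
    disjoint_family_on (\<lambda>i. {u i<..<v i}) {..<n} \<Longrightarrow> (\<Sum>i<n. v i - u i) < \<delta> \<Longrightarrow>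
    (\<Sum>i<n. \<bar>f (v i) - f (u i)\<bar>) < \<epsilon>"
proof -
  obtain \<delta> where "0 < \<delta>" and *: "\<forall>(n::nat) u v.
      (\<forall>i<n. u i \<le> v i \<and> {u i..v i} \<subseteq> S) \<longrightarrow>
      disjoint_family_on (\<lambda>i. {u i<..<v i}) {..<n} \<longrightarrow>
      (\<Sum>i<n. v i - u i) < \<delta> \<longrightarrow> (\<Sum>i<n. \<bar>f (v i) - f (u i)\<bar>) < \<epsilon>"
    using assms(1)[unfolded abs_continuous_on_def, THEN spec, THEN mp, OF assms(2)] by (elim exE conjE)
  show thesis
    by (rule that[OF \<open>0 < \<delta>\<close>]) (rule *[THEN spec, THEN spec, THEN spec, THEN mp, THEN mp, THEN mp]; simp)
qed

lemma abs_continuous_on_shift: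
  assumes g: "abs_continuous_on S g" and f: "\<And>x. x \<in> S \<Longrightarrow> f x = a + g x"
  shows "abs_continuous_on S f"
  unfolding abs_continuous_on_def
proof (intro allI impI)
  fix \<epsilon> :: real assume "0 < \<epsilon>"
  then obtain \<delta> where \<delta>: "0 < \<delta>" "\<And>(n::nat) u v. (\<And>i. i < n \<Longrightarrow> u i \<le> v i \<and> {u i..v i} \<subseteq> S) \<Longrightarrow>
    disjoint_family_on (\<lambda>i. {u i<..<v i}) {..<n} \<Longrightarrow> (\<Sum>i<n. v i - u i) < \<delta> \<Longrightarrow>
    (\<Sum>i<n. \<bar>g (v i) - g (u i)\<bar>) < \<epsilon>"
    using abs_continuous_onE[OF g] by blast
  show "\<exists>\<delta>>0. \<forall>(n::nat) u v. (\<forall>i<n. u i \<le> v i \<and> {u i..v i} \<subseteq> S) \<longrightarrow>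
      disjoint_family_on (\<lambda>i. {u i<..<v i}) {..<n} \<longrightarrow>
      (\<Sum>i<n. v i - u i) < \<delta> \<longrightarrow> (\<Sum>i<n. \<bar>f (v i) - f (u i)\<bar>) < \<epsilon>"
  proof (intro exI[of _ \<delta>] conjI allI impI \<delta>(1))
    fix n :: nat and u v :: "nat \<Rightarrow> real"
    assume uv: "\<forall>i<n. u i \<le> v i \<and> {u i..v i} \<subseteq> S"
      and disj: "disjoint_family_on (\<lambda>i. {u i<..<v i}) {..<n}" and len: "(\<Sum>i<n. v i - u i) < \<delta>"
    have "(\<Sum>i<n. \<bar>f (v i) - f (u i)\<bar>) = (\<Sum>i<n. \<bar>g (v i) - g (u i)\<bar>)"
    proof (rule sum.cong[OF refl])
      fix i assume "i \<in> {..<n}"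
      then have "u i \<in> S" "v i \<in> S" using uv by (auto simp: subset_iff)
      then show "\<bar>f (v i) - f (u i)\<bar> = \<bar>g (v i) - g (u i)\<bar>" by (simp add: f)
    qed
    then show "(\<Sum>i<n. \<bar>f (v i) - f (u i)\<bar>) < \<epsilon>" using \<delta>(2)[OF uv[rule_format] disj len] by simp
  qed
qed

lemma abs_continuous_on_imp_continuous_on:
  assumes ac: "abs_continuous_on {a..b} f"
  shows "continuous_on {a..b} f"
  unfolding continuous_on_iff
proof (intro ballI allI impI)
  fix x e :: real assume x: "x \<in> {a..b}" and e: "0 < e"
  obtain d where d: "0 < d" "\<And>(n::nat) u v. (\<And>i. i < n \<Longrightarrow> u i \<le> v i \<and> {u i..v i} \<subseteq> {a..b}) \<Longrightarrow>
    disjoint_family_on (\<lambda>i. {u i<..<v i}) {..<n} \<Longrightarrow> (\<Sum>i<n. v i - u i) < d \<Longrightarrow>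
    (\<Sum>i<n. \<bar>f (v i) - f (u i)\<bar>) < e"
    using abs_continuous_onE[OF ac e] by blast
  have one: "\<bar>f v - f u\<bar> < e" if "u \<le> v" "u \<in> {a..b}" "v \<in> {a..b}" "v - u < d" for u v
    using d(2)[of 1 "\<lambda>_. u" "\<lambda>_. v"] that by (auto simp: disjoint_family_on_def)
  show "\<exists>d>0. \<forall>y\<in>{a..b}. dist y x < d \<longrightarrow> dist (f y) (f x) < e"
  proof (intro exI[of _ d] conjI ballI impI d(1))
    fix y assume y: "y \<in> {a..b}" "dist y x < d"
    then show "dist (f y) (f x) < e"
      using one[of x y] one[of y x] x by (cases "x \<le> y") (auto simp: dist_real_def abs_minus_commute)
  qed
qed

text \<open>
  Among the nondegenerate intervals, all but the one with the largest left end point \<open>u x\<close> lie to the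
  left of \<open>u x\<close>; this makes induction on the family work although the intervals are not given in order.
\<close>

lemma sum_increments_disjoint_le:
  fixes D :: "real \<Rightarrow> real" and u v :: "'i \<Rightarrow> real"
  assumes D: "mono D" and fin: "finite I"
    and uv: "\<And>i. i \<in> I \<Longrightarrow> a \<le> u i \<and> u i \<le> v i \<and> v i \<le> b"
    and disj: "disjoint_family_on (\<lambda>i. {u i<..<v i}) I" and ab: "a \<le> b"
  shows "(\<Sum>i\<in>I. D (v i) - D (u i)) \<le> D b - D a"
proof -
  define J where "J = {i \<in> I. u i < v i}"
  have J: "finite J" "\<And>i. i \<in> J \<Longrightarrow> a \<le> u i \<and> u i < v i \<and> v i \<le> b"
    "disjoint_family_on (\<lambda>i. {u i<..<v i}) J"
    using fin uv disj by (auto simp: J_def disjoint_family_on_def)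
  have "\<forall>b\<ge>a. (\<forall>i\<in>J. a \<le> u i \<and> u i < v i \<and> v i \<le> b) \<longrightarrow> disjoint_family_on (\<lambda>i. {u i<..<v i}) J \<longrightarrow>
     (\<Sum>i\<in>J. D (v i) - D (u i)) \<le> D b - D a"
    using J(1)
  proof (induction J rule: finite_ranking_induct[where f=u])
    case empty
    then show ?case using monoD[OF D] by auto
  next
    case (insert x S)
    show ?case
    proof (cases "x \<in> S")
      case False
      show ?thesis
      proof (intro allI impI)
        fix b assume b: "a \<le> b" "\<forall>i\<in>insert x S. a \<le> u i \<and> u i < v i \<and> v i \<le> b"
          "disjoint_family_on (\<lambda>i. {u i<..<v i}) (insert x S)"
        have "v i \<le> u x" if i: "i \<in> S" for i
        proof (rule ccontr)
          assume "\<not> v i \<le> u x"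
          then have "u x < min (v i) (v x)" using b(2) by auto
          then obtain z where z: "u x < z" "z < min (v i) (v x)" using dense by blast
          moreover have "u i \<le> u x" using insert(2) i by auto
          ultimately have "z \<in> {u i<..<v i} \<inter> {u x<..<v x}" by auto
          moreover have "i \<noteq> x" using False i by auto
          ultimately show False using b(3) i unfolding disjoint_family_on_def by blast
        qed
        then have "(\<Sum>i\<in>S. D (v i) - D (u i)) \<le> D (u x) - D a"
          using insert.IH b by (auto simp: disjoint_family_on_def)
        moreover have "D (v x) \<le> D b" using b by (auto intro: monoD[OF D])
        ultimately show "(\<Sum>i\<in>insert x S. D (v i) - D (u i)) \<le> D b - D a"
          using insert(1) False by simp
      qed
    next
      case True
      then show ?thesis using insert.IH by (simp add: insert_absorb)
    qed
  qed
  then have "(\<Sum>i\<in>J. D (v i) - D (u i)) \<le> D b - D a" using J ab by auto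
  moreover have "(\<Sum>i\<in>I. D (v i) - D (u i)) = (\<Sum>i\<in>J. D (v i) - D (u i))"
    using fin uv by (intro sum.mono_neutral_right) (auto simp: J_def less_le)
  ultimately show ?thesis by simp
qed

section \<open>Uniqueness of Laplace transforms\<close>

text \<open>
  Right continuity replaces the usual almost-everywhere conclusion by one at every point: if the
  function were positive at \<open>t\<close>, its integral over a short interval to the right of \<open>t\<close> would be.
\<close>

lemma zero_of_zero_integrals:
  fixes G :: "real \<Rightarrow> real"
  assumes int: "\<And>t. set_integrable lborel {0..t} G"
    and zero: "\<And>t. 0 \<le> t \<Longrightarrow> (LINT s:{0..t}|lborel. G s) = 0"
    and rc: "continuous (at_right t) G" and t: "0 \<le> t"
  shows "G t = 0"
proof -
  have nonpos: "F t \<le> 0" if int: "\<And>t. set_integrable lborel {0..t} F"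
    and zero: "\<And>t. 0 \<le> t \<Longrightarrow> (LINT s:{0..t}|lborel. F s) = 0"
    and rc: "continuous (at_right t) F" for F :: "real \<Rightarrow> real"
  proof (rule ccontr)
    assume "\<not> F t \<le> 0"
    then have pos: "F t / 2 < F t" "0 < F t" by auto
    have "(F \<longlongrightarrow> F t) (at_right t)" using rc by (simp add: continuous_within)
    from order_tendstoD(1)[OF this pos(1)] obtain u where u: "t < u" "\<And>s. t < s \<Longrightarrow> s < u \<Longrightarrow> F t / 2 < F s"
      by (auto simp: eventually_at_right_field)
    define v where "v = (t + u) / 2"
    have v: "t < v" "v < u" using u by (auto simp: v_def)
    have iv: "set_integrable lborel {t<..v} F"
      by (rule set_integrable_subset[OF int[of v]]) (use t in auto)
    have "(LINT s:{0..v}|lborel. F s) = (LINT s:{0..t}|lborel. F s) + (LINT s:{t<..v}|lborel. F s)"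
    proof -
      have e: "{0..v} = {0..t} \<union> {t<..v}" using t v by auto
      show ?thesis unfolding e by (rule set_integral_Un[OF _ int iv]) auto
    qed
    then have "(LINT s:{t<..v}|lborel. F s) = 0" using zero[of v] zero[of t] t v by auto
    moreover have "(LINT s:{t<..v}|lborel. F t / 2) \<le> (LINT s:{t<..v}|lborel. F s)"
      using u v by (intro set_integral_mono iv)
        (auto simp: set_integrable_def less_imp_le intro!: integrable_mult_left)
    moreover have "(LINT s:{t<..v}|lborel. F t / 2) = (v - t) * (F t / 2)"
      using v by (simp add: set_lebesgue_integral_def)
    moreover have "(v - t) * (F t / 2) > 0" using v pos by simp
    ultimately show False by linarith
  qed
  have "- G t \<le> 0"
  proof (rule nonpos[of "\<lambda>s. - G s"])
    show "set_integrable lborel {0..t} (\<lambda>s. - G s)" for t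
      using int[of t] by (simp add: set_integrable_def)
    show "(LINT s:{0..t}|lborel. - G s) = 0" if "0 \<le> t" for t
      using zero[OF that] by (simp add: set_lebesgue_integral_def)
    show "continuous (at_right t) (\<lambda>s. - G s)" using rc by (intro continuous_intros)
  qed
  moreover have "G t \<le> 0" by (rule nonpos[OF int zero rc])
  ultimately show ?thesis by simp
qed

lemma integrable_mult_bounded:
  fixes f g :: "'a \<Rightarrow> real"
  assumes "integrable M f" "g \<in> borel_measurable M" "AE x in M. \<bar>g x\<bar> \<le> C"
  shows "integrable M (\<lambda>x. f x * g x)"
proof (rule Bochner_Integration.integrable_bound)
  show "integrable M (\<lambda>x. C * f x)" using assms by auto
  show "(\<lambda>x. f x * g x) \<in> borel_measurable M" using assms by auto
  show "AE x in M. norm (f x * g x) \<le> norm (C * f x)"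
    using assms(3)
  proof eventually_elim
    case (elim x)
    have "\<bar>f x\<bar> * \<bar>g x\<bar> \<le> \<bar>f x\<bar> * \<bar>C\<bar>" using elim by (intro mult_left_mono) auto
    then show ?case by (simp add: abs_mult mult.commute)
  qed
qed

text \<open>
  Lerch's theorem. In the variable \<open>exp (- t)\<close>, the transforms at \<open>x0 + n\<close> are the moments of a
  finite signed measure on \<open>[0,1]\<close>. By the Weierstrass theorem they determine its integrals against
  continuous functions, and hence, in the limit, against indicators of intervals.
\<close>

lemma laplace_zero_imp_zero:
  fixes F :: "real \<Rightarrow> real"
  assumes [measurable]: "F \<in> borel_measurable borel"
    and neg: "\<And>t. t < 0 \<Longrightarrow> F t = 0"
    and rc: "\<And>t. 0 \<le> t \<Longrightarrow> continuous (at_right t) F"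
    and int: "integrable lborel (\<lambda>t. exp (- x0 * t) * F t)"
    and zero: "\<And>x. x0 \<le> x \<Longrightarrow> (\<integral>t. exp (- x * t) * F t \<partial>lborel) = 0"
  shows "F t = 0"
proof (cases "t < 0")
  case False
  define G where "G t = exp (- x0 * t) * F t" for t
  have [measurable]: "G \<in> borel_measurable borel" unfolding G_def by measurable
  have iG: "integrable lborel G" using int unfolding G_def .
  have Gneg: "G t = 0" if "t < 0" for t using neg that by (simp add: G_def)
  \<comment> \<open>The clipping affects only negative \<open>t\<close>, where \<open>F\<close> vanishes; it keeps the variable in \<open>[0,1]\<close>.\<close>
  define e where "e t = max 0 (min 1 (exp (- t)))" for t :: real
  have e01: "e t \<in> {0..1}" for t by (auto simp: e_def)
  have [measurable]: "e \<in> borel_measurable borel" unfolding e_def by measurable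
  have pow: "(\<integral>t. G t * e t ^ n \<partial>lborel) = 0" and ipow: "integrable lborel (\<lambda>t. G t * e t ^ n)" for n
  proof -
    have "G t * e t ^ n = exp (- (x0 + n) * t) * F t" for t
    proof (cases "t < 0")
      case False
      then have "e t = exp (- t)" by (simp add: e_def)
      then show ?thesis
        by (simp add: G_def exp_of_nat_mult[symmetric] exp_add[symmetric] algebra_simps flip: exp_minus)
    qed (simp add: neg G_def)
    then show "(\<integral>t. G t * e t ^ n \<partial>lborel) = 0" using zero[of "x0 + n"] by simp
    show "integrable lborel (\<lambda>t. G t * e t ^ n)"
      by (rule integrable_mult_bounded[OF iG, where C=1]) (use e01 in \<open>auto simp: power_le_one\<close>)
  qed
  have cont: "(\<integral>t. G t * \<phi> (e t) \<partial>lborel) = 0"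
    if c: "continuous_on {0..1} \<phi>" and [measurable]: "\<phi> \<in> borel_measurable borel" for \<phi> :: "real \<Rightarrow> real"
  proof -
    define I where "I = (\<integral>t. \<bar>G t\<bar> \<partial>lborel)"
    have I: "I \<ge> 0" by (simp add: I_def)
    have bd: "\<bar>\<integral>t. G t * \<phi> (e t) \<partial>lborel\<bar> \<le> \<epsilon> * I" if "\<epsilon> > 0" for \<epsilon>
    proof -
      obtain g where g: "real_polynomial_function g" "\<And>x. x \<in> {0..1} \<Longrightarrow> \<bar>\<phi> x - g x\<bar> < \<epsilon>"
        using Stone_Weierstrass_real_polynomial_function[OF compact_Icc c \<open>\<epsilon> > 0\<close>] by blast
      then obtain a n where ga: "g = (\<lambda>x. \<Sum>i\<le>n. a i * x ^ i)"
        by (auto simp: real_polynomial_function_iff_sum)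
      have [measurable]: "g \<in> borel_measurable borel" unfolding ga by measurable
      have gi: "integrable lborel (\<lambda>t. G t * g (e t))"
      proof -
        have "(\<lambda>t. G t * g (e t)) = (\<lambda>t. \<Sum>i\<le>n. a i * (G t * e t ^ i))"
          by (auto simp: ga sum_distrib_left ac_simps)
        then show ?thesis by (auto intro!: ipow)
      qed
      have g0: "(\<integral>t. G t * g (e t) \<partial>lborel) = 0"
      proof -
        have "(\<integral>t. G t * g (e t) \<partial>lborel) = (\<integral>t. (\<Sum>i\<le>n. a i * (G t * e t ^ i)) \<partial>lborel)"
          by (auto simp: ga sum_distrib_left ac_simps)
        also have "\<dots> = 0" by (subst Bochner_Integration.integral_sum) (auto simp: pow intro!: ipow)
        finally show ?thesis .
      qed
      have di: "integrable lborel (\<lambda>t. G t * (\<phi> (e t) - g (e t)))"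
        by (rule integrable_mult_bounded[OF iG, where C=\<epsilon>]) (use g e01 in \<open>auto simp: less_imp_le\<close>)
      have "(\<integral>t. G t * \<phi> (e t) \<partial>lborel) = (\<integral>t. G t * (\<phi> (e t) - g (e t)) + G t * g (e t) \<partial>lborel)"
        by (simp add: algebra_simps)
      also have "\<dots> = (\<integral>t. G t * (\<phi> (e t) - g (e t)) \<partial>lborel)"
        using di gi g0 by simp
      also have "\<bar>\<dots>\<bar> \<le> (\<integral>t. \<bar>G t * (\<phi> (e t) - g (e t))\<bar> \<partial>lborel)" by (rule integral_abs_bound)
      also have "\<dots> \<le> (\<integral>t. \<epsilon> * \<bar>G t\<bar> \<partial>lborel)"
        using g e01 iG
        by (intro integral_mono integrable_abs di integrable_mult_right)
          (auto simp: abs_mult mult.commute[of \<epsilon>] less_imp_le intro!: mult_left_mono)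
      finally show ?thesis by (simp add: I_def)
    qed
    show ?thesis
    proof (rule ccontr)
      assume "\<not> ?thesis"
      then have p: "\<bar>\<integral>t. G t * \<phi> (e t) \<partial>lborel\<bar> > 0" (is "?J > 0") by simp
      have "?J \<le> ?J / (2 * (I + 1)) * I" by (rule bd) (use p I in auto)
      also have "\<dots> = ?J * (I / (2 * (I + 1)))" by simp
      also have "\<dots> \<le> ?J * (1/2)" using I by (intro mult_left_mono) (auto simp: field_simps)
      finally show False using p by linarith
    qed
  qed
  have "(LINT s:{0..b}|lborel. G s) = 0" if b: "0 \<le> b" for b
  proof -
    \<comment> \<open>Continuous functions decreasing to the indicator of \<open>y \<ge> exp (- b)\<close>, that is, of \<open>t \<le> b\<close>.\<close>
    define \<phi> where "\<phi> k y = max 0 (min 1 (1 + real k * (y - exp (- b))))" for k y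
    have lim: "(\<lambda>k. \<integral>t. G t * \<phi> k (e t) \<partial>lborel) \<longlonglongrightarrow> (\<integral>t. indicator {0..b} t * G t \<partial>lborel)"
    proof (rule integral_dominated_convergence[where w="\<lambda>t. \<bar>G t\<bar>"])
      show "integrable lborel (\<lambda>t. \<bar>G t\<bar>)" using iG by auto
      show "(\<lambda>t. indicator {0..b} t * G t) \<in> borel_measurable lborel" by measurable
      show "(\<lambda>t. G t * \<phi> k (e t)) \<in> borel_measurable lborel" for k unfolding \<phi>_def by measurable
      show "AE t in lborel. norm (G t * \<phi> k (e t)) \<le> \<bar>G t\<bar>" for k
        by (auto simp: \<phi>_def abs_mult intro!: mult_left_le)
      show "AE t in lborel. (\<lambda>k. G t * \<phi> k (e t)) \<longlonglongrightarrow> indicator {0..b} t * G t"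
      proof (rule AE_I2)
        fix t
        consider "t < 0" | "0 \<le> t" "t \<le> b" | "t > b" by linarith
        then show "(\<lambda>k. G t * \<phi> k (e t)) \<longlonglongrightarrow> indicator {0..b} t * G t"
        proof cases
          case 1 then show ?thesis by (simp add: Gneg)
        next
          case 2
          then have "e t \<ge> exp (- b)" using b by (auto simp: e_def)
          then have "\<phi> k (e t) = 1" for k by (auto simp: \<phi>_def)
          then show ?thesis using 2 by simp
        next
          case 3
          then have et: "e t = exp (- t)" using b by (auto simp: e_def)
          have pos: "exp (- b) - exp (- t) > 0" using 3 by simp
          then obtain N where N: "real N * (exp (- b) - exp (- t)) > 1"
            using reals_Archimedean3 by blast
          have "\<phi> k (e t) = 0" if "k \<ge> N" for k
          proof -
            have "real N * (exp (- b) - exp (- t)) \<le> real k * (exp (- b) - exp (- t))"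
              using that pos by (intro mult_right_mono) auto
            then have "1 + real k * (exp (- t) - exp (- b)) \<le> 0" using N by (simp add: algebra_simps)
            then show ?thesis by (simp add: \<phi>_def et)
          qed
          then have "eventually (\<lambda>k. G t * \<phi> k (e t) = 0) sequentially"
            unfolding eventually_sequentially by (intro exI[of _ N]) auto
          then show ?thesis using 3 by (auto intro: tendsto_eventually)
        qed
      qed
    qed
    have "(\<integral>t. G t * \<phi> k (e t) \<partial>lborel) = 0" for k
      by (rule cont) (auto simp: \<phi>_def intro!: continuous_intros)
    then have "(\<integral>t. indicator {0..b} t * G t \<partial>lborel) = 0"
      using lim by (simp add: LIMSEQ_const_iff)
    then show ?thesis by (simp add: set_lebesgue_integral_def)
  qed
  note zi = this
  have si: "set_integrable lborel {0..b} G" for b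
    unfolding set_integrable_def by (rule integrable_mult_indicator[OF _ iG]) simp
  have "continuous (at_right t) G"
    unfolding G_def using rc[of t] False by (auto intro!: continuous_intros)
  from zero_of_zero_integrals[OF si zi this] have "G t = 0" using False by simp
  then show ?thesis by (simp add: G_def)
qed (simp add: neg)

section \<open>Convolution of functions on the half-line\<close>

definition conv :: "(real \<Rightarrow> real) \<Rightarrow> (real \<Rightarrow> real) \<Rightarrow> real \<Rightarrow> real" where
  "conv f g t = (\<integral>z. f (t - z) * g z \<partial>lborel)"

text \<open>
  Functions on the half-line are represented by functions on the reals vanishing at negative arguments,
  so that their convolution is an integral over the whole line without side conditions on the range.
\<close>

definition locint :: "(real \<Rightarrow> real) \<Rightarrow> bool" where
  "locint f \<longleftrightarrow> f \<in> borel_measurable borel \<and> (\<forall>t<0. f t = 0) \<and> (\<forall>T. set_integrable lborel {..T} f)"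

definition locbdd :: "(real \<Rightarrow> real) \<Rightarrow> bool" where
  "locbdd f \<longleftrightarrow> f \<in> borel_measurable borel \<and> (\<forall>t<0. f t = 0) \<and> (\<forall>T. \<exists>C. \<forall>t\<le>T. \<bar>f t\<bar> \<le> C)"

abbreviation cut :: "real \<Rightarrow> (real \<Rightarrow> real) \<Rightarrow> real \<Rightarrow> real" where
  "cut T f \<equiv> (\<lambda>t. indicator {..T} t * f t)"

lemma locintD:
  assumes "locint f"
  shows "f \<in> borel_measurable borel" "t < 0 \<Longrightarrow> f t = 0" "set_integrable lborel {..T} f"
  using assms by (auto simp: locint_def)

lemma locbddD:
  assumes "locbdd f"
  shows "f \<in> borel_measurable borel" "t < 0 \<Longrightarrow> f t = 0" "\<exists>C. \<forall>t\<le>T. \<bar>f t\<bar> \<le> C"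
  using assms by (auto simp: locbdd_def)

lemma locbdd_imp_locint:
  assumes "locbdd f"
  shows "locint f"
  unfolding locint_def
proof (intro conjI allI)
  note [measurable] = locbddD(1)[OF assms]
  show "f \<in> borel_measurable borel" by fact
  show "t < 0 \<longrightarrow> f t = 0" for t using locbddD(2)[OF assms] by auto
  fix T
  obtain C where C: "\<forall>t\<le>T. \<bar>f t\<bar> \<le> C" using locbddD(3)[OF assms] by auto
  have "integrable lborel (\<lambda>t. indicator {0..T} t * (indicator {..T} t * f t))"
  proof (rule integrable_mult_bounded[where C="\<bar>C\<bar>"])
    show "integrable lborel (indicator {0..T} :: real \<Rightarrow> real)"
      by (rule integrable_real_indicator) (auto simp: emeasure_lborel_Icc_eq)
    show "AE x in lborel. \<bar>cut T f x\<bar> \<le> \<bar>C\<bar>"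
      using C by (intro AE_I2) (auto simp: abs_mult indicator_def intro: order_trans[OF _ abs_ge_self])
  qed auto
  also have "(\<lambda>t. indicator {0..T} t * (indicator {..T} t * f t)) = (\<lambda>t. indicator {..T} t *\<^sub>R f t)"
  proof (rule ext)
    fix t
    show "indicator {0..T} t * cut T f t = indicator {..T} t *\<^sub>R f t"
      using locbddD(2)[OF assms, of t] by (cases "t < 0") (auto simp: indicator_def)
  qed
  finally show "set_integrable lborel {..T} f" by (simp add: set_integrable_def)
qed

lemma integrable_cut: "locint f \<Longrightarrow> integrable lborel (cut T f)"
  using locintD(3)[of f T] by (simp add: set_integrable_def)

lemma conv_commute: "conv f g t = conv g f t"
proof -
  have "conv f g t = (\<integral>z. f (t - (t + (-1) * z)) * g (t + (-1) * z) \<partial>lborel)"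
    unfolding conv_def by (subst lborel_integral_real_affine[where c="-1" and t=t]) auto
  also have "\<dots> = conv g f t" by (simp add: conv_def mult.commute)
  finally show ?thesis .
qed

text \<open>
  The value of a convolution at \<open>t\<close> depends only on the factors up to \<open>t\<close>. Thus locally integrable
  functions may be truncated, and Fubini's theorem applied to integrable ones.
\<close>

lemma conv_cut:
  assumes "\<And>t. t < 0 \<Longrightarrow> f t = 0" "\<And>t. t < 0 \<Longrightarrow> g t = 0" "t \<le> T"
  shows "conv (cut T f) (cut T g) t = conv f g t"
  unfolding conv_def
proof (rule Bochner_Integration.integral_cong)
  fix z
  show "cut T f (t - z) * cut T g z = f (t - z) * g z"
    using assms by (cases "z < 0"; cases "z > t") (auto simp: indicator_def)
qed simp

lemma conv_neg:
  assumes "\<And>t. t < 0 \<Longrightarrow> f t = 0" "\<And>t. t < 0 \<Longrightarrow> g t = 0" "t < 0"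
  shows "conv f g t = 0"
proof -
  have "f (t - z) * g z = 0" for z using assms by (cases "z < 0") auto
  then show ?thesis unfolding conv_def by (metis (no_types, lifting) Bochner_Integration.integral_cong integral_zero)
qed

lemma conv_integrable:
  assumes f: "locbdd f" and g: "locint g"
  shows "integrable lborel (\<lambda>z. f (t - z) * g z)"
proof -
  note [measurable] = locbddD(1)[OF f] locintD(1)[OF g]
  obtain C where C: "\<forall>s\<le>t. \<bar>f s\<bar> \<le> C" using locbddD(3)[OF f] by auto
  have "integrable lborel (\<lambda>z. cut t g z * (if z < 0 then 0 else f (t - z)))"
    by (rule integrable_mult_bounded[OF integrable_cut[OF g], where C="\<bar>C\<bar>"])
      (use C in \<open>auto intro!: order_trans[OF _ abs_ge_self]\<close>)
  also have "(\<lambda>z. cut t g z * (if z < 0 then 0 else f (t - z))) = (\<lambda>z. f (t - z) * g z)"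
    using locbddD(2)[OF f] locintD(2)[OF g] by (auto simp: fun_eq_iff indicator_def)
  finally show ?thesis .
qed

lemma conv_measurable[measurable]:
  assumes [measurable]: "f \<in> borel_measurable borel" "g \<in> borel_measurable borel"
  shows "conv f g \<in> borel_measurable borel"
  unfolding conv_def by measurable

lemma conv_locbdd:
  assumes f: "locbdd f" and g: "locint g"
  shows "locbdd (conv f g)"
  unfolding locbdd_def
proof (intro conjI allI)
  note [measurable] = locbddD(1)[OF f] locintD(1)[OF g]
  show "conv f g \<in> borel_measurable borel" by measurable
  show "t < 0 \<longrightarrow> conv f g t = 0" for t
    using conv_neg[of f g t] locbddD(2)[OF f] locintD(2)[OF g] by auto
  fix T
  obtain C where C: "\<forall>s\<le>T. \<bar>f s\<bar> \<le> C" using locbddD(3)[OF f] by auto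
  have "\<bar>conv f g t\<bar> \<le> (\<integral>z. \<bar>C\<bar> * \<bar>cut T g z\<bar> \<partial>lborel)" if t: "t \<le> T" for t
  proof -
    have "\<bar>conv f g t\<bar> \<le> (\<integral>z. \<bar>f (t - z) * g z\<bar> \<partial>lborel)"
      unfolding conv_def by (rule integral_abs_bound)
    also have "\<dots> \<le> (\<integral>z. \<bar>C\<bar> * \<bar>cut T g z\<bar> \<partial>lborel)"
    proof (rule integral_mono)
      show "integrable lborel (\<lambda>z. \<bar>f (t - z) * g z\<bar>)" using conv_integrable[OF f g] by auto
      show "integrable lborel (\<lambda>z. \<bar>C\<bar> * \<bar>cut T g z\<bar>)" using integrable_cut[OF g] by auto
      fix z
      have "\<bar>f (t - z)\<bar> \<le> \<bar>C\<bar>" if "0 \<le> z" using C[rule_format, of "t - z"] t that by auto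
      then show "\<bar>f (t - z) * g z\<bar> \<le> \<bar>C\<bar> * \<bar>cut T g z\<bar>"
        using locbddD(2)[OF f, of "t - z"] locintD(2)[OF g, of z] t
        by (cases "z < 0"; cases "z > t") (auto simp: abs_mult indicator_def intro!: mult_right_mono)
    qed
    finally show ?thesis .
  qed
  then show "\<exists>C. \<forall>t\<le>T. \<bar>conv f g t\<bar> \<le> C" by blast
qed

lemma conv_pair_integrable:
  fixes g h :: "real \<Rightarrow> real"
  assumes g: "integrable lborel g" and h: "integrable lborel h"
  shows "integrable (lborel \<Otimes>\<^sub>M lborel) (\<lambda>(r, s). g (s - r) * h r)"
proof (rule lborel_pair.Fubini_integrable)
  have [measurable]: "g \<in> borel_measurable borel" "h \<in> borel_measurable borel" using g h by auto
  show "(\<lambda>(r, s). g (s - r) * h r) \<in> borel_measurable (lborel \<Otimes>\<^sub>M lborel)" by measurable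
  have i: "integrable lborel (\<lambda>s. g (s - r))" for r
    using lborel_integrable_real_affine[OF g, of 1 "-r"] by simp
  then show "AE r in lborel. integrable lborel (\<lambda>s. case (r, s) of (r, s) \<Rightarrow> g (s - r) * h r)"
    by auto
  have "(\<integral>s. norm (g (s - r) * h r) \<partial>lborel) = (\<integral>s. \<bar>g s\<bar> \<partial>lborel) * \<bar>h r\<bar>" for r
    by (subst (2) lborel_integral_real_affine[where c=1 and t="-r"]) (auto simp: abs_mult)
  then show "integrable lborel (\<lambda>r. \<integral>s. norm (case (r, s) of (r, s) \<Rightarrow> g (s - r) * h r) \<partial>lborel)"
    using h by auto
qed

lemma integral_conv:
  fixes g h :: "real \<Rightarrow> real"
  assumes g: "integrable lborel g" and h: "integrable lborel h"
  shows "integrable lborel (conv g h)"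
    and "(\<integral>t. conv g h t \<partial>lborel) = (\<integral>t. g t \<partial>lborel) * (\<integral>t. h t \<partial>lborel)"
proof -
  note p = conv_pair_integrable[OF g h]
  show "integrable lborel (conv g h)"
    using lborel_pair.integrable_snd[OF p] unfolding conv_def by simp
  have "(\<integral>t. conv g h t \<partial>lborel) = (\<integral>r. (\<integral>s. g (s - r) * h r \<partial>lborel) \<partial>lborel)"
    unfolding conv_def using lborel_pair.Fubini_integral[OF p] by simp
  also have "\<dots> = (\<integral>r. (\<integral>s. g s \<partial>lborel) * h r \<partial>lborel)"
  proof (rule Bochner_Integration.integral_cong)
    fix r
    have "(\<integral>s. g s \<partial>lborel) = (\<integral>s. g (s - r) \<partial>lborel)"
      by (subst lborel_integral_real_affine[where c=1 and t="-r"]) auto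
    then show "(\<integral>s. g (s - r) * h r \<partial>lborel) = (\<integral>s. g s \<partial>lborel) * h r" by simp
  qed simp
  finally show "(\<integral>t. conv g h t \<partial>lborel) = (\<integral>t. g t \<partial>lborel) * (\<integral>t. h t \<partial>lborel)" by simp
qed

lemma conv_assoc_integrable:
  fixes f g h :: "real \<Rightarrow> real"
  assumes [measurable]: "f \<in> borel_measurable borel" and f: "\<And>t. \<bar>f t\<bar> \<le> C"
    and g: "integrable lborel g" and h: "integrable lborel h"
  shows "conv f (conv g h) t = conv (conv f g) h t"
proof -
  have [measurable]: "g \<in> borel_measurable borel" "h \<in> borel_measurable borel" using g h by auto
  have "integrable (lborel \<Otimes>\<^sub>M lborel) (\<lambda>x. (case x of (r, s) \<Rightarrow> g (s - r) * h r) * (case x of (r, s) \<Rightarrow> f (t - s)))"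
    by (rule integrable_mult_bounded[OF conv_pair_integrable[OF g h], where C=C]) (use f in auto)
  then have p: "integrable (lborel \<Otimes>\<^sub>M lborel) (\<lambda>(r, s). f (t - s) * (g (s - r) * h r))"
    by (simp add: split_beta' mult.commute)
  have "conv f (conv g h) t = (\<integral>s. (\<integral>r. f (t - s) * (g (s - r) * h r) \<partial>lborel) \<partial>lborel)"
    unfolding conv_def by simp
  also have "\<dots> = (\<integral>r. (\<integral>s. f (t - s) * (g (s - r) * h r) \<partial>lborel) \<partial>lborel)"
    using lborel_pair.Fubini_integral[OF p] by simp
  also have "\<dots> = (\<integral>r. conv f g (t - r) * h r \<partial>lborel)"
  proof (rule Bochner_Integration.integral_cong)
    fix r
    have "(\<integral>s. f (t - s) * (g (s - r) * h r) \<partial>lborel) = (\<integral>s. f (t - r - s) * g s * h r \<partial>lborel)"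
      by (subst lborel_integral_real_affine[where c=1 and t=r]) (auto simp: algebra_simps)
    then show "(\<integral>s. f (t - s) * (g (s - r) * h r) \<partial>lborel) = conv f g (t - r) * h r"
      by (simp add: conv_def)
  qed simp
  also have "\<dots> = conv (conv f g) h t" by (simp add: conv_def)
  finally show ?thesis .
qed

lemma conv_assoc:
  assumes f: "locbdd f" and g: "locint g" and h: "locint h"
  shows "conv f (conv g h) t = conv (conv f g) h t"
proof -
  note [measurable] = locbddD(1)[OF f] locintD(1)[OF g] locintD(1)[OF h]
  note neg = locbddD(2)[OF f] locintD(2)[OF g] locintD(2)[OF h]
  obtain C where C: "\<forall>s\<le>t. \<bar>f s\<bar> \<le> C" using locbddD(3)[OF f] by auto
  have "conv f (conv g h) t = conv (cut t f) (conv (cut t g) (cut t h)) t"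
    unfolding conv_def[of f] conv_def[of "cut t f"]
  proof (rule Bochner_Integration.integral_cong)
    fix z
    show "f (t - z) * conv g h z = cut t f (t - z) * conv (cut t g) (cut t h) z"
      using conv_cut[of g h z t] conv_neg[of g h z] neg
      by (cases "z < 0"; cases "z > t") (auto simp: indicator_def not_less)
  qed simp
  also have "\<dots> = conv (conv (cut t f) (cut t g)) (cut t h) t"
    by (rule conv_assoc_integrable[where C="\<bar>C\<bar>"])
      (use C integrable_cut[OF g] integrable_cut[OF h] in
        \<open>auto simp: abs_mult indicator_def intro: order_trans[OF _ abs_ge_self]\<close>)
  also have "\<dots> = conv (conv f g) h t"
    unfolding conv_def[of "conv f g"] conv_def[of "conv (cut t f) (cut t g)"]
  proof (rule Bochner_Integration.integral_cong)
    fix z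
    show "conv (cut t f) (cut t g) (t - z) * cut t h z = conv f g (t - z) * h z"
      using conv_cut[of f g "t - z" t] conv_neg[of f g "t - z"] neg
      by (cases "z < 0"; cases "z > t") (auto simp: indicator_def not_less)
  qed simp
  finally show ?thesis .
qed

lemma conv_right_continuous:
  assumes w: "locbdd w" and k: "locint k" and rc: "\<And>t. continuous (at_right t) w"
  shows "continuous (at_right t) (conv w k)"
  unfolding continuous_within
proof (rule tendsto_at_right_sequentially[of t "t + 1"])
  note [measurable] = locbddD(1)[OF w] locintD(1)[OF k]
  fix S :: "nat \<Rightarrow> real"
  assume S: "\<And>n. t < S n" "\<And>n. S n < t + 1" "S \<longlonglongrightarrow> t"
  obtain C where C: "\<forall>s\<le>t+1. \<bar>w s\<bar> \<le> C" using locbddD(3)[OF w] by auto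
  show "(\<lambda>n. conv w k (S n)) \<longlonglongrightarrow> conv w k t"
    unfolding conv_def
  proof (rule integral_dominated_convergence[where w="\<lambda>z. \<bar>C\<bar> * \<bar>cut (t+1) k z\<bar>"])
    show "integrable lborel (\<lambda>z. \<bar>C\<bar> * \<bar>cut (t+1) k z\<bar>)" using integrable_cut[OF k] by auto
    show "AE z in lborel. (\<lambda>n. w (S n - z) * k z) \<longlonglongrightarrow> w (t - z) * k z"
    proof (rule AE_I2)
      fix z
      have "filterlim (\<lambda>n. S n - z) (at_right (t - z)) sequentially"
        using S by (auto simp: filterlim_at intro!: tendsto_intros always_eventually)
      with rc[of "t - z"] have "(\<lambda>n. w (S n - z)) \<longlonglongrightarrow> w (t - z)"
        unfolding continuous_within by (rule filterlim_compose)
      then show "(\<lambda>n. w (S n - z) * k z) \<longlonglongrightarrow> w (t - z) * k z" by (intro tendsto_intros)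
    qed
    show "AE z in lborel. norm (w (S n - z) * k z) \<le> \<bar>C\<bar> * \<bar>cut (t+1) k z\<bar>" for n
    proof (rule AE_I2)
      fix z
      have "\<bar>w (S n - z)\<bar> \<le> \<bar>C\<bar>" if "0 \<le> z" using C[rule_format, of "S n - z"] S(2)[of n] that by auto
      then show "norm (w (S n - z) * k z) \<le> \<bar>C\<bar> * \<bar>cut (t+1) k z\<bar>"
        using locbddD(2)[OF w, of "S n - z"] locintD(2)[OF k, of z] S(2)[of n]
        by (cases "z < 0"; cases "z > S n") (auto simp: abs_mult indicator_def intro!: mult_right_mono)
    qed
  qed measurable
qed simp

lemma set_integral_eq_conv:
  assumes "\<And>t. t < 0 \<Longrightarrow> k t = 0"
  shows "(LINT s:{0..t}|lborel. k (t - s) * d s) = conv k (\<lambda>s. indicator {0..} s * d s) t"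
  unfolding conv_def set_lebesgue_integral_def
  by (rule Bochner_Integration.integral_cong) (use assms in \<open>auto simp: indicator_def\<close>)

section \<open>Laplace transforms of convolutions and derivatives\<close>

definition heaviside :: "real \<Rightarrow> real" where "heaviside t = indicator {0..} t"

lemma heaviside_locbdd: "locbdd heaviside"
  unfolding locbdd_def
proof (intro conjI allI impI)
  show "heaviside \<in> borel_measurable borel" unfolding heaviside_def[abs_def] by measurable
  show "\<exists>C. \<forall>t\<le>T. \<bar>heaviside t\<bar> \<le> C" for T by (rule exI[of _ 1]) (simp add: heaviside_def indicator_def)
qed (simp add: heaviside_def)

lemma heaviside_rc: "continuous (at_right t) heaviside"
proof (cases "t < 0")
  case True
  have "eventually (\<lambda>s. heaviside s = 0) (at_right t)"
    unfolding eventually_at_right_field using True by (intro exI[of _ 0]) (auto simp: heaviside_def)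
  then show ?thesis using True by (auto simp: continuous_within heaviside_def intro: tendsto_eventually)
next
  case False
  have "eventually (\<lambda>s. heaviside s = 1) (at_right t)"
    unfolding eventually_at_right_field using False by (intro exI[of _ "t+1"]) (auto simp: heaviside_def)
  then show ?thesis using False by (auto simp: continuous_within heaviside_def intro: tendsto_eventually)
qed

lemma conv_heaviside_heaviside: "conv heaviside heaviside t = max 0 t"
proof -
  have "conv heaviside heaviside t = (\<integral>z. indicator {0..t} z \<partial>lborel)"
    unfolding conv_def heaviside_def by (intro Bochner_Integration.integral_cong) (auto simp: indicator_def)
  then show ?thesis by simp
qed

lemma exp_atLeast_integral:
  fixes x a :: real
  assumes x: "0 < x"
  shows "integrable lborel (\<lambda>t. indicator {a..} t * exp (- x * t))"
    and "(\<integral>t. indicator {a..} t * exp (- x * t) \<partial>lborel) = exp (- x * a) / x"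
proof -
  have "(\<integral>\<^sup>+ t. ennreal (exp (- x * t)) * indicator {a..} t \<partial>lborel) = ennreal (0 - (- exp (- x * a) / x))"
  proof (rule nn_integral_FTC_atLeast)
    show "((\<lambda>t. - exp (- x * t) / x) \<longlongrightarrow> 0) at_top" using x by real_asymp
  qed (use x in \<open>auto intro!: derivative_eq_intros\<close>)
  also have "(\<integral>\<^sup>+ t. ennreal (exp (- x * t)) * indicator {a..} t \<partial>lborel)
     = (\<integral>\<^sup>+ t. ennreal (indicator {a..} t * exp (- x * t)) \<partial>lborel)"
    by (intro nn_integral_cong) (simp add: indicator_def)
  finally have "has_bochner_integral lborel (\<lambda>t. indicator {a..} t * exp (- x * t)) (exp (- x * a) / x)"
    using x by (intro has_bochner_integral_nn_integral) auto
  then show "integrable lborel (\<lambda>t. indicator {a..} t * exp (- x * t))"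
    "(\<integral>t. indicator {a..} t * exp (- x * t) \<partial>lborel) = exp (- x * a) / x"
    by (auto simp: has_bochner_integral_iff)
qed

lemma exp_mult_conv:
  fixes x t :: real
  shows "exp (- x * t) * conv f g t = conv (\<lambda>t. exp (- x * t) * f t) (\<lambda>t. exp (- x * t) * g t) t"
proof -
  have e: "exp (- x * t) = exp (- x * (t - z)) * exp (- x * z)" for z
    by (simp add: exp_add[symmetric] algebra_simps)
  have "exp (- x * t) * conv f g t = (\<integral>z. exp (- x * t) * (f (t - z) * g z) \<partial>lborel)"
    by (simp add: conv_def)
  also have "\<dots> = conv (\<lambda>t. exp (- x * t) * f t) (\<lambda>t. exp (- x * t) * g t) t"
    unfolding conv_def
  proof (intro Bochner_Integration.integral_cong refl)
    fix z
    show "exp (- x * t) * (f (t - z) * g z) = exp (- x * (t - z)) * f (t - z) * (exp (- x * z) * g z)"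
      by (subst e[of z]) (simp only: mult_ac)
  qed
  finally show ?thesis .
qed

lemma laplace_conv:
  assumes "integrable lborel (\<lambda>t. exp (- x * t) * f t)" "integrable lborel (\<lambda>t. exp (- x * t) * g t)"
  shows "integrable lborel (\<lambda>t. exp (- x * t) * conv f g t)"
    and "(\<integral>t. exp (- x * t) * conv f g t \<partial>lborel)
      = (\<integral>t. exp (- x * t) * f t \<partial>lborel) * (\<integral>t. exp (- x * t) * g t \<partial>lborel)"
  using integral_conv[OF assms] by (simp_all only: exp_mult_conv)

lemma laplace_heaviside:
  assumes "0 < x"
  shows "integrable lborel (\<lambda>t. exp (- x * t) * heaviside t)" "(\<integral>t. exp (- x * t) * heaviside t \<partial>lborel) = 1 / x"
proof -
  have e: "exp (- x * t) * heaviside t = indicator {0..} t * exp (- x * t)" for t by (simp add: heaviside_def)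
  show "integrable lborel (\<lambda>t. exp (- x * t) * heaviside t)" "(\<integral>t. exp (- x * t) * heaviside t \<partial>lborel) = 1 / x"
    using exp_atLeast_integral[OF assms, of 0] unfolding e by auto
qed

text \<open>
  The exponential bound with rate \<open>c < F\<close> removes the boundary term at infinity.
\<close>

lemma laplace_by_parts:
  fixes h h' :: "real \<Rightarrow> real"
  assumes h: "\<And>s. (h has_real_derivative h' s) (at s)" and h': "\<And>s. isCont h' s"
    and bd: "\<And>s. 0 \<le> s \<Longrightarrow> \<bar>h s\<bar> \<le> C * exp (c * s)" "\<And>s. 0 \<le> s \<Longrightarrow> \<bar>h' s\<bar> \<le> C * exp (c * s)"
    and F: "c < F"
  shows "(\<integral>s. indicator {0<..} s * h' s * exp (- s * F) \<partial>lborel)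
    = F * (\<integral>s. indicator {0<..} s * h s * exp (- s * F) \<partial>lborel) - h 0"
proof -
  have contD: "continuous_on UNIV h" "continuous_on UNIV h'"
    using h h' by (auto intro: DERIV_continuous_on continuous_at_imp_continuous_on)
  have int: "integrable lborel (\<lambda>s. indicator {0<..} s * r s * exp (- s * F))"
    if r: "\<And>s. 0 \<le> s \<Longrightarrow> \<bar>r s\<bar> \<le> C * exp (c * s)" "continuous_on UNIV r" for r
  proof (rule Bochner_Integration.integrable_bound)
    show "integrable lborel (\<lambda>s. C * (indicator {0..} s * exp (- (F - c) * s)))"
      using exp_atLeast_integral(1)[of "F - c" 0] F by auto
    show "(\<lambda>s. indicator {0<..} s * r s * exp (- s * F)) \<in> borel_measurable lborel"
      using borel_measurable_continuous_onI[OF r(2)] by measurable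
    show "AE s in lborel. norm (indicator {0<..} s * r s * exp (- s * F))
      \<le> norm (C * (indicator {0..} s * exp (- (F - c) * s)))"
    proof (rule AE_I2)
      fix s
      show "norm (indicator {0<..} s * r s * exp (- s * F)) \<le> norm (C * (indicator {0..} s * exp (- (F - c) * s)))"
      proof (cases "0 < s")
        case True
        have "\<bar>r s\<bar> * exp (- s * F) \<le> C * exp (c * s) * exp (- s * F)"
          using r(1)[of s] True by (intro mult_right_mono) auto
        also have "\<dots> = C * exp (- (F - c) * s)" by (simp add: exp_add[symmetric] algebra_simps)
        also have "\<dots> \<le> \<bar>C\<bar> * exp (- (F - c) * s)" by (intro mult_right_mono) auto
        finally show ?thesis using True by (simp add: abs_mult)
      qed simp
    qed
  qed
  note i = int[OF bd(1) contD(1)] int[OF bd(2) contD(2)]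
  define G where "G s = h s * exp (- s * F)" for s
  define G' where "G' s = h' s * exp (- s * F) - F * (h s * exp (- s * F))" for s
  have lim: "(G \<longlongrightarrow> 0) at_top"
  proof (rule Lim_null_comparison)
    have "eventually (\<lambda>s::real. 0 \<le> s) at_top" by (rule eventually_ge_at_top)
    then show "eventually (\<lambda>s. norm (G s) \<le> C * exp (- (F - c) * s)) at_top"
    proof eventually_elim
      case (elim s)
      have "\<bar>h s\<bar> * exp (- s * F) \<le> C * exp (c * s) * exp (- s * F)"
        using bd(1)[of s] elim by (intro mult_right_mono) auto
      also have "\<dots> = C * exp (- (F - c) * s)" by (simp add: exp_add[symmetric] algebra_simps)
      finally show ?case by (simp add: G_def abs_mult)
    qed
    have "((\<lambda>s. exp (- (F - c) * s)) \<longlongrightarrow> 0) at_top" using F by real_asymp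
    then show "((\<lambda>s. C * exp (- (F - c) * s)) \<longlongrightarrow> 0) at_top" by (rule tendsto_mult_right_zero)
  qed
  have "(LBINT s=0..\<infinity>. G' s) = 0 - G 0"
  proof (rule interval_integral_FTC_integrable)
    show "(G has_vector_derivative G' s) (at s)" for s
      unfolding G_def[abs_def] G'_def
      by (rule has_real_derivative_iff_has_vector_derivative[THEN iffD1])
        (auto intro!: derivative_eq_intros h)
    show "isCont G' s" for s
      unfolding G'_def[abs_def] using h' DERIV_isCont[OF h] by (intro continuous_intros) auto
    show "set_integrable lborel (einterval 0 \<infinity>) G'"
    proof -
      have e: "einterval 0 \<infinity> = {0::real<..}" by (auto simp: einterval_def zero_ereal_def)
      have "integrable lborel (\<lambda>s. indicator {0<..} s * h' s * exp (- s * F)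
          - F * (indicator {0<..} s * h s * exp (- s * F)))" using i by simp
      then show ?thesis unfolding set_integrable_def e G'_def by (simp add: algebra_simps)
    qed
    have "isCont G 0"
      unfolding G_def[abs_def] using DERIV_isCont[OF h] by (intro continuous_intros) auto
    then have "(G \<longlongrightarrow> G 0) (at_right 0)"
      by (simp add: isCont_def filterlim_at_split)
    then show "((G \<circ> real_of_ereal) \<longlongrightarrow> G 0) (at_right 0)"
      unfolding zero_ereal_def by (rule ereal_tendsto_simps1(2)[THEN iffD2])
    show "((G \<circ> real_of_ereal) \<longlongrightarrow> 0) (at_left \<infinity>)"
      by (rule ereal_tendsto_simps1(3)[THEN iffD2, OF lim])
  qed auto
  also have "(LBINT s=0..\<infinity>. G' s) = (\<integral>s. indicator {0<..} s * G' s \<partial>lborel)"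
  proof -
    have e: "einterval 0 \<infinity> = {0::real<..}" by (auto simp: einterval_def zero_ereal_def)
    show ?thesis unfolding interval_lebesgue_integral_def set_lebesgue_integral_def e by simp
  qed
  also have "\<dots> = (\<integral>s. indicator {0<..} s * h' s * exp (- s * F)
          - F * (indicator {0<..} s * h s * exp (- s * F)) \<partial>lborel)"
    by (intro Bochner_Integration.integral_cong) (auto simp: G'_def algebra_simps)
  also have "\<dots> = (\<integral>s. indicator {0<..} s * h' s * exp (- s * F) \<partial>lborel)
    - F * (\<integral>s. indicator {0<..} s * h s * exp (- s * F) \<partial>lborel)" using i by simp
  finally show ?thesis by (simp add: G_def)
qed

section \<open>Infinite Levy measures and their tails\<close>

text \<open>
  A Levy measure is kept as a measure on all Borel sets of the line, concentrated on the positive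
  half-line: then measurability of functions of two variables is the usual one on the plane.
\<close>

locale levy_measure =
  fixes \<nu> :: "real measure"
  assumes sets_nu[measurable_cong]: "sets \<nu> = sets borel"
    and null_nonpos: "emeasure \<nu> {..0} = 0"
    and min_finite: "(\<integral>\<^sup>+ y. ennreal (min y 1) \<partial>\<nu>) < \<infinity>"
    and infinite: "emeasure \<nu> UNIV = \<infinity>"
begin

abbreviation k :: "real \<Rightarrow> real" where "k \<equiv> levy_tail \<nu>"

lemma space_nu[simp]: "space \<nu> = UNIV"
  using sets_eq_imp_space_eq[OF sets_nu] by simp

lemma AE_pos: "AE y in \<nu>. 0 < y"
  by (rule AE_I[of _ _ "{..0}"]) (auto simp: null_nonpos sets_nu)

lemma emeasure_tail_finite:
  assumes "0 < s"
  shows "emeasure \<nu> {s<..} < \<infinity>"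
proof -
  have "ennreal (min s 1) * emeasure \<nu> {s<..} = (\<integral>\<^sup>+ y. ennreal (min s 1) * indicator {s<..} y \<partial>\<nu>)"
    by (subst nn_integral_cmult_indicator) auto
  also have "\<dots> \<le> (\<integral>\<^sup>+ y. ennreal (min y 1) \<partial>\<nu>)"
    by (intro nn_integral_mono) (auto simp: indicator_def intro!: ennreal_leI)
  also have "\<dots> < \<infinity>" by (rule min_finite)
  finally show ?thesis using assms
    by (auto simp: ennreal_mult_less_top ennreal_eq_0_iff min_le_iff_disj)
qed

lemma emeasure_tail: "0 < s \<Longrightarrow> emeasure \<nu> {s<..} = ennreal (k s)"
  using emeasure_tail_finite[of s] unfolding levy_tail_def
  by (intro emeasure_eq_ennreal_measure) auto

lemma emeasure_pos: "emeasure \<nu> {0<..} = \<infinity>"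
proof -
  have "emeasure \<nu> UNIV = emeasure \<nu> {..0} + emeasure \<nu> {0<..}"
    by (subst plus_emeasure) (auto simp: sets_nu intro!: arg_cong[where f="emeasure \<nu>"])
  then show ?thesis using null_nonpos infinite by simp
qed

text \<open>
  The measure of an infinite set is \<open>0\<close> by convention, so the tail is causal although
  its limit at \<open>0\<close> from the right is infinite.
\<close>

lemma tail_nonpos:
  assumes "s \<le> 0"
  shows "k s = 0"
proof -
  have "emeasure \<nu> {0<..} \<le> emeasure \<nu> {s<..}" using assms by (intro emeasure_mono) (auto simp: sets_nu)
  then show ?thesis by (simp add: emeasure_pos levy_tail_def measure_def top_unique)
qed

lemma tail_nonneg: "0 \<le> k s" by (simp add: levy_tail_def)

lemma tail_antimono:
  assumes "0 < s" "s \<le> t"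
  shows "k t \<le> k s"
proof -
  have "ennreal (k t) \<le> ennreal (k s)"
    using assms by (simp add: emeasure_tail[symmetric]) (intro emeasure_mono, auto simp: sets_nu)
  then show ?thesis by (simp add: tail_nonneg)
qed

lemma tail_measurable[measurable]: "k \<in> borel_measurable borel"
proof -
  \<comment> \<open>The tail is monotone on the positive half-line only, hence the change of variables.\<close>
  have "mono (\<lambda>x. - k (exp x))" by (intro monoI) (simp add: tail_antimono)
  then have [measurable]: "(\<lambda>x. - k (exp x)) \<in> borel_measurable borel" by (rule borel_measurable_mono)
  have "k = (\<lambda>x. if x \<le> 0 then 0 else - (- k (exp (ln x))))" by (auto simp: tail_nonpos)
  also have "\<dots> \<in> borel_measurable borel" by measurable
  finally show ?thesis .
qed

lemma tail_unbounded: "\<exists>\<eta>>0. \<eta> < a \<and> C < k \<eta>" if "0 < a"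
proof -
  have "(\<lambda>n. emeasure \<nu> {1 / real (Suc n)<..}) \<longlonglongrightarrow> emeasure \<nu> (\<Union>n. {1 / real (Suc n)<..})"
    by (intro Lim_emeasure_incseq)
      (auto simp: incseq_def sets_nu intro: le_less_trans[rotated] simp: frac_le)
  also have "(\<Union>n. {1 / real (Suc n)<..}) = {0::real<..}"
  proof (intro set_eqI iffI)
    fix x :: real assume "x \<in> {0<..}"
    then obtain n where "1 / real (Suc n) < x" using nat_approx_posE by auto
    then show "x \<in> (\<Union>n. {1 / real (Suc n)<..})" by auto
  qed (auto intro: less_trans[rotated])
  finally have lim: "(\<lambda>n. emeasure \<nu> {1 / real (Suc n)<..}) \<longlonglongrightarrow> \<infinity>" using emeasure_pos by simp
  have "eventually (\<lambda>n. ennreal \<bar>C\<bar> < emeasure \<nu> {1 / real (Suc n)<..}) sequentially"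
    by (rule order_tendstoD[OF lim]) simp
  moreover have "eventually (\<lambda>n. 1 / real (Suc n) < a) sequentially"
    by (rule order_tendstoD(2)[OF LIMSEQ_Suc[OF lim_1_over_n] that])
  ultimately have "eventually (\<lambda>n. ennreal \<bar>C\<bar> < emeasure \<nu> {1 / real (Suc n)<..} \<and> 1 / real (Suc n) < a) sequentially"
    by eventually_elim simp
  then obtain n where n: "ennreal \<bar>C\<bar> < emeasure \<nu> {1 / real (Suc n)<..}" "1 / real (Suc n) < a"
    using eventually_happens'[OF sequentially_bot] by blast
  then have "\<bar>C\<bar> < k (1 / real (Suc n))"
    by (subst (asm) emeasure_tail) (auto simp: ennreal_less_iff)
  then show ?thesis using n by (intro exI[of _ "1 / real (Suc n)"]) auto
qed

lemma sigma_finite: "sigma_finite_measure \<nu>"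
proof
  define A where "A = insert {..0} (range (\<lambda>n. {1 / real (Suc n)<..}))"
  have "x \<in> \<Union>A" for x
  proof (cases "x \<le> 0")
    case False
    then obtain n where "1 / real (Suc n) < x" using nat_approx_posE[of x] by auto
    then show ?thesis by (auto simp: A_def)
  qed (auto simp: A_def)
  moreover have "emeasure \<nu> a \<noteq> \<infinity>" if "a \<in> A" for a
  proof -
    have "emeasure \<nu> {1 / real (Suc n)<..} \<noteq> \<infinity>" for n
      using emeasure_tail_finite[of "1 / real (Suc n)"] by simp
    then show ?thesis using that by (auto simp: A_def null_nonpos)
  qed
  moreover have "countable A" "A \<subseteq> sets \<nu>" by (auto simp: A_def sets_nu)
  ultimately show "\<exists>A. countable A \<and> A \<subseteq> sets \<nu> \<and> \<Union>A = space \<nu> \<and> (\<forall>a\<in>A. emeasure \<nu> a \<noteq> \<infinity>)"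
    by (intro exI[of _ A]) auto
qed

sublocale nu: sigma_finite_measure \<nu> by (rule sigma_finite)
sublocale pair: pair_sigma_finite lborel \<nu> ..

lemma tail_eq_nn_integral: "ennreal (k z) * indicator {0<..} z = (\<integral>\<^sup>+ y. indicator {0<..<y} z \<partial>\<nu>)"
proof (cases "0 < z")
  case True
  have "(\<integral>\<^sup>+ y. indicator {0<..<y} z \<partial>\<nu>) = (\<integral>\<^sup>+ y. indicator {z<..} y \<partial>\<nu>)"
    using True by (intro nn_integral_cong) (auto simp: indicator_def)
  then show ?thesis using True by (simp add: emeasure_tail sets_nu)
qed (simp add: tail_nonpos)

text \<open>
  Fubini's theorem, with \<open>k z\<close> read as the integral over \<open>y\<close> of the indicator of \<open>z < y\<close>.
\<close>

lemma tail_nn_integral: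
  assumes [measurable]: "g \<in> borel_measurable borel"
  shows "(\<integral>\<^sup>+ z. ennreal (k z) * g z \<partial>lborel) = (\<integral>\<^sup>+ y. (\<integral>\<^sup>+ z. indicator {0<..<y} z * g z \<partial>lborel) \<partial>\<nu>)"
proof -
  have "(\<integral>\<^sup>+ z. ennreal (k z) * g z \<partial>lborel) = (\<integral>\<^sup>+ z. (\<integral>\<^sup>+ y. indicator {0<..<y} z * g z \<partial>\<nu>) \<partial>lborel)"
  proof (rule nn_integral_cong)
    fix z :: real
    have "ennreal (k z) * g z = (ennreal (k z) * indicator {0<..} z) * g z"
      by (cases "0 < z") (auto simp: tail_nonpos)
    also have "\<dots> = (\<integral>\<^sup>+ y. indicator {0<..<y} z * g z \<partial>\<nu>)"
      unfolding tail_eq_nn_integral by (rule nn_integral_multc[symmetric]) (auto simp: indicator_def)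
    finally show "ennreal (k z) * g z = (\<integral>\<^sup>+ y. indicator {0<..<y} z * g z \<partial>\<nu>)" .
  qed
  also have "\<dots> = (\<integral>\<^sup>+ y. (\<integral>\<^sup>+ z. indicator {0<..<y} z * g z \<partial>lborel) \<partial>\<nu>)"
  proof (rule pair.Fubini'[symmetric])
    have "(\<lambda>x. (if 0 < fst x \<and> fst x < snd x then 1 else 0) * g (fst x)) \<in> borel_measurable (lborel \<Otimes>\<^sub>M \<nu>)"
      by measurable
    then show "(\<lambda>(z, y). indicator {0<..<y} z * g z) \<in> borel_measurable (lborel \<Otimes>\<^sub>M \<nu>)"
      by (simp add: indicator_def split_beta' cong: if_cong)
  qed
  finally show ?thesis .
qed

lemma tail_integral:
  fixes \<xi> :: "real \<Rightarrow> real"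
  assumes int: "integrable lborel (\<lambda>z. k z * \<xi> z)" and [measurable]: "\<xi> \<in> borel_measurable borel"
  shows "integrable \<nu> (\<lambda>y. \<integral>z. indicator {0<..<y} z * \<xi> z \<partial>lborel)"
    and "(\<integral>z. k z * \<xi> z \<partial>lborel) = (\<integral>y. (\<integral>z. indicator {0<..<y} z * \<xi> z \<partial>lborel) \<partial>\<nu>)"
proof -
  have "(\<lambda>x. (if 0 < fst x \<and> fst x < snd x then 1 else 0) * \<xi> (fst x)) \<in> borel_measurable (lborel \<Otimes>\<^sub>M \<nu>)"
    by measurable
  then have m: "(\<lambda>(z, y). indicator {0<..<y} z * \<xi> z) \<in> borel_measurable (lborel \<Otimes>\<^sub>M \<nu>)"
    by (simp add: indicator_def split_beta' cong: if_cong)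
  have e: "(\<integral>y. indicator {0<..<y} z * c \<partial>\<nu>) = k z * c"
    and i: "integrable \<nu> (\<lambda>y. indicator {0<..<y} z * c)" for z c :: real
  proof -
    have "(\<lambda>y. indicator {0<..<y} z * c) = (if 0 < z then (\<lambda>y. indicator {z<..} y * c) else (\<lambda>y. 0))"
      by (auto simp: fun_eq_iff indicator_def)
    then show "(\<integral>y. indicator {0<..<y} z * c \<partial>\<nu>) = k z * c" "integrable \<nu> (\<lambda>y. indicator {0<..<y} z * c)"
      using emeasure_tail_finite[of z]
      by (auto simp: tail_nonpos tail_nonpos[unfolded levy_tail_def] levy_tail_def sets_nu intro!: integrable_mult_left integrable_real_indicator)
  qed
  have p: "integrable (lborel \<Otimes>\<^sub>M \<nu>) (\<lambda>(z, y). indicator {0<..<y} z * \<xi> z)"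
  proof (rule pair.Fubini_integrable[OF m])
    show "integrable lborel (\<lambda>z. \<integral>y. norm (case (z, y) of (z, y) \<Rightarrow> indicator {0<..<y} z * \<xi> z) \<partial>\<nu>)"
      using integrable_abs[OF int] by (simp add: abs_mult e e[of _ 1, simplified] tail_nonneg)
    show "AE z in lborel. integrable \<nu> (\<lambda>y. case (z, y) of (z, y) \<Rightarrow> indicator {0<..<y} z * \<xi> z)"
      by (simp add: i i[of _ 1, simplified])
  qed
  show "integrable \<nu> (\<lambda>y. \<integral>z. indicator {0<..<y} z * \<xi> z \<partial>lborel)"
    using pair.integrable_snd[OF p] by simp
  show "(\<integral>z. k z * \<xi> z \<partial>lborel) = (\<integral>y. (\<integral>z. indicator {0<..<y} z * \<xi> z \<partial>lborel) \<partial>\<nu>)"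
    using pair.Fubini_integral[OF p] by (simp add: e e[of _ 1, simplified])
qed

lemma min_integrable:
  assumes "0 \<le> c"
  shows "integrable \<nu> (\<lambda>y. min y c)"
proof -
  have 1: "integrable \<nu> (\<lambda>y. min y 1)"
  proof (rule integrableI_nonneg)
    show "AE y in \<nu>. 0 \<le> min y 1" using AE_pos by eventually_elim auto
  qed (use min_finite in auto)
  show ?thesis
  proof (rule Bochner_Integration.integrable_bound)
    show "integrable \<nu> (\<lambda>y. (1 + c) * min y 1)" using 1 by auto
    show "AE y in \<nu>. norm (min y c) \<le> norm ((1 + c) * min y 1)"
      using AE_pos
    proof eventually_elim
      case (elim y)
      have "y \<le> (1 + c) * y" using elim assms by (simp add: algebra_simps)
      then have "min y c \<le> (1 + c) * min y 1" using assms by (cases "y \<le> 1") auto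
      then show ?case using elim assms by auto
    qed
  qed auto
qed

lemma min_nn_integral_finite:
  assumes "0 \<le> c"
  shows "(\<integral>\<^sup>+ y. ennreal (min y c) \<partial>\<nu>) < \<infinity>"
proof -
  have "(\<integral>\<^sup>+ y. ennreal (min y c) \<partial>\<nu>) \<le> (\<integral>\<^sup>+ y. ennreal (norm (min y c)) \<partial>\<nu>)"
    by (intro nn_integral_mono ennreal_leI) auto
  also have "\<dots> < \<infinity>" using min_integrable[OF assms] by (simp add: integrable_iff_bounded)
  finally show ?thesis .
qed

lemma tail_locint: "locint k"
  unfolding locint_def
proof (intro conjI allI)
  show "t < 0 \<longrightarrow> k t = 0" for t by (simp add: tail_nonpos)
  show "set_integrable lborel {..T} k" for T
    unfolding set_integrable_def
  proof (rule integrableI_nonneg)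
    have "(\<integral>\<^sup>+ z. ennreal (indicator {..T} z *\<^sub>R k z) \<partial>lborel) = (\<integral>\<^sup>+ z. ennreal (k z) * indicator {..T} z \<partial>lborel)"
      by (intro nn_integral_cong) (auto simp: indicator_def)
    also have "\<dots> = (\<integral>\<^sup>+ y. (\<integral>\<^sup>+ z. indicator {0<..<y} z * indicator {..T} z \<partial>lborel) \<partial>\<nu>)"
      by (rule tail_nn_integral) simp
    also have "\<dots> \<le> (\<integral>\<^sup>+ y. ennreal (min y \<bar>T\<bar>) \<partial>\<nu>)"
    proof (rule nn_integral_mono_AE, use AE_pos in eventually_elim)
      case (elim y)
      have "(\<integral>\<^sup>+ z. indicator {0<..<y} z * indicator {..T} z \<partial>lborel) \<le> (\<integral>\<^sup>+ z. indicator {0..min y \<bar>T\<bar>} z \<partial>lborel)"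
        by (intro nn_integral_mono) (auto simp: indicator_def)
      then show ?case using elim by simp
    qed
    also have "\<dots> < \<infinity>" by (rule min_nn_integral_finite) simp
    finally show "(\<integral>\<^sup>+ z. ennreal (indicator {..T} z *\<^sub>R k z) \<partial>lborel) < \<infinity>" .
  qed (auto simp: tail_nonneg)
qed simp

text \<open>
  The inner integral over \<open>{0<..<y}\<close> of \<open>exp (- x * z)\<close> is \<open>(1 - exp (- y * x)) / x\<close>: this links the
  tail to the Laplace exponent.
\<close>

lemma tail_laplace:
  assumes x: "0 < x"
  shows "integrable lborel (\<lambda>z. exp (- x * z) * k z)"
    and "(\<integral>z. exp (- x * z) * k z \<partial>lborel) = (\<integral>y. (1 - exp (- y * x)) \<partial>\<nu>) / x"
    and "integrable \<nu> (\<lambda>y. 1 - exp (- y * x))"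
proof -
  have inner: "(\<integral>\<^sup>+ z. indicator {0<..<y} z * ennreal (exp (- x * z)) \<partial>lborel) = ennreal ((1 - exp (- y * x)) / x)"
    if "0 < y" for y
  proof -
    have "(\<integral>\<^sup>+ z. indicator {0<..<y} z * ennreal (exp (- x * z)) \<partial>lborel)
        = (\<integral>\<^sup>+ z. ennreal (exp (- x * z)) * indicator {0..y} z \<partial>lborel)"
      by (intro nn_integral_cong_AE, use AE_lborel_singleton[of 0] AE_lborel_singleton[of y] in eventually_elim)
        (auto simp: indicator_def)
    also have "\<dots> = ennreal (- exp (- x * y) / x - (- exp (- x * 0) / x))"
      using x that by (intro nn_integral_FTC_Icc) (auto intro!: derivative_eq_intros)
    also have "- exp (- x * y) / x - (- exp (- x * 0) / x) = (1 - exp (- y * x)) / x"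
      by (simp add: diff_divide_distrib mult.commute)
    finally show ?thesis .
  qed
  have eq: "(\<integral>\<^sup>+ z. ennreal (exp (- x * z) * k z) \<partial>lborel) = (\<integral>\<^sup>+ y. ennreal ((1 - exp (- y * x)) / x) \<partial>\<nu>)"
  proof -
    have "(\<integral>\<^sup>+ z. ennreal (exp (- x * z) * k z) \<partial>lborel) = (\<integral>\<^sup>+ z. ennreal (k z) * ennreal (exp (- x * z)) \<partial>lborel)"
      by (intro nn_integral_cong) (simp add: ennreal_mult' tail_nonneg mult.commute)
    also have "\<dots> = (\<integral>\<^sup>+ y. (\<integral>\<^sup>+ z. indicator {0<..<y} z * ennreal (exp (- x * z)) \<partial>lborel) \<partial>\<nu>)"
      by (rule tail_nn_integral) simp
    also have "\<dots> = (\<integral>\<^sup>+ y. ennreal ((1 - exp (- y * x)) / x) \<partial>\<nu>)"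
      by (intro nn_integral_cong_AE, use AE_pos in eventually_elim) (rule inner)
    finally show ?thesis .
  qed
  have bound: "1 - exp (- y * x) \<le> (1 + x) * min y 1" "0 \<le> 1 - exp (- y * x)" if "0 < y" for y
  proof -
    have "1 - exp (- y * x) \<le> y * x" using exp_ge_add_one_self[of "- y * x"] by linarith
    also have "\<dots> \<le> (1 + x) * y" using that by (simp add: algebra_simps)
    finally have "1 - exp (- y * x) \<le> (1 + x) * y" .
    moreover have "1 - exp (- y * x) \<le> (1 + x) * 1"
    proof -
      have "1 - exp (- y * x) \<le> 1" by simp
      also have "\<dots> \<le> (1 + x) * 1" using x by simp
      finally show ?thesis .
    qed
    ultimately show "1 - exp (- y * x) \<le> (1 + x) * min y 1" by (auto simp: min_def)
    show "0 \<le> 1 - exp (- y * x)" using that x by simp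
  qed
  show i: "integrable \<nu> (\<lambda>y. 1 - exp (- y * x))"
  proof (rule Bochner_Integration.integrable_bound)
    show "integrable \<nu> (\<lambda>y. (1 + x) * min y 1)" using min_integrable[of 1] by auto
    show "AE y in \<nu>. norm (1 - exp (- y * x)) \<le> norm ((1 + x) * min y 1)"
      using AE_pos
    proof eventually_elim
      case (elim y)
      show ?case using bound[OF elim] by simp
    qed
  qed auto
  have nonneg: "AE y in \<nu>. 0 \<le> (1 - exp (- y * x)) / x"
    using AE_pos by eventually_elim (use bound x in auto)
  have fin: "(\<integral>\<^sup>+ y. ennreal ((1 - exp (- y * x)) / x) \<partial>\<nu>) = ennreal ((\<integral>y. (1 - exp (- y * x)) \<partial>\<nu>) / x)"
    using i nonneg by (subst nn_integral_eq_integral) auto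
  show int: "integrable lborel (\<lambda>z. exp (- x * z) * k z)"
  proof (rule integrableI_nonneg)
    show "(\<integral>\<^sup>+ z. ennreal (exp (- x * z) * k z) \<partial>lborel) < \<infinity>" unfolding eq fin by simp
  qed (auto simp: tail_nonneg)
  show "(\<integral>z. exp (- x * z) * k z \<partial>lborel) = (\<integral>y. (1 - exp (- y * x)) \<partial>\<nu>) / x"
  proof (subst integral_eq_nn_integral)
    have "0 \<le> (\<integral>y. (1 - exp (- y * x)) \<partial>\<nu>)"
      by (rule integral_nonneg_AE, use AE_pos in eventually_elim) (use bound in auto)
    then show "enn2real (\<integral>\<^sup>+ z. ennreal (exp (- x * z) * k z) \<partial>lborel) = (\<integral>y. (1 - exp (- y * x)) \<partial>\<nu>) / x"
      unfolding eq fin using x by simp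
  qed (auto simp: tail_nonneg)
qed

lemma exponent_unbounded: "\<exists>x0>0. \<forall>x\<ge>x0. C < (\<integral>y. (1 - exp (- y * x)) \<partial>\<nu>)"
proof -
  obtain \<eta> where \<eta>: "\<eta> > 0" "2 * \<bar>C\<bar> < k \<eta>" using tail_unbounded[of 1] by auto
  have "C < (\<integral>y. (1 - exp (- y * x)) \<partial>\<nu>)" if x: "x \<ge> 1 / \<eta>" for x
  proof -
    have x0: "x > 0" using x \<eta> by (simp add: less_le_trans[rotated])
    have fin: "emeasure \<nu> {\<eta><..} < \<infinity>" using emeasure_tail_finite \<eta> by simp
    have "(\<integral>y. indicator {\<eta><..} y * (1/2 :: real) \<partial>\<nu>) \<le> (\<integral>y. (1 - exp (- y * x)) \<partial>\<nu>)"
    proof (rule integral_mono_AE)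
      show "integrable \<nu> (\<lambda>y. indicator {\<eta><..} y * (1/2 :: real))"
        using fin by (intro integrable_mult_left integrable_real_indicator) (auto simp: sets_nu)
      show "integrable \<nu> (\<lambda>y. 1 - exp (- y * x))" by (rule tail_laplace[OF x0])
      show "AE y in \<nu>. indicator {\<eta><..} y * (1/2) \<le> 1 - exp (- y * x)"
        using AE_pos
      proof eventually_elim
        case (elim y)
        have "exp (- y * x) \<le> 1/2" if "y > \<eta>"
        proof -
          have "1 \<le> \<eta> * x" using x \<eta> by (simp add: field_simps)
          also have "\<dots> \<le> y * x" using that x0 by (intro mult_right_mono) auto
          finally have "2 \<le> exp (y * x)" using exp_ge_add_one_self[of "y * x"] by linarith
          then show ?thesis by (simp add: exp_minus field_simps)
        qed
        then show ?case using elim x0 by (auto simp: indicator_def)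
      qed
    qed
    moreover have "(\<integral>y. indicator {\<eta><..} y * (1/2 :: real) \<partial>\<nu>) = k \<eta> / 2" by (simp add: levy_tail_def sets_nu)
    ultimately show ?thesis using \<eta> by linarith
  qed
  then show ?thesis using \<eta> by (intro exI[of _ "1 / \<eta>"]) auto
qed

end

lemma (in levy_measure) emeasure_Ioc:
  assumes "0 < p" "p \<le> q"
  shows "emeasure \<nu> {p<..q} = ennreal (k p - k q)"
proof -
  have "{p<..q} = {p<..} - {q<..}" by auto
  also have "emeasure \<nu> \<dots> = emeasure \<nu> {p<..} - emeasure \<nu> {q<..}"
    using assms emeasure_tail_finite[of q] by (intro emeasure_Diff) (auto simp: sets_nu)
  also have "\<dots> = ennreal (k p - k q)"
    using assms by (simp add: emeasure_tail ennreal_minus tail_nonneg)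
  finally show ?thesis .
qed

lemma (in levy_measure) tail_integral_ge:
  assumes t: "0 < t"
  shows "t * k t \<le> (\<integral>z. indicator {..t} z * k z \<partial>lborel)"
proof -
  have "(\<integral>z. indicator {0<..t} z * k t \<partial>lborel) \<le> (\<integral>z. indicator {..t} z * k z \<partial>lborel)"
  proof (rule integral_mono)
    show "integrable lborel (\<lambda>z. indicator {0<..t} z * k t)"
      using t by (intro integrable_mult_left integrable_real_indicator) auto
    show "integrable lborel (\<lambda>z. indicator {..t} z * k z)" by (rule integrable_cut[OF tail_locint])
    show "indicator {0<..t} z * k t \<le> indicator {..t} z * k z" for z
      by (auto simp: indicator_def tail_nonneg intro: tail_antimono)
  qed
  then show ?thesis using t by simp
qed

section \<open>Absolute continuity of the renewal function\<close>

text \<open>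
  In the application \<open>U t\<close> is the expected time that the subordinator spends in \<open>[0, t]\<close>; the last
  assumption is the convolution equation of its renewal measure.
\<close>

locale renewal = levy_measure +
  fixes b :: real and U :: "real \<Rightarrow> real"
  assumes b: "0 \<le> b" and U_mono: "mono U" and U_neg: "\<And>t. t < 0 \<Longrightarrow> U t = 0"
    and U_rc: "\<And>t. continuous (at_right t) U"
    and renewal_eq: "\<And>t. b * U t + conv U k t = max 0 t"
begin

lemma U_nonneg: "0 \<le> U t"
  using monoD[OF U_mono, of "min t (-1)" t] U_neg[of "min t (-1)"] by auto

lemma U_measurable[measurable]: "U \<in> borel_measurable borel"
  by (rule borel_measurable_mono[OF U_mono])

lemma U_locbdd: "locbdd U"
  unfolding locbdd_def
proof (intro conjI allI impI)
  show "\<exists>C. \<forall>t\<le>T. \<bar>U t\<bar> \<le> C" for T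
    by (rule exI[of _ "U T"]) (auto simp: U_nonneg monoD[OF U_mono])
qed (auto simp: U_neg)

text \<open>
  The interval is half-open so that the density of the moving average, a difference quotient of \<open>U\<close>,
  comes out exactly and not only almost everywhere.
\<close>

definition window :: "real \<Rightarrow> real \<Rightarrow> real" where
  "window h z = indicator {0..<h} z / h"

definition smoothed :: "real \<Rightarrow> real \<Rightarrow> real" where
  "smoothed h = conv U (window h)"

definition ramp :: "real \<Rightarrow> real" where
  "ramp t = max 0 t"

lemma ramp_locbdd: "locbdd ramp"
  unfolding locbdd_def
proof (intro conjI allI impI)
  show "\<exists>C. \<forall>t\<le>T. \<bar>ramp t\<bar> \<le> C" for T by (rule exI[of _ "max 0 T"]) (auto simp: ramp_def)
qed (auto simp: ramp_def[abs_def])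

context
  fixes h :: real
  assumes h: "0 < h"
begin

lemma window_int: "(\<integral>z. window h z \<partial>lborel) = 1" and window_integrable: "integrable lborel (window h)"
  using h unfolding window_def by (auto intro!: integrable_real_indicator integrable_divide)

lemma window_measurable: "window h \<in> borel_measurable borel"
  unfolding window_def by measurable

lemma window_nonneg: "0 \<le> window h z" using h by (simp add: window_def)

lemma window_neg: "z < 0 \<Longrightarrow> window h z = 0" by (simp add: window_def)

lemma window_locint: "locint (window h)"
  unfolding locint_def set_integrable_def
  using integrable_mult_indicator[OF _ window_integrable] by (auto simp: window_neg window_measurable)

lemma conv_window_mono:
  assumes D: "locbdd D" "\<And>s t. s \<le> t \<Longrightarrow> D s \<le> D t" and t: "s \<le> t"
  shows "conv D (window h) s \<le> conv D (window h) t" "conv D (window h) t \<le> D t"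
proof -
  note i = conv_integrable[OF D(1) window_locint]
  show "conv D (window h) s \<le> conv D (window h) t"
    unfolding conv_def using t by (intro integral_mono i mult_right_mono D(2) window_nonneg) auto
  have "conv D (window h) t \<le> (\<integral>z. D t * window h z \<partial>lborel)"
    unfolding conv_def
  proof (intro integral_mono i)
    show "D (t - z) * window h z \<le> D t * window h z" for z
      by (cases "z < 0") (auto simp: window_neg window_nonneg intro!: mult_right_mono D(2))
  qed (use window_integrable in auto)
  also have "\<dots> = D t" by (simp add: window_int)
  finally show "conv D (window h) t \<le> D t" .
qed

lemma smoothed_mono: "s \<le> t \<Longrightarrow> smoothed h s \<le> smoothed h t"
  unfolding smoothed_def by (rule conv_window_mono(1)[OF U_locbdd monoD[OF U_mono]])

lemma smoothed_le: "smoothed h t \<le> U t"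
  unfolding smoothed_def by (rule conv_window_mono(2)[OF U_locbdd monoD[OF U_mono] order_refl])

lemma smoothed_neg: "t < 0 \<Longrightarrow> smoothed h t = 0"
  unfolding smoothed_def by (rule conv_neg) (auto simp: U_neg window_neg)

lemma smoothed_locbdd: "locbdd (smoothed h)"
  unfolding smoothed_def by (rule conv_locbdd[OF U_locbdd window_locint])

text \<open>
  Convolution with the window commutes with the renewal equation.
\<close>

lemma smoothed_eq: "b * smoothed h t + conv (smoothed h) k t = conv ramp (window h) t"
proof -
  have "conv (smoothed h) k t = conv U (conv (window h) k) t"
    unfolding smoothed_def by (rule conv_assoc[symmetric, OF U_locbdd window_locint tail_locint])
  also have "conv (window h) k = conv k (window h)" by (rule ext, rule conv_commute)
  also have "conv U \<dots> t = conv (conv U k) (window h) t"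
    by (rule conv_assoc[OF U_locbdd tail_locint window_locint])
  finally have 1: "conv (smoothed h) k t = conv (conv U k) (window h) t" .
  note i1 = conv_integrable[OF U_locbdd window_locint, of t]
  note i2 = conv_integrable[OF conv_locbdd[OF U_locbdd tail_locint] window_locint, of t]
  have "b * smoothed h t + conv (conv U k) (window h) t
     = (\<integral>z. b * (U (t - z) * window h z) + conv U k (t - z) * window h z \<partial>lborel)"
    unfolding smoothed_def conv_def[of U "window h"] conv_def[of "conv U k"] using i1 i2 by simp
  also have "\<dots> = conv ramp (window h) t"
    unfolding conv_def[of ramp]
    by (rule Bochner_Integration.integral_cong) (auto simp: ramp_def renewal_eq[symmetric] algebra_simps)
  finally show ?thesis using 1 by simp
qed

definition smoothed_density :: "real \<Rightarrow> real" where
  "smoothed_density w = (U w - U (w - h)) / h"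

lemma smoothed_density_nonneg: "0 \<le> smoothed_density w" using h monoD[OF U_mono, of "w - h" w] by (simp add: smoothed_density_def)

lemma smoothed_density_neg: "w < 0 \<Longrightarrow> smoothed_density w = 0" using h by (simp add: smoothed_density_def U_neg)

lemma smoothed_density_le: "w \<le> T \<Longrightarrow> smoothed_density w \<le> U T / h"
  unfolding smoothed_density_def using h monoD[OF U_mono, of w T] U_nonneg[of "w - h"] by (intro divide_right_mono) auto

lemma smoothed_density_measurable: "smoothed_density \<in> borel_measurable borel" unfolding smoothed_density_def by measurable

text \<open>
  Both sides are \<open>1 / h\<close> times the integral of \<open>U\<close> over \<open>{x<..y}\<close> minus that over the interval moved left
  by \<open>h\<close>.
\<close>

lemma smoothed_eq_integral:
  assumes "x \<le> y"
  shows "integrable lborel (\<lambda>w. indicator {x<..y} w * smoothed_density w)"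
    and "smoothed h y - smoothed h x = (\<integral>w. indicator {x<..y} w * smoothed_density w \<partial>lborel)"
proof -
  have U_int: "integrable lborel (\<lambda>w. indicator {a<..c} w * U w)" for a c
  proof -
    have "integrable lborel (indicator {a<..c} :: real \<Rightarrow> real)"
      by (cases "a \<le> c") (auto intro!: integrable_real_indicator)
    then have "integrable lborel (\<lambda>w. indicator {a<..c} w * U (min c w))"
      by (rule integrable_mult_bounded[where C="U c"]) (auto simp: U_nonneg monoD[OF U_mono])
    then show ?thesis
      by (rule Bochner_Integration.integrable_cong[THEN iffD1, rotated -1]) (auto simp: indicator_def)
  qed
  have shift: "(\<integral>w. indicator {x<..y} w * U (w - h) \<partial>lborel) = (\<integral>w. indicator {x-h<..y-h} w * U w \<partial>lborel)"
    and shift_int: "integrable lborel (\<lambda>w. indicator {x<..y} w * U (w - h))"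
  proof -
    have e: "indicator {x-h<..y-h} (-h + 1 * w) * U (-h + 1 * w) = indicator {x<..y} w * U (w - h)" for w
      by (auto simp: indicator_def)
    show "(\<integral>w. indicator {x<..y} w * U (w - h) \<partial>lborel) = (\<integral>w. indicator {x-h<..y-h} w * U w \<partial>lborel)"
      by (subst (2) lborel_integral_real_affine[where c=1 and t="-h"]) (simp_all only: e, auto)
    show "integrable lborel (\<lambda>w. indicator {x<..y} w * U (w - h))"
      using lborel_integrable_real_affine[OF U_int[of "x-h" "y-h"], of 1 "-h"] by (simp only: e)
  qed
  show "integrable lborel (\<lambda>w. indicator {x<..y} w * smoothed_density w)"
    using U_int[of x y] shift_int by (simp add: smoothed_density_def diff_divide_distrib right_diff_distrib)
  have Vi: "h * smoothed h t = (\<integral>w. indicator {t-h<..t} w * U w \<partial>lborel)" for t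
  proof -
    have "smoothed h t = conv (window h) U t" unfolding smoothed_def by (rule conv_commute)
    also have "h * \<dots> = (\<integral>w. h * (window h (t - w) * U w) \<partial>lborel)" unfolding conv_def by simp
    also have "\<dots> = (\<integral>w. indicator {t-h<..t} w * U w \<partial>lborel)"
      using h by (intro Bochner_Integration.integral_cong) (auto simp: window_def indicator_def)
    finally show ?thesis .
  qed
  have "h * smoothed h y - h * smoothed h x = (\<integral>w. indicator {y-h<..y} w * U w - indicator {x-h<..x} w * U w \<partial>lborel)"
    unfolding Vi using U_int by simp
  also have "\<dots> = (\<integral>w. indicator {x<..y} w * U w - indicator {x-h<..y-h} w * U w \<partial>lborel)"
    using assms h by (intro Bochner_Integration.integral_cong) (auto simp: indicator_def)
  also have "\<dots> = (\<integral>w. indicator {x<..y} w * U w \<partial>lborel) - (\<integral>w. indicator {x<..y} w * U (w - h) \<partial>lborel)"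
    unfolding shift using U_int by simp
  also have "\<dots> = (\<integral>w. h * (indicator {x<..y} w * smoothed_density w) \<partial>lborel)"
  proof -
    have "(\<lambda>w. h * (indicator {x<..y} w * smoothed_density w)) = (\<lambda>w. indicator {x<..y} w * U w - indicator {x<..y} w * U (w - h))"
      using h by (intro ext) (simp add: smoothed_density_def field_simps)
    then show ?thesis using U_int[of x y] shift_int by simp
  qed
  finally have "h * (smoothed h y - smoothed h x) = h * (\<integral>w. indicator {x<..y} w * smoothed_density w \<partial>lborel)"
    by (simp add: right_diff_distrib)
  then show "smoothed h y - smoothed h x = (\<integral>w. indicator {x<..y} w * smoothed_density w \<partial>lborel)" using h by simp
qed

lemma smoothed_lipschitz:
  assumes "x \<le> y" "y \<le> T"
  shows "smoothed h y - smoothed h x \<le> U T / h * (y - x)"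
proof -
  have "smoothed h y - smoothed h x \<le> (\<integral>w. indicator {x<..y} w * (U T / h) \<partial>lborel)"
    unfolding smoothed_eq_integral(2)[OF assms(1)]
  proof (intro integral_mono smoothed_eq_integral(1)[OF assms(1)])
    show "integrable lborel (\<lambda>w. indicator {x<..y} w * (U T / h))"
      using assms by (intro integrable_mult_left integrable_real_indicator) auto
  qed (use assms smoothed_density_le in \<open>auto simp: indicator_def\<close>)
  then show ?thesis using assms by (simp add: mult.commute)
qed

end

end

context renewal
begin

lemma smoothed_ge: "0 < h \<Longrightarrow> U (t - h) \<le> smoothed h t"
proof -
  assume h: "0 < h"
  have "U (t - h) = (\<integral>z. U (t - h) * window h z \<partial>lborel)" by (simp add: window_int[OF h])
  also have "\<dots> \<le> (\<integral>z. U (t - z) * window h z \<partial>lborel)"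
  proof (intro integral_mono conv_integrable[OF U_locbdd window_locint[OF h]])
    show "U (t - h) * window h z \<le> U (t - z) * window h z" for z
      using h by (auto simp: window_def indicator_def intro!: divide_right_mono monoD[OF U_mono])
  qed (use window_integrable[OF h] in auto)
  finally show ?thesis by (simp add: smoothed_def conv_def)
qed

context
  fixes h \<eta> T \<epsilon> :: real and n :: nat and u v :: "nat \<Rightarrow> real"
  assumes h: "0 < h" and \<eta>: "0 < \<eta>" and T: "0 \<le> T" and \<epsilon>: "0 \<le> \<epsilon>"
    and uv: "\<And>i. i < n \<Longrightarrow> 0 \<le> u i \<and> u i \<le> v i \<and> v i \<le> T"
    and small: "\<And>c. c \<le> 0 \<Longrightarrow> (\<Sum>i<n. k (max \<eta> (u i + c)) - k (max \<eta> (v i + c))) \<le> \<epsilon>"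
begin

text \<open>
  The total increment of the moving average over the given intervals, moved by \<open>x\<close>. The maximum is taken
  over \<open>x \<le> 0\<close>: there the intervals stay to the left of \<open>T\<close>, where bounds are uniform, and the jumps of
  the generator, which move to the left as well, do not leave this range.
\<close>

definition increments :: "real \<Rightarrow> real" where
  "increments x = (\<Sum>i<n. smoothed h (v i + x) - smoothed h (u i + x))"

lemma increments_nonneg: "0 \<le> increments x"
  unfolding increments_def using uv by (intro sum_nonneg) (auto intro!: smoothed_mono[OF h])

lemma smoothed_measurable[measurable]: "smoothed h \<in> borel_measurable borel"
  using locbddD(1)[OF smoothed_locbdd[OF h]] .

lemma increments_measurable[measurable]: "increments \<in> borel_measurable borel"
  unfolding increments_def[abs_def] by measurable

text \<open>
  Insert the density of the moving average and exchange integrals. For a fixed position \<open>w\<close> the jumps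
  \<open>y > \<eta>\<close> that count are those for which \<open>y\<close> lies in one of the intervals translated by \<open>x - w\<close>. Their
  \<open>\<nu>\<close>-measure is a sum of decrements of the tail over disjoint short intervals beyond \<open>\<eta>\<close>.
\<close>

lemma big_jumps_bound:
  assumes x: "x \<le> 0"
  shows "(\<integral>\<^sup>+ y. indicator {\<eta><..} y * ennreal (increments (x - y)) \<partial>\<nu>) \<le> ennreal (\<epsilon> * U T)"
proof -
  note [measurable] = smoothed_density_measurable[OF h]
  define B where "B i y w \<longleftrightarrow> \<eta> < y \<and> u i + x - y < w \<and> w \<le> v i + x - y" for i y w
  have [measurable]: "(\<lambda>(w, y). if B i y w then ennreal (smoothed_density h w) else 0) \<in> borel_measurable (lborel \<Otimes>\<^sub>M \<nu>)" for i
    unfolding B_def split_beta' by measurable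
  have phi: "indicator {\<eta><..} y * ennreal (increments (x - y)) =
     (\<Sum>i<n. (\<integral>\<^sup>+ w. (if B i y w then ennreal (smoothed_density h w) else 0) \<partial>lborel))" for y
  proof (cases "\<eta> < y")
    case True
    have "ennreal (increments (x - y)) = (\<Sum>i<n. ennreal (smoothed h (v i + (x - y)) - smoothed h (u i + (x - y))))"
      unfolding increments_def by (rule sum_ennreal[symmetric]) (use uv in \<open>auto intro!: smoothed_mono[OF h]\<close>)
    also have "\<dots> = (\<Sum>i<n. (\<integral>\<^sup>+ w. (if B i y w then ennreal (smoothed_density h w) else 0) \<partial>lborel))"
    proof (rule sum.cong)
      fix i assume i: "i \<in> {..<n}"
      then have "u i + (x - y) \<le> v i + (x - y)" using uv by auto
      note d = smoothed_eq_integral[OF h this]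
      have "ennreal (smoothed h (v i + (x - y)) - smoothed h (u i + (x - y)))
         = (\<integral>\<^sup>+ w. ennreal (indicator {u i + (x - y)<..v i + (x - y)} w * smoothed_density h w) \<partial>lborel)"
        unfolding d(2) by (rule nn_integral_eq_integral[symmetric, OF d(1)]) (auto simp: smoothed_density_nonneg[OF h])
      also have "\<dots> = (\<integral>\<^sup>+ w. (if B i y w then ennreal (smoothed_density h w) else 0) \<partial>lborel)"
        using True by (intro nn_integral_cong) (auto simp: B_def indicator_def)
      finally show "ennreal (smoothed h (v i + (x - y)) - smoothed h (u i + (x - y))) = \<dots>" .
    qed simp
    finally show ?thesis using True by simp
  qed (simp add: B_def)
  have inner: "(\<integral>\<^sup>+ y. (if B i y w then ennreal (smoothed_density h w) else 0) \<partial>\<nu>)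
     = ennreal (smoothed_density h w) * ennreal (k (max \<eta> (u i + (x - w))) - k (max \<eta> (v i + (x - w))))"
    if i: "i < n" for i w
  proof -
    have "(\<integral>\<^sup>+ y. (if B i y w then ennreal (smoothed_density h w) else 0) \<partial>\<nu>)
      = (\<integral>\<^sup>+ y. ennreal (smoothed_density h w) * indicator {max \<eta> (u i + (x - w))<..max \<eta> (v i + (x - w))} y \<partial>\<nu>)"
      by (intro nn_integral_cong) (auto simp: B_def indicator_def)
    also have "\<dots> = ennreal (smoothed_density h w) * emeasure \<nu> {max \<eta> (u i + (x - w))<..max \<eta> (v i + (x - w))}"
      by (rule nn_integral_cmult_indicator) (auto simp: sets_nu)
    also have "emeasure \<nu> {max \<eta> (u i + (x - w))<..max \<eta> (v i + (x - w))}
      = ennreal (k (max \<eta> (u i + (x - w))) - k (max \<eta> (v i + (x - w))))"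
      using \<eta> uv[OF i] by (intro emeasure_Ioc) auto
    finally show ?thesis .
  qed
  have "(\<integral>\<^sup>+ y. indicator {\<eta><..} y * ennreal (increments (x - y)) \<partial>\<nu>)
    = (\<Sum>i<n. (\<integral>\<^sup>+ y. (\<integral>\<^sup>+ w. (if B i y w then ennreal (smoothed_density h w) else 0) \<partial>lborel) \<partial>\<nu>))"
    unfolding phi by (rule nn_integral_sum) measurable
  also have "\<dots> = (\<Sum>i<n. (\<integral>\<^sup>+ w. (\<integral>\<^sup>+ y. (if B i y w then ennreal (smoothed_density h w) else 0) \<partial>\<nu>) \<partial>lborel))"
    by (intro sum.cong refl pair.Fubini'[where f="\<lambda>w y. if B i y w then ennreal (smoothed_density h w) else 0" for i]) auto
  also have "\<dots> = (\<Sum>i<n. (\<integral>\<^sup>+ w. ennreal (smoothed_density h w) * ennreal (k (max \<eta> (u i + (x - w))) - k (max \<eta> (v i + (x - w)))) \<partial>lborel))"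
    by (intro sum.cong refl nn_integral_cong inner) auto
  also have "\<dots> = (\<integral>\<^sup>+ w. (\<Sum>i<n. ennreal (smoothed_density h w) * ennreal (k (max \<eta> (u i + (x - w))) - k (max \<eta> (v i + (x - w))))) \<partial>lborel)"
    by (intro nn_integral_sum[symmetric]) measurable
  also have "\<dots> \<le> (\<integral>\<^sup>+ w. ennreal (\<epsilon> * (indicator {-1<..T} w * smoothed_density h w)) \<partial>lborel)"
  proof (rule nn_integral_mono)
    fix w
    have mono_k: "k (max \<eta> (v i + (x - w))) \<le> k (max \<eta> (u i + (x - w)))" if "i < n" for i
      using \<eta> uv[OF that] by (intro tail_antimono) auto
    have "(\<Sum>i<n. ennreal (smoothed_density h w) * ennreal (k (max \<eta> (u i + (x - w))) - k (max \<eta> (v i + (x - w)))))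
       = ennreal (smoothed_density h w * (\<Sum>i<n. k (max \<eta> (u i + (x - w))) - k (max \<eta> (v i + (x - w)))))"
      unfolding sum_distrib_left using mono_k
      by (subst sum_ennreal[symmetric]) (auto simp: smoothed_density_nonneg[OF h] ennreal_mult)
    also have "\<dots> \<le> ennreal (\<epsilon> * (indicator {-1<..T} w * smoothed_density h w))"
    proof (rule ennreal_leI)
      consider "w < 0" | "w > T" | "0 \<le> w" "w \<le> T" by linarith
      then show "smoothed_density h w * (\<Sum>i<n. k (max \<eta> (u i + (x - w))) - k (max \<eta> (v i + (x - w))))
          \<le> \<epsilon> * (indicator {-1<..T} w * smoothed_density h w)"
      proof cases
        case 1 then show ?thesis by (simp add: smoothed_density_neg[OF h])
      next
        case 2
        then have "max \<eta> (u i + (x - w)) = \<eta>" "max \<eta> (v i + (x - w)) = \<eta>" if "i < n" for i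
          using uv[OF that] x \<eta> by auto
        then have "(\<Sum>i<n. k (max \<eta> (u i + (x - w))) - k (max \<eta> (v i + (x - w)))) = 0"
          by (intro sum.neutral) auto
        then show ?thesis using 2 by simp
      next
        case 3
        then show ?thesis using small[of "x - w"] x smoothed_density_nonneg[OF h, of w]
          by (simp add: mult.commute[of "smoothed_density h w"] mult_right_mono)
      qed
    qed
    finally show "(\<Sum>i<n. ennreal (smoothed_density h w) * ennreal (k (max \<eta> (u i + (x - w))) - k (max \<eta> (v i + (x - w)))))
      \<le> ennreal (\<epsilon> * (indicator {-1<..T} w * smoothed_density h w))" .
  qed
  also have "\<dots> = ennreal (\<integral>w. \<epsilon> * (indicator {-1<..T} w * smoothed_density h w) \<partial>lborel)"
    using smoothed_eq_integral(1)[OF h, of "-1" T] T \<epsilon> smoothed_density_nonneg[OF h] by (intro nn_integral_eq_integral) auto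
  also have "(\<integral>w. \<epsilon> * (indicator {-1<..T} w * smoothed_density h w) \<partial>lborel) = \<epsilon> * (smoothed h T - smoothed h (-1))"
    using smoothed_eq_integral(2)[OF h, of "-1" T] T by simp
  also have "ennreal \<dots> \<le> ennreal (\<epsilon> * U T)"
    using \<epsilon> smoothed_le[OF h, of T] smoothed_neg[OF h, of "-1"] by (intro ennreal_leI mult_left_mono) auto
  finally show ?thesis .
qed

definition lip :: real where "lip = real n * (U T / h)"

lemma lip_nonneg: "0 \<le> lip" using h by (simp add: lip_def U_nonneg)

lemma increments_lipschitz:
  assumes "q \<le> p" "p \<le> 0"
  shows "\<bar>increments p - increments q\<bar> \<le> lip * (p - q)"
proof -
  have b: "0 \<le> (\<Sum>i<n. smoothed h (a i + p) - smoothed h (a i + q)) \<and> (\<Sum>i<n. smoothed h (a i + p) - smoothed h (a i + q)) \<le> lip * (p - q)"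
    if a: "\<And>i. i < n \<Longrightarrow> a i \<le> T" for a :: "nat \<Rightarrow> real"
  proof
    show "0 \<le> (\<Sum>i<n. smoothed h (a i + p) - smoothed h (a i + q))"
      using assms by (intro sum_nonneg) (auto intro: smoothed_mono[OF h])
    have "(\<Sum>i<n. smoothed h (a i + p) - smoothed h (a i + q)) \<le> (\<Sum>i<n. U T / h * (p - q))"
    proof (rule sum_mono)
      fix i assume i: "i \<in> {..<n}"
      show "smoothed h (a i + p) - smoothed h (a i + q) \<le> U T / h * (p - q)"
        using smoothed_lipschitz[OF h, of "a i + q" "a i + p" T] a[of i] i assms by auto
    qed
    then show "(\<Sum>i<n. smoothed h (a i + p) - smoothed h (a i + q)) \<le> lip * (p - q)" by (simp add: lip_def)
  qed
  have "increments p - increments q = (\<Sum>i<n. smoothed h (v i + p) - smoothed h (v i + q)) - (\<Sum>i<n. smoothed h (u i + p) - smoothed h (u i + q))"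
    by (simp add: increments_def sum_subtractf)
  moreover have "u i \<le> T" "v i \<le> T" if "i < n" for i using uv[OF that] by auto
  ultimately show ?thesis using b[of u] b[of v] by (auto simp: abs_le_iff)
qed

text \<open>
  Far to the left all increments vanish, so the supremum is attained on a compact interval.
\<close>

lemma increments_max: obtains x where "x \<le> 0" "\<And>y. y \<le> 0 \<Longrightarrow> increments y \<le> increments x"
proof -
  have "continuous_on {-T-1..0} increments"
  proof (rule lipschitz_on_continuous_on[OF lipschitz_onI[of _ _ lip]])
    fix x y :: real assume "x \<in> {-T-1..0}" "y \<in> {-T-1..0}"
    then show "dist (increments x) (increments y) \<le> lip * dist x y"
      using increments_lipschitz[of x y] increments_lipschitz[of y x]
      by (cases "x \<le> y") (auto simp: dist_real_def abs_minus_commute)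
  qed (rule lip_nonneg)
  then obtain x where x: "x \<in> {-T-1..0}" "\<And>y. y \<in> {-T-1..0} \<Longrightarrow> increments y \<le> increments x"
    using continuous_attains_sup[of "{-T-1..0}" increments] T by auto
  have "increments y \<le> increments x" if "y \<le> 0" for y
  proof (cases "y < -T-1")
    case True
    have "increments y = 0" unfolding increments_def
    proof (intro sum.neutral ballI)
      fix i assume "i \<in> {..<n}"
      then show "smoothed h (v i + y) - smoothed h (u i + y) = 0"
        using uv[of i] True by (simp add: smoothed_neg[OF h])
    qed
    then show ?thesis using increments_nonneg by simp
  qed (use x that in auto)
  then show thesis using that x by auto
qed

text \<open>
  The right-hand side of the smoothed equation is an average of \<open>max 0 t\<close>. Its difference over a step \<open>\<delta>\<close>
  is nondecreasing with values in \<open>[0, \<delta>]\<close>, so its increments over disjoint intervals add up to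
  at most \<open>\<delta>\<close>. At a maximum the drift term has the favourable sign and can be dropped.
\<close>

lemma generator_bound_at_maximum:
  assumes disj: "disjoint_family_on (\<lambda>i. {u i<..<v i}) {..<n}"
    and x: "x \<le> 0" "\<And>y. y \<le> 0 \<Longrightarrow> increments y \<le> increments x" and \<delta>: "0 < \<delta>"
  shows "integrable lborel (\<lambda>z. k z * (increments (x - z) - increments (x - \<delta> - z)))"
    and "(\<integral>z. k z * (increments (x - z) - increments (x - \<delta> - z)) \<partial>lborel) \<le> \<delta>"
proof -
  define F where "F t = conv ramp (window h) t" for t
  define D where "D t = F t - F (t - \<delta>)" for t
  define ramp' where "ramp' t = ramp t - ramp (t - \<delta>)" for t
  have ramp'_mono: "ramp' s \<le> ramp' t" if "s \<le> t" for s t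
    using that \<delta> by (auto simp: ramp'_def ramp_def)
  have ramp'_bounds: "0 \<le> ramp' t" "ramp' t \<le> \<delta>" for t using \<delta> by (auto simp: ramp'_def ramp_def)
  have ramp'_locbdd: "locbdd ramp'"
    unfolding locbdd_def
  proof (intro conjI allI impI)
    show "ramp' \<in> borel_measurable borel" unfolding ramp'_def[abs_def] ramp_def by measurable
    show "ramp' t = 0" if "t < 0" for t using that \<delta> by (simp add: ramp'_def ramp_def)
    show "\<exists>C. \<forall>t\<le>T. \<bar>ramp' t\<bar> \<le> C" for T using ramp'_bounds by (intro exI[of _ \<delta>]) auto
  qed
  note iE = conv_integrable[OF ramp_locbdd window_locint[OF h]]
  have D_eq: "D t = conv ramp' (window h) t" for t
  proof -
    have "conv ramp' (window h) t = (\<integral>z. ramp (t - z) * window h z - ramp (t - \<delta> - z) * window h z \<partial>lborel)"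
      unfolding conv_def ramp'_def by (intro Bochner_Integration.integral_cong) (auto simp: algebra_simps)
    then show ?thesis using iE[of t] iE[of "t - \<delta>"] by (simp add: D_def F_def conv_def)
  qed
  have D_mono: "mono D"
    unfolding D_eq[abs_def] by (intro monoI conv_window_mono(1)[OF h ramp'_locbdd ramp'_mono])
  have D_le: "D t \<le> \<delta>" for t
    unfolding D_eq using conv_window_mono(2)[OF h ramp'_locbdd ramp'_mono order_refl] ramp'_bounds(2)[of t]
    by (rule order_trans)
  have D_nonneg: "0 \<le> D t" for t
    unfolding D_eq conv_def by (intro integral_nonneg_AE) (simp add: ramp'_bounds window_nonneg[OF h])
  have sumD: "(\<Sum>i<n. D (v i + x) - D (u i + x)) \<le> \<delta>"
  proof -
    have "(\<Sum>i<n. D (v i + x) - D (u i + x)) \<le> D (T + x) - D x"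
      by (rule sum_increments_disjoint_le[where a=0 and b=T and D="\<lambda>t. D (t + x)", simplified])
        (use uv disj T in \<open>auto intro!: monoI monoD[OF D_mono]\<close>)
    then show ?thesis using D_le[of "T + x"] D_nonneg[of x] by linarith
  qed
  define C where "C t = conv (smoothed h) k t" for t
  have Ci: "integrable lborel (\<lambda>z. smoothed h (t - z) * k z)" for t
    by (rule conv_integrable[OF smoothed_locbdd[OF h] tail_locint])
  have Cv: "(\<integral>z. smoothed h (t - z) * k z \<partial>lborel) = C t" for t by (simp add: C_def conv_def)
  have Ceq: "C t = F t - b * smoothed h t" for t using smoothed_eq[OF h, of t] by (simp add: C_def F_def)
  have e: "k z * (increments (x - z) - increments (x - \<delta> - z)) =
      (\<Sum>i<n. (smoothed h (v i + x - z) * k z - smoothed h (u i + x - z) * k z)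
         - (smoothed h (v i + x - \<delta> - z) * k z - smoothed h (u i + x - \<delta> - z) * k z))" for z
    unfolding increments_def sum_subtractf[symmetric] sum_distrib_left
    by (intro sum.cong refl) (simp add: algebra_simps)
  show "integrable lborel (\<lambda>z. k z * (increments (x - z) - increments (x - \<delta> - z)))"
    unfolding e by (intro Bochner_Integration.integrable_sum Bochner_Integration.integrable_diff Ci)
  have "(\<integral>z. k z * (increments (x - z) - increments (x - \<delta> - z)) \<partial>lborel)
    = (\<Sum>i<n. (C (v i + x) - C (u i + x)) - (C (v i + x - \<delta>) - C (u i + x - \<delta>)))"
    unfolding e by (simp add: Ci Cv)
  also have "\<dots> = (\<Sum>i<n. D (v i + x) - D (u i + x)) - b * (increments x - increments (x - \<delta>))"
    unfolding Ceq D_def increments_def sum_subtractf[symmetric] sum_distrib_left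
    by (intro sum.cong refl) (simp add: algebra_simps)
  also have "\<dots> \<le> \<delta>"
    using sumD b x(2)[of "x - \<delta>"] x(1) \<delta> mult_nonneg_nonneg[of b "increments x - increments (x - \<delta>)"] by linarith
  finally show "(\<integral>z. k z * (increments (x - z) - increments (x - \<delta> - z)) \<partial>lborel) \<le> \<delta>" .
qed

text \<open>
  The maximum principle. By Fubini's theorem the left-hand side of the generator bound is the
  integral over jumps \<open>y\<close> of \<open>J y\<close>, the integral of the \<open>\<delta>\<close>-step difference over \<open>{0<..<y}\<close>. Jumps
  \<open>y \<le> \<eta>\<close> are bounded below by the maximum and the Lipschitz property, at the cost of the term
  with \<open>min y \<delta>\<close>, which disappears for \<open>\<delta> \<rightarrow> 0\<close>. For \<open>y > \<eta>\<close>, \<open>J y\<close> is about \<open>\<delta>\<close> times the maximum minus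
  the term \<open>Q y\<close>, controlled by the bound on big jumps.
\<close>

lemma maximum_estimate:
  assumes disj: "disjoint_family_on (\<lambda>i. {u i<..<v i}) {..<n}"
    and x: "x \<le> 0" and max: "\<And>y. y \<le> 0 \<Longrightarrow> increments y \<le> increments x"
    and \<delta>: "0 < \<delta>" "\<delta> \<le> \<eta>"
  shows "increments x * k \<eta> \<le> 1 + \<epsilon> * U T + lip * (\<integral>y. min y \<delta> \<partial>\<nu>)"
proof -
  define \<psi> where "\<psi> z = increments (x - z) - increments (x - \<delta> - z)" for z
  define J where "J y = (\<integral>z. indicator {0<..<y} z * \<psi> z \<partial>lborel)" for y
  define Q where "Q y = (\<integral>r. indicator {0..<\<delta>} r * increments (x - y - r) \<partial>lborel)" for y
  have [measurable]: "\<psi> \<in> borel_measurable borel" unfolding \<psi>_def[abs_def] by measurable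
  have [measurable]: "Q \<in> borel_measurable borel" unfolding Q_def[abs_def] by measurable
  note inc = generator_bound_at_maximum[OF disj x max \<delta>(1), folded \<psi>_def]
  have J_int: "integrable \<nu> J" and J_le: "(\<integral>y. J y \<partial>\<nu>) \<le> \<delta>"
    using tail_integral[OF inc(1)] inc(2) unfolding J_def by auto
  have increments_int: "integrable lborel (\<lambda>z. indicator A z * increments (x - z))"
    if A: "A \<in> sets borel" "A \<subseteq> {0..c}" for A c
  proof -
    have "emeasure lborel A \<le> emeasure lborel {0..c}" using A by (intro emeasure_mono) auto
    also have "\<dots> < \<infinity>" by (simp add: emeasure_lborel_Icc_eq)
    finally have "integrable lborel (indicator A :: real \<Rightarrow> real)" using A by (intro integrable_real_indicator) auto
    then have "integrable lborel (\<lambda>z. indicator A z * (if 0 \<le> z then increments (x - z) else 0))"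
      using x max increments_nonneg
      by (intro integrable_mult_bounded[where C="increments x"]) (auto intro!: increments_nonneg)
    then show ?thesis
      by (rule Bochner_Integration.integrable_cong[THEN iffD1, rotated -1])
        (use A in \<open>auto simp: indicator_def\<close>)
  qed
  have \<psi>_bound: "\<bar>\<psi> z\<bar> \<le> lip * \<delta>" if "0 \<le> z" for z
    using increments_lipschitz[of "x - \<delta> - z" "x - z"] that x \<delta> by (simp add: \<psi>_def)
  have Icc_int: "integrable lborel (\<lambda>z. indicator {0<..<y} z * c)" for y c :: real
    by (cases "0 \<le> y") (auto intro!: integrable_mult_left integrable_real_indicator)
  have \<psi>_int: "integrable lborel (\<lambda>z. indicator {0<..<y} z * \<psi> z)" for y
  proof (rule Bochner_Integration.integrable_bound[OF Icc_int[of y "lip * \<delta>"]])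
    show "AE z in lborel. norm (indicator {0<..<y} z * \<psi> z) \<le> norm (indicator {0<..<y} z * (lip * \<delta>))"
      using \<psi>_bound lip_nonneg \<delta> by (auto simp: indicator_def abs_mult)
  qed measurable
  have small_y: "J y \<ge> - (lip * \<delta>) * y" if "0 < y" for y
  proof -
    have "(\<integral>z. indicator {0<..<y} z * (- (lip * \<delta>)) \<partial>lborel) \<le> J y"
      unfolding J_def
    proof (rule integral_mono[OF Icc_int \<psi>_int])
      fix z
      show "indicator {0<..<y} z * (- (lip * \<delta>)) \<le> indicator {0<..<y} z * \<psi> z"
        using \<psi>_bound[of z] by (auto simp: indicator_def abs_le_iff)
    qed
    then show ?thesis using that by (simp add: mult.commute)
  qed
  have Q_eq: "Q y = (\<integral>z. indicator {y..<y+\<delta>} z * increments (x - z) \<partial>lborel)" for y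
    unfolding Q_def by (subst (2) lborel_integral_real_affine[where c=1 and t=y])
      (auto simp: algebra_simps indicator_def intro!: Bochner_Integration.integral_cong)
  have Q_le: "Q y \<le> \<delta> * increments x" if "0 < y" for y
  proof -
    have "Q y \<le> (\<integral>z. indicator {y..<y+\<delta>} z * increments x \<partial>lborel)"
      unfolding Q_eq
    proof (rule integral_mono[OF increments_int[where c="y+\<delta>"]])
      show "integrable lborel (\<lambda>z. indicator {y..<y+\<delta>} z * increments x)"
        using \<delta> by (intro integrable_mult_left integrable_real_indicator) auto
      show "indicator {y..<y+\<delta>} z * increments (x - z) \<le> indicator {y..<y+\<delta>} z * increments x" for z
        using max[of "x - z"] x that by (auto simp: indicator_def)
    qed (use that in auto)
    then show ?thesis using \<delta> by simp
  qed
  have Q_nonneg: "0 \<le> Q y" for y unfolding Q_def by (intro integral_nonneg_AE) (simp add: increments_nonneg)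
  have large_y: "J y \<ge> \<delta> * increments x - lip * \<delta> * \<delta> - Q y" if y: "\<delta> < y" for y
  proof -
    have shift: "(\<integral>z. indicator {0<..<y} z * increments (x - \<delta> - z) \<partial>lborel)
      = (\<integral>z. indicator {\<delta><..<y+\<delta>} z * increments (x - z) \<partial>lborel)"
      by (subst (2) lborel_integral_real_affine[where c=1 and t=\<delta>])
        (auto simp: algebra_simps indicator_def intro!: Bochner_Integration.integral_cong)
    have i0: "integrable lborel (\<lambda>z. indicator {0<..<y} z * increments (x - z))"
      by (rule increments_int[where c=y]) auto
    have i1: "integrable lborel (\<lambda>z. indicator {0<..<y} z * increments (x - \<delta> - z))"
      using Bochner_Integration.integrable_diff[OF i0 \<psi>_int[of y]] by (simp add: \<psi>_def algebra_simps)
    have i2: "integrable lborel (\<lambda>z. indicator {\<delta><..<y+\<delta>} z * increments (x - z))"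
      by (rule increments_int[where c="y+\<delta>"]) (use \<delta> in auto)
    have i3: "integrable lborel (\<lambda>z. indicator {0<..\<delta>} z * increments (x - z))"
      by (rule increments_int[where c="\<delta>"]) (use \<delta> in auto)
    have i4: "integrable lborel (\<lambda>z. indicator {y..<y+\<delta>} z * increments (x - z))"
      by (rule increments_int[where c="y+\<delta>"]) (use \<delta> y in auto)
    have "J y = (\<integral>z. indicator {0<..<y} z * increments (x - z) - indicator {0<..<y} z * increments (x - \<delta> - z) \<partial>lborel)"
      unfolding J_def \<psi>_def by (simp add: right_diff_distrib)
    also have "\<dots> = (\<integral>z. indicator {0<..<y} z * increments (x - z) - indicator {\<delta><..<y+\<delta>} z * increments (x - z) \<partial>lborel)"
      using i0 i1 i2 shift by simp
    also have "\<dots> = (\<integral>z. indicator {0<..\<delta>} z * increments (x - z) - indicator {y..<y+\<delta>} z * increments (x - z) \<partial>lborel)"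
      using y \<delta> by (intro Bochner_Integration.integral_cong) (auto simp: indicator_def)
    also have "\<dots> = (\<integral>z. indicator {0<..\<delta>} z * increments (x - z) \<partial>lborel) - Q y"
      using i3 i4 by (simp add: Q_eq)
    finally have J: "J y = (\<integral>z. indicator {0<..\<delta>} z * increments (x - z) \<partial>lborel) - Q y" .
    have "(\<integral>z. indicator {0<..\<delta>} z * (increments x - lip * \<delta>) \<partial>lborel) \<le> (\<integral>z. indicator {0<..\<delta>} z * increments (x - z) \<partial>lborel)"
    proof (rule integral_mono[OF _ i3])
      show "integrable lborel (\<lambda>z. indicator {0<..\<delta>} z * (increments x - lip * \<delta>))"
        using \<delta> by (intro integrable_mult_left integrable_real_indicator) auto
      show "indicator {0<..\<delta>} z * (increments x - lip * \<delta>) \<le> indicator {0<..\<delta>} z * increments (x - z)" for z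
      proof (cases "z \<in> {0<..\<delta>}")
        case True
        have "\<bar>increments x - increments (x - z)\<bar> \<le> lip * z" using increments_lipschitz[of "x - z" x] x True by simp
        also have "\<dots> \<le> lip * \<delta>" using lip_nonneg True by (intro mult_left_mono) auto
        finally show ?thesis using True by auto
      qed simp
    qed
    then show ?thesis using J \<delta> by (simp add: algebra_simps)
  qed
  \<comment> \<open>Near \<open>0\<close> the Lipschitz bound is needed because the Levy measure is infinite there;
    between \<open>\<delta>\<close> and \<open>\<eta>\<close> it is the maximality of \<open>x\<close> that makes the contribution harmless.\<close>
  have lower: "AE y in \<nu>. - (lip * \<delta>) * min y \<delta> + indicator {\<eta><..} y * (\<delta> * increments x - Q y) \<le> J y"
    using AE_pos
  proof eventually_elim
    case (elim y)
    consider "y \<le> \<delta>" | "\<delta> < y" "y \<le> \<eta>" | "\<eta> < y" by linarith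
    then show ?case
    proof cases
      case 1 then show ?thesis using small_y[OF elim] \<delta> by simp
    next
      case 2 then show ?thesis using large_y[of y] Q_le[OF elim] by simp
    next
      case 3 then show ?thesis using large_y[of y] \<delta> by simp
    qed
  qed
  have fin: "emeasure \<nu> {\<eta><..} < \<infinity>" by (rule emeasure_tail_finite[OF \<eta>])
  have ind_int: "integrable \<nu> (indicator {\<eta><..} :: real \<Rightarrow> real)"
    using fin by (intro integrable_real_indicator) (auto simp: sets_nu)
  have Q_int: "integrable \<nu> (\<lambda>y. indicator {\<eta><..} y * Q y)"
  proof (rule integrable_mult_bounded[OF ind_int])
    show "AE y in \<nu>. \<bar>Q y\<bar> \<le> \<delta> * increments x"
      using AE_pos by eventually_elim (use Q_le Q_nonneg in auto)
  qed measurable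
  have Q_bound: "(\<integral>y. indicator {\<eta><..} y * Q y \<partial>\<nu>) \<le> \<delta> * (\<epsilon> * U T)"
  proof -
    have q: "ennreal (Q y) = (\<integral>\<^sup>+ r. indicator {0..<\<delta>} r * ennreal (increments (x - r - y)) \<partial>lborel)" if "0 < y" for y
    proof -
      have "integrable lborel (\<lambda>z. indicator {y..<y+\<delta>} z * increments (x - z))"
        by (rule increments_int[where c="y+\<delta>"]) (use \<delta> that in auto)
      from lborel_integrable_real_affine[OF this, of 1 y]
      have "integrable lborel (\<lambda>r. indicator {0..<\<delta>} r * increments (x - y - r))"
        by (rule Bochner_Integration.integrable_cong[THEN iffD1, rotated -1]) (auto simp: indicator_def algebra_simps)
      then have "ennreal (Q y) = (\<integral>\<^sup>+ r. ennreal (indicator {0..<\<delta>} r * increments (x - y - r)) \<partial>lborel)"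
        unfolding Q_def by (intro nn_integral_eq_integral[symmetric]) (auto simp: increments_nonneg)
      also have "\<dots> = (\<integral>\<^sup>+ r. indicator {0..<\<delta>} r * ennreal (increments (x - r - y)) \<partial>lborel)"
        by (intro nn_integral_cong) (auto simp: indicator_def algebra_simps)
      finally show ?thesis .
    qed
    have "ennreal (\<integral>y. indicator {\<eta><..} y * Q y \<partial>\<nu>) = (\<integral>\<^sup>+ y. ennreal (indicator {\<eta><..} y * Q y) \<partial>\<nu>)"
      using Q_int Q_nonneg by (intro nn_integral_eq_integral[symmetric]) auto
    also have "\<dots> = (\<integral>\<^sup>+ y. (\<integral>\<^sup>+ r. indicator {\<eta><..} y * (indicator {0..<\<delta>} r * ennreal (increments (x - r - y))) \<partial>lborel) \<partial>\<nu>)"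
    proof (rule nn_integral_cong)
      fix y
      show "ennreal (indicator {\<eta><..} y * Q y)
        = (\<integral>\<^sup>+ r. indicator {\<eta><..} y * (indicator {0..<\<delta>} r * ennreal (increments (x - r - y))) \<partial>lborel)"
        using q[of y] \<eta> by (cases "\<eta> < y") auto
    qed
    also have "\<dots> = (\<integral>\<^sup>+ r. (\<integral>\<^sup>+ y. indicator {\<eta><..} y * (indicator {0..<\<delta>} r * ennreal (increments (x - r - y))) \<partial>\<nu>) \<partial>lborel)"
      by (rule pair.Fubini') measurable
    also have "\<dots> \<le> (\<integral>\<^sup>+ r. ennreal (\<epsilon> * U T) * indicator {0..<\<delta>} r \<partial>lborel)"
    proof (rule nn_integral_mono)
      fix r
      show "(\<integral>\<^sup>+ y. indicator {\<eta><..} y * (indicator {0..<\<delta>} r * ennreal (increments (x - r - y))) \<partial>\<nu>)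
        \<le> ennreal (\<epsilon> * U T) * indicator {0..<\<delta>} r"
        using big_jumps_bound[of "x - r"] x by (cases "r \<in> {0..<\<delta>}") auto
    qed
    also have "\<dots> = ennreal (\<epsilon> * U T) * ennreal \<delta>"
      using \<delta> by (subst nn_integral_cmult_indicator) auto
    also have "\<dots> = ennreal (\<delta> * (\<epsilon> * U T))"
      using \<epsilon> U_nonneg \<delta> by (simp add: ennreal_mult'[symmetric] mult.commute)
    finally show ?thesis using \<epsilon> U_nonneg \<delta> by (subst (asm) ennreal_le_iff) auto
  qed
  have "(\<integral>y. - (lip * \<delta>) * min y \<delta> + indicator {\<eta><..} y * (\<delta> * increments x - Q y) \<partial>\<nu>)
     = - (lip * \<delta>) * (\<integral>y. min y \<delta> \<partial>\<nu>) + (\<delta> * increments x * k \<eta> - (\<integral>y. indicator {\<eta><..} y * Q y \<partial>\<nu>))"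
    and low_int: "integrable \<nu> (\<lambda>y. - (lip * \<delta>) * min y \<delta> + indicator {\<eta><..} y * (\<delta> * increments x - Q y))"
    using min_integrable[of \<delta>] \<delta> ind_int Q_int
    by (simp_all add: right_diff_distrib levy_tail_def sets_nu)
  with integral_mono_AE[OF low_int J_int lower] J_le Q_bound
  have "\<delta> * increments x * k \<eta> \<le> \<delta> + \<delta> * (\<epsilon> * U T) + lip * \<delta> * (\<integral>y. min y \<delta> \<partial>\<nu>)" by simp
  then have "\<delta> * (increments x * k \<eta>) \<le> \<delta> * (1 + \<epsilon> * U T + lip * (\<integral>y. min y \<delta> \<partial>\<nu>))"
    by (simp add: algebra_simps)
  then show ?thesis using \<delta> by simp
qed

lemma smoothed_increments_le:
  assumes disj: "disjoint_family_on (\<lambda>i. {u i<..<v i}) {..<n}"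
  shows "(\<Sum>i<n. smoothed h (v i) - smoothed h (u i)) * k \<eta> \<le> 1 + \<epsilon> * U T"
proof -
  obtain x where x: "x \<le> 0" "\<And>y. y \<le> 0 \<Longrightarrow> increments y \<le> increments x" using increments_max by blast
  define d where "d m = \<eta> / real (Suc m)" for m
  have d: "0 < d m" "d m \<le> \<eta>" for m using \<eta> by (auto simp: d_def field_simps)
  have d0: "d \<longlonglongrightarrow> 0" unfolding d_def by real_asymp
  have "(\<lambda>m. \<integral>y. min y (d m) \<partial>\<nu>) \<longlonglongrightarrow> (\<integral>y. 0 \<partial>\<nu>)"
  proof (rule integral_dominated_convergence[where w="\<lambda>y. min y \<eta>"])
    show "integrable \<nu> (\<lambda>y. min y \<eta>)" using \<eta> by (intro min_integrable) auto
    show "AE y in \<nu>. (\<lambda>m. min y (d m)) \<longlonglongrightarrow> 0"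
      using AE_pos
    proof eventually_elim
      case (elim y)
      have "(\<lambda>m. min y (d m)) \<longlonglongrightarrow> min y 0" by (intro tendsto_intros d0)
      then show ?case using elim by simp
    qed
    show "AE y in \<nu>. norm (min y (d m)) \<le> min y \<eta>" for m
      using AE_pos
    proof eventually_elim
      case (elim y)
      show ?case using elim d[of m] by (auto simp: min_def)
    qed
  qed auto
  then have "(\<lambda>m. 1 + \<epsilon> * U T + lip * (\<integral>y. min y (d m) \<partial>\<nu>)) \<longlonglongrightarrow> 1 + \<epsilon> * U T + lip * 0"
    by (intro tendsto_intros) simp
  then have "increments x * k \<eta> \<le> 1 + \<epsilon> * U T + lip * 0"
    by (rule LIMSEQ_le_const) (use maximum_estimate[OF disj x d] in blast)
  moreover have "increments 0 * k \<eta> \<le> increments x * k \<eta>" using x by (intro mult_right_mono tail_nonneg) auto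
  ultimately show ?thesis by (simp add: increments_def)
qed

end

text \<open>
  Smoothing is removed by monotonicity: the moving average lies between \<open>U (t - h)\<close> and \<open>U t\<close>. The
  intervals are moved right by \<open>h\<close>, so that the average dominates \<open>U\<close> at the right end points, and right
  continuity takes care of the left end points.
\<close>

lemma U_abs_continuous:
  assumes ac: "\<And>x y. 0 < x \<Longrightarrow> x < y \<Longrightarrow> abs_continuous_on {x..y} k" and T: "0 \<le> T"
  shows "abs_continuous_on {0..T} U"
  unfolding abs_continuous_on_def
proof (intro allI impI)
  fix e :: real assume e: "0 < e"
  define C where "C = 1 + U (T + 1)"
  obtain \<eta> where \<eta>: "0 < \<eta>" "C / e < k \<eta>" using tail_unbounded[of 1] by auto
  have C: "C > 0" using U_nonneg[of "T + 1"] by (simp add: C_def)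
  have k\<eta>: "k \<eta> > 0" using \<eta>(2) C e by (smt (verit) divide_pos_pos)
  have "abs_continuous_on {\<eta>..\<eta> + T + 1} k" using ac[of \<eta> "\<eta> + T + 1"] \<eta> T by auto
  then obtain d where d: "0 < d" "\<And>(n::nat) u v. (\<forall>i<n. u i \<le> v i \<and> {u i..v i} \<subseteq> {\<eta>..\<eta> + T + 1}) \<Longrightarrow>
      disjoint_family_on (\<lambda>i. {u i<..<v i}) {..<n} \<Longrightarrow>
      (\<Sum>i<n. v i - u i) < d \<Longrightarrow> (\<Sum>i<n. \<bar>k (v i) - k (u i)\<bar>) < 1"
    unfolding abs_continuous_on_def by (meson zero_less_one)
  show "\<exists>\<delta>>0. \<forall>(n::nat) u v. (\<forall>i<n. u i \<le> v i \<and> {u i..v i} \<subseteq> {0..T}) \<longrightarrow>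
      disjoint_family_on (\<lambda>i. {u i<..<v i}) {..<n} \<longrightarrow>
      (\<Sum>i<n. v i - u i) < \<delta> \<longrightarrow> (\<Sum>i<n. \<bar>U (v i) - U (u i)\<bar>) < e"
  proof (intro exI[of _ d] conjI allI impI d(1))
    fix n :: nat and u v :: "nat \<Rightarrow> real"
    assume uv: "\<forall>i<n. u i \<le> v i \<and> {u i..v i} \<subseteq> {0..T}"
      and disj: "disjoint_family_on (\<lambda>i. {u i<..<v i}) {..<n}"
      and len: "(\<Sum>i<n. v i - u i) < d"
    have uv': "0 \<le> u i" "u i \<le> v i" "v i \<le> T" if "i < n" for i using uv that by auto
    have shift_disj: "disjoint_family_on (\<lambda>i. {u i + c<..<v i + c}) {..<n}" for c
      unfolding disjoint_family_on_def
    proof (intro ballI impI equals0I)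
      fix i j z assume "i \<in> {..<n}" "j \<in> {..<n}" "i \<noteq> j"
        "z \<in> {u i + c<..<v i + c} \<inter> {u j + c<..<v j + c}"
      moreover from this have "z - c \<in> {u i<..<v i} \<inter> {u j<..<v j}" by auto
      ultimately show False using disj unfolding disjoint_family_on_def by blast
    qed
    have bound: "(\<Sum>i<n. U (v i) - U (u i + h)) \<le> C / k \<eta>" if h: "0 < h" "h < 1" for h
    proof -
      have small: "(\<Sum>i<n. k (max \<eta> (u i + h + c)) - k (max \<eta> (v i + h + c))) \<le> 1" if c: "c \<le> 0" for c
      proof -
        have "(\<Sum>i<n. k (max \<eta> (u i + h + c)) - k (max \<eta> (v i + h + c)))
          \<le> (\<Sum>i<n. \<bar>k (max \<eta> (v i + h + c)) - k (max \<eta> (u i + h + c))\<bar>)"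
          by (intro sum_mono) linarith
        also have "\<dots> < 1"
        proof (rule d(2))
          show "\<forall>i<n. max \<eta> (u i + h + c) \<le> max \<eta> (v i + h + c) \<and>
             {max \<eta> (u i + h + c)..max \<eta> (v i + h + c)} \<subseteq> {\<eta>..\<eta> + T + 1}"
            using uv' c h \<eta> T by (auto intro: max.coboundedI2) (smt (verit))+
          show "disjoint_family_on (\<lambda>i. {max \<eta> (u i + h + c)<..<max \<eta> (v i + h + c)}) {..<n}"
            using shift_disj[of "h + c"] unfolding disjoint_family_on_def
            by (fastforce simp: add.assoc)
          have "(\<Sum>i<n. max \<eta> (v i + h + c) - max \<eta> (u i + h + c)) \<le> (\<Sum>i<n. v i - u i)"
          proof (rule sum_mono)
            fix i assume "i \<in> {..<n}"
            then have "u i \<le> v i" using uv' by auto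
            then show "max \<eta> (v i + h + c) - max \<eta> (u i + h + c) \<le> v i - u i" by (auto simp: max_def)
          qed
          then show "(\<Sum>i<n. max \<eta> (v i + h + c) - max \<eta> (u i + h + c)) < d" using len by linarith
        qed
        finally show ?thesis by simp
      qed
      have "(\<Sum>i<n. smoothed h (v i + h) - smoothed h (u i + h)) * k \<eta> \<le> 1 + 1 * U (T + 1)"
        by (rule smoothed_increments_le[where \<epsilon>=1 and u="\<lambda>i. u i + h" and v="\<lambda>i. v i + h"])
          (use h \<eta> T small uv' shift_disj[of h] in \<open>auto intro: add_mono\<close>)
      moreover have "(\<Sum>i<n. U (v i) - U (u i + h)) \<le> (\<Sum>i<n. smoothed h (v i + h) - smoothed h (u i + h))"
      proof (intro sum_mono diff_mono)
        show "U (v i) \<le> smoothed h (v i + h)" for i using smoothed_ge[OF h(1), of "v i + h"] by simp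
        show "smoothed h (u i + h) \<le> U (u i + h)" for i by (rule smoothed_le[OF h(1)])
      qed
      ultimately have "(\<Sum>i<n. U (v i) - U (u i + h)) * k \<eta> \<le> C"
        using k\<eta> unfolding C_def by (smt (verit) mult_right_mono)
      then show ?thesis using k\<eta> by (simp add: field_simps)
    qed
    have "((\<lambda>h. \<Sum>i<n. U (v i) - U (u i + h)) \<longlongrightarrow> (\<Sum>i<n. U (v i) - U (u i))) (at_right 0)"
    proof (intro tendsto_intros)
      fix i
      have "filterlim (\<lambda>h. u i + h) (at_right (u i)) (at_right 0)"
        by (auto simp: filterlim_at eventually_at_filter intro!: tendsto_eq_intros)
      with U_rc[of "u i"] show "((\<lambda>h. U (u i + h)) \<longlongrightarrow> U (u i)) (at_right 0)"
        unfolding continuous_within by (rule filterlim_compose)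
    qed
    moreover have "eventually (\<lambda>h::real. 0 < h \<and> h < 1) (at_right 0)"
      by (auto simp: eventually_at_right_field intro!: exI[of _ 1])
    then have "eventually (\<lambda>h. (\<Sum>i<n. U (v i) - U (u i + h)) \<le> C / k \<eta>) (at_right 0)"
      by eventually_elim (use bound in auto)
    ultimately have "(\<Sum>i<n. U (v i) - U (u i)) \<le> C / k \<eta>"
      by (intro tendsto_upperbound) auto
    also have "\<dots> < e" using \<eta>(2) e k\<eta> C by (simp add: field_simps)
    finally show "(\<Sum>i<n. \<bar>U (v i) - U (u i)\<bar>) < e"
      using uv' monoD[OF U_mono] by (simp add: abs_of_nonneg)
  qed
qed

end

text \<open>
  Since \<open>U\<close> is nondecreasing, the renewal equation bounds \<open>U 0\<close> times the integral of \<open>k\<close> up to \<open>t\<close> by \<open>t\<close>;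
  that integral is at least \<open>t k(t)\<close>, and \<open>k\<close> is unbounded near \<open>0\<close>.
\<close>

lemma (in renewal) U_zero: "U 0 = 0"
proof (rule ccontr)
  assume "U 0 \<noteq> 0"
  then have U0: "U 0 > 0" using U_nonneg[of 0] by simp
  then obtain t where t: "0 < t" "1 / U 0 < k t" using tail_unbounded[of 1] by auto
  have "U 0 * (\<integral>z. indicator {..t} z * k z \<partial>lborel) = (\<integral>z. U 0 * (indicator {..t} z * k z) \<partial>lborel)" by simp
  also have "\<dots> \<le> conv U k t"
    unfolding conv_def
  proof (rule integral_mono[OF _ conv_integrable[OF U_locbdd tail_locint]])
    show "integrable lborel (\<lambda>z. U 0 * (indicator {..t} z * k z))" using integrable_cut[OF tail_locint] by simp
    show "U 0 * (indicator {..t} z * k z) \<le> U (t - z) * k z" for z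
      using tail_nonneg[of z] U_nonneg[of "t - z"] monoD[OF U_mono, of 0 "t - z"]
      by (auto simp: indicator_def intro!: mult_right_mono)
  qed
  also have "\<dots> \<le> t"
  proof -
    have "conv U k t = t - b * U t" using renewal_eq[of t] t by simp
    moreover have "0 \<le> b * U t" using b U_nonneg by simp
    ultimately show ?thesis by linarith
  qed
  finally have "U 0 * (t * k t) \<le> t"
    using tail_integral_ge[OF t(1)] U0 by (meson mult_left_mono order_trans less_imp_le)
  then have "t * (U 0 * k t) \<le> t * 1" by (simp add: ac_simps)
  then have "U 0 * k t \<le> 1" using t(1) by (simp only: mult_le_cancel_left_pos)
  then show False using t(2) U0 by (simp add: field_simps)
qed

section \<open>Laws of a subordinator and weighted occupation functions\<close>

definition exp_bounded :: "real \<Rightarrow> real \<Rightarrow> (real \<Rightarrow> real) \<Rightarrow> bool" where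
  "exp_bounded C c h \<longleftrightarrow> h \<in> borel_measurable borel \<and> (\<forall>s\<ge>0. \<bar>h s\<bar> \<le> C * exp (c * s))"

text \<open>
  The distribution functions of the one-dimensional laws: \<open>p s t\<close> is the probability that the process is
  at most \<open>t\<close> at time \<open>s\<close>. The value \<open>0\<close> at \<open>s \<le> 0\<close> is a convention that lets integrals over \<open>s\<close> extend over the
  whole line.
\<close>

locale subordinator_law = levy_measure +
  fixes b :: real and p :: "real \<Rightarrow> real \<Rightarrow> real"
  assumes b: "0 \<le> b"
    and p_nonneg: "0 \<le> p s t" and p_le_1: "p s t \<le> 1"
    and p_nonpos: "s \<le> 0 \<Longrightarrow> p s t = 0"
    and p_neg: "t < 0 \<Longrightarrow> p s t = 0"
    and p_mono: "t \<le> t' \<Longrightarrow> p s t \<le> p s t'"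
    and p_rc: "continuous (at_right t) (p s)"
    and p_antimono: "0 < s \<Longrightarrow> s \<le> s' \<Longrightarrow> p s' t \<le> p s t"
    and p_laplace: "0 < s \<Longrightarrow> 0 < x \<Longrightarrow> (\<integral>t. exp (- x * t) * p s t \<partial>lborel)
      = exp (- s * (b * x + (\<integral>y. (1 - exp (- y * x)) \<partial>\<nu>))) / x"
begin

definition bernstein :: "real \<Rightarrow> real" where
  "bernstein x = b * x + (\<integral>y. (1 - exp (- y * x)) \<partial>\<nu>)"

lemma bernstein_eq: "0 < x \<Longrightarrow> bernstein x = x * (b + (\<integral>z. exp (- x * z) * k z \<partial>lborel))"
  unfolding bernstein_def by (subst tail_laplace(2)) (auto simp: field_simps)

lemma bernstein_unbounded: "\<exists>x0>0. \<forall>x\<ge>x0. c < bernstein x"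
proof -
  obtain x0 where x0: "x0 > 0" "\<forall>x\<ge>x0. c < (\<integral>y. (1 - exp (- y * x)) \<partial>\<nu>)"
    using exponent_unbounded by blast
  have "c < bernstein x" if "x0 \<le> x" for x
  proof -
    have "0 \<le> b * x" using b x0 that by (intro mult_nonneg_nonneg) auto
    moreover have "c < (\<integral>y. (1 - exp (- y * x)) \<partial>\<nu>)" using x0 that by blast
    ultimately show ?thesis by (simp add: bernstein_def)
  qed
  then show ?thesis using x0 by blast
qed

lemma p_measurable_t[measurable]: "p s \<in> borel_measurable borel"
  by (rule borel_measurable_mono) (auto intro: monoI p_mono)

lemma p_measurable_s: "(\<lambda>s. p s t) \<in> borel_measurable borel"
proof -
  have "mono (\<lambda>s. - p (exp s) t)" by (intro monoI) (simp add: p_antimono)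
  then have [measurable]: "(\<lambda>s. - p (exp s) t) \<in> borel_measurable borel" by (rule borel_measurable_mono)
  have "(\<lambda>s. p s t) = (\<lambda>s. if s \<le> 0 then 0 else - (- p (exp (ln s)) t))" by (auto simp: p_nonpos)
  also have "\<dots> \<in> borel_measurable borel" by measurable
  finally show ?thesis .
qed

lemma p_measurable[measurable]: "(\<lambda>(s, t). p s t) \<in> borel_measurable (borel \<Otimes>\<^sub>M borel)"
proof -
  \<comment> \<open>Rounding \<open>t\<close> up to a grid leaves countably many sections; it has to be strictly upwards because \<open>p s\<close>
    is continuous from the right only.\<close>
  define q where "q n t = (real_of_int \<lfloor>t * real (Suc n)\<rfloor> + 1) / real (Suc n)" for n t
  have q: "t < q n t" "q n t \<le> t + 1 / real (Suc n)" for n t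
  proof -
    have m: "0 < real (Suc n)" by simp
    show "t < q n t" unfolding q_def pos_less_divide_eq[OF m] by linarith
    show "q n t \<le> t + 1 / real (Suc n)"
      unfolding q_def add_divide_distrib by (simp only: add_le_cancel_right pos_divide_le_eq[OF m]) linarith
  qed
  have "(\<lambda>x. p (fst x) (snd x)) \<in> borel_measurable (borel \<Otimes>\<^sub>M borel)"
  proof (rule borel_measurable_LIMSEQ_real)
    fix x :: "real \<times> real"
    have "(\<lambda>n. q n (snd x)) \<longlonglongrightarrow> snd x"
    proof (rule tendsto_sandwich[where f="\<lambda>_. snd x" and h="\<lambda>n. snd x + 1 / real (Suc n)"])
      have "(\<lambda>n. 1 / real (Suc n)) \<longlonglongrightarrow> 0" by (rule LIMSEQ_Suc[OF lim_1_over_n])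
      then show "(\<lambda>n. snd x + 1 / real (Suc n)) \<longlonglongrightarrow> snd x" by (auto intro: tendsto_eq_intros)
    qed (use q in \<open>auto intro!: always_eventually less_imp_le\<close>)
    then have "filterlim (\<lambda>n. q n (snd x)) (at_right (snd x)) sequentially"
      using q(1) by (auto simp: filterlim_at intro!: always_eventually) (metis less_irrefl)
    with p_rc show "(\<lambda>n. p (fst x) (q n (snd x))) \<longlonglongrightarrow> p (fst x) (snd x)"
      unfolding continuous_within by (rule filterlim_compose)
  next
    fix n
    show "(\<lambda>x. p (fst x) (q n (snd x))) \<in> borel_measurable (borel \<Otimes>\<^sub>M borel)"
      unfolding q_def
    proof (rule measurable_compose_countable[where g="\<lambda>x. \<lfloor>snd x * real (Suc n)\<rfloor>"
          and f="\<lambda>i x. p (fst x) ((real_of_int i + 1) / real (Suc n))"])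
      show "(\<lambda>x. p (fst x) ((real_of_int i + 1) / real (Suc n))) \<in> borel_measurable (borel \<Otimes>\<^sub>M borel)" for i
        by (rule measurable_compose[OF measurable_fst p_measurable_s])
    qed measurable
  qed
  then show ?thesis by (simp add: split_beta')
qed

lemma p_abs: "\<bar>p s t\<bar> = p s t" by (simp add: p_nonneg)

lemma p_exp_integrable:
  assumes "0 < x"
  shows "integrable lborel (\<lambda>t. exp (- x * t) * p s t)"
proof -
  have "integrable lborel (\<lambda>t. indicator {0..} t * exp (- x * t) * p s t)"
    by (rule integrable_mult_bounded[OF exp_atLeast_integral(1)[OF assms], where C=1])
      (auto simp: p_abs p_le_1)
  then show ?thesis
    by (rule Bochner_Integration.integrable_cong[THEN iffD1, rotated -1]) (auto simp: indicator_def p_neg)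
qed

text \<open>
  Markov's inequality for \<open>exp (- x * \<sigma>)\<close>, read off from the transform of the distribution function.
\<close>

lemma p_chernoff:
  assumes s: "0 < s" and x: "0 < x"
  shows "p s t \<le> exp (x * t) * exp (- s * bernstein x)"
proof -
  have "p s t * exp (- x * t) / x = (\<integral>r. p s t * (indicator {t..} r * exp (- x * r)) \<partial>lborel)"
    using exp_atLeast_integral[OF x, of t] by simp
  also have "\<dots> \<le> (\<integral>r. exp (- x * r) * p s r \<partial>lborel)"
  proof (rule integral_mono[OF _ p_exp_integrable[OF x]])
    show "integrable lborel (\<lambda>r. p s t * (indicator {t..} r * exp (- x * r)))"
      using exp_atLeast_integral[OF x, of t] by simp
    show "p s t * (indicator {t..} r * exp (- x * r)) \<le> exp (- x * r) * p s r" for r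
      by (auto simp: indicator_def p_nonneg mult.commute intro!: mult_left_mono p_mono)
  qed
  also have "\<dots> = exp (- s * bernstein x) / x" using p_laplace[OF s x] by (simp add: bernstein_def)
  finally have "p s t * exp (- x * t) \<le> exp (- s * bernstein x)" using x by (simp add: divide_le_cancel)
  then have "p s t * exp (- x * t) * exp (x * t) \<le> exp (- s * bernstein x) * exp (x * t)" by (intro mult_right_mono) auto
  moreover have "exp (- x * t) * exp (x * t) = 1" by (simp add: exp_add[symmetric])
  ultimately show ?thesis by (simp only: mult.assoc mult_1_right mult.commute[of "exp (- s * bernstein x)"])
qed

text \<open>
  The expected amount of \<open>h\<close> accumulated while the process is in \<open>[0, t]\<close>; in terms of the inverse
  process, the expectation of the integral of \<open>h\<close> from \<open>0\<close> to \<open>L\<^sub>t\<close>.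
\<close>

definition occ :: "(real \<Rightarrow> real) \<Rightarrow> real \<Rightarrow> real" where
  "occ h t = (\<integral>s. h s * p s t \<partial>lborel)"

context
  fixes C c :: real and h :: "real \<Rightarrow> real"
  assumes h: "exp_bounded C c h"
begin

lemma h_measurable: "h \<in> borel_measurable borel"
  using h by (simp add: exp_bounded_def)

lemma C_nonneg: "0 \<le> C"
proof -
  have "0 \<le> C * exp (c * 0)" using h unfolding exp_bounded_def by (meson abs_ge_zero order_refl order_trans)
  then show ?thesis by simp
qed

lemma weighted_law_bound:
  assumes x: "0 < x"
  shows "\<bar>h s * p s t\<bar> \<le> C * exp (x * t) * (indicator {0..} s * exp (- (bernstein x - c) * s))"
proof (cases "0 < s")
  case True
  have "\<bar>h s * p s t\<bar> \<le> (C * exp (c * s)) * (exp (x * t) * exp (- s * bernstein x))"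
    unfolding abs_mult p_abs using h True p_chernoff[OF True x]
    by (intro mult_mono) (auto simp: exp_bounded_def p_nonneg C_nonneg)
  also have "\<dots> = C * exp (x * t) * exp (- (bernstein x - c) * s)"
    by (simp add: exp_add[symmetric] algebra_simps)
  finally show ?thesis using True by simp
qed (simp add: p_nonpos C_nonneg)

lemma weighted_law_integrable: "integrable lborel (\<lambda>s. h s * p s t)"
proof -
  obtain x where x: "x > 0" "c < bernstein x" using bernstein_unbounded[of c] by blast
  note [measurable] = h_measurable p_measurable_s
  show ?thesis
  proof (rule Bochner_Integration.integrable_bound)
    show "integrable lborel (\<lambda>s. C * exp (x * t) * (indicator {0..} s * exp (- (bernstein x - c) * s)))"
      using exp_atLeast_integral(1)[of "bernstein x - c" 0] x by auto
    show "AE s in lborel. norm (h s * p s t) \<le> norm (C * exp (x * t) * (indicator {0..} s * exp (- (bernstein x - c) * s)))"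
      using weighted_law_bound[OF x(1)] by (auto intro!: order_trans[OF _ abs_ge_self])
  qed measurable
qed

lemma occ_bound:
  assumes x: "0 < x" "c < bernstein x"
  shows "\<bar>occ h t\<bar> \<le> C * exp (x * t) / (bernstein x - c)"
proof -
  have "\<bar>occ h t\<bar> \<le> (\<integral>s. \<bar>h s * p s t\<bar> \<partial>lborel)" unfolding occ_def by (rule integral_abs_bound)
  also have "\<dots> \<le> (\<integral>s. C * exp (x * t) * (indicator {0..} s * exp (- (bernstein x - c) * s)) \<partial>lborel)"
    using exp_atLeast_integral(1)[of "bernstein x - c" 0] x
    by (intro integral_mono weighted_law_bound integrable_abs weighted_law_integrable) auto
  also have "\<dots> = C * exp (x * t) / (bernstein x - c)"
    using exp_atLeast_integral(2)[of "bernstein x - c" 0] x by simp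
  finally show ?thesis .
qed

lemma occ_measurable: "occ h \<in> borel_measurable borel"
  using h_measurable unfolding occ_def[abs_def] by measurable

lemma occ_neg: "t < 0 \<Longrightarrow> occ h t = 0" by (simp add: occ_def p_neg)

lemma occ_locbdd: "locbdd (occ h)"
  unfolding locbdd_def
proof (intro conjI allI impI occ_measurable occ_neg)
  fix T
  obtain x where x: "x > 0" "c < bernstein x" using bernstein_unbounded[of c] by blast
  have "\<bar>occ h t\<bar> \<le> C * exp (x * T) / (bernstein x - c)" if "t \<le> T" for t
  proof -
    note occ_bound[OF x]
    also have "C * exp (x * t) / (bernstein x - c) \<le> C * exp (x * T) / (bernstein x - c)"
      using that x C_nonneg by (intro divide_right_mono mult_left_mono) auto
    finally show ?thesis .
  qed
  then show "\<exists>C. \<forall>t\<le>T. \<bar>occ h t\<bar> \<le> C" by blast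
qed auto

lemma occ_rc: "continuous (at_right t) (occ h)"
  unfolding continuous_within
proof (rule tendsto_at_right_sequentially[of t "t + 1"])
  fix S :: "nat \<Rightarrow> real"
  assume S: "\<And>n. t < S n" "\<And>n. S n < t + 1" "S \<longlonglongrightarrow> t"
  note [measurable] = h_measurable p_measurable_s
  show "(\<lambda>n. occ h (S n)) \<longlonglongrightarrow> occ h t"
    unfolding occ_def
  proof (rule integral_dominated_convergence[where w="\<lambda>s. \<bar>h s * p s (t + 1)\<bar>"])
    show "integrable lborel (\<lambda>s. \<bar>h s * p s (t + 1)\<bar>)" using weighted_law_integrable by auto
    show "AE s in lborel. (\<lambda>n. h s * p s (S n)) \<longlonglongrightarrow> h s * p s t"
    proof (rule AE_I2)
      fix s
      have "filterlim S (at_right t) sequentially"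
        using S by (auto simp: filterlim_at intro!: always_eventually)
      with p_rc[of t s] have "(\<lambda>n. p s (S n)) \<longlonglongrightarrow> p s t"
        unfolding continuous_within by (rule filterlim_compose)
      then show "(\<lambda>n. h s * p s (S n)) \<longlonglongrightarrow> h s * p s t" by (intro tendsto_intros)
    qed
    show "AE s in lborel. norm (h s * p s (S n)) \<le> \<bar>h s * p s (t + 1)\<bar>" for n
      using S(2)[of n] by (auto simp: abs_mult p_abs intro!: mult_left_mono p_mono)
  qed measurable
qed simp

text \<open>
  The subordination principle: Fubini's theorem turns the transform in \<open>t\<close> into one in \<open>s\<close>, evaluated at
  the Laplace exponent.
\<close>

lemma occ_laplace:
  assumes x: "0 < x" "c < bernstein x"
  shows "integrable lborel (\<lambda>t. exp (- x * t) * occ h t)"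
    and "(\<integral>t. exp (- x * t) * occ h t \<partial>lborel) = (\<integral>s. indicator {0<..} s * h s * exp (- s * bernstein x) \<partial>lborel) / x"
proof -
  note [measurable] = h_measurable p_measurable_s
  have inner: "(\<integral>t. exp (- x * t) * (r * p s t) \<partial>lborel) = indicator {0<..} s * r * exp (- s * bernstein x) / x" for r s
  proof (cases "0 < s")
    case True
    have "(\<integral>t. exp (- x * t) * (r * p s t) \<partial>lborel) = r * (\<integral>t. exp (- x * t) * p s t \<partial>lborel)"
      by (subst Bochner_Integration.integral_mult_right_zero[symmetric]) (simp add: ac_simps)
    then show ?thesis using p_laplace[OF True x(1)] True by (simp add: bernstein_def)
  qed (simp add: p_nonpos)
  have "integrable (lborel \<Otimes>\<^sub>M lborel) (\<lambda>(s, t). exp (- x * t) * (h s * p s t))"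
  proof (rule lborel_pair.Fubini_integrable)
    show "(\<lambda>(s, t). exp (- x * t) * (h s * p s t)) \<in> borel_measurable (lborel \<Otimes>\<^sub>M lborel)" by measurable
    show "AE s in lborel. integrable lborel (\<lambda>t. case (s, t) of (s, t) \<Rightarrow> exp (- x * t) * (h s * p s t))"
      using p_exp_integrable[OF x(1)] by (auto simp: mult.left_commute)
    have "integrable lborel (\<lambda>s. indicator {0<..} s * \<bar>h s\<bar> * exp (- s * bernstein x) / x)"
    proof (rule Bochner_Integration.integrable_bound)
      show "integrable lborel (\<lambda>s. C / x * (indicator {0..} s * exp (- (bernstein x - c) * s)))"
        using exp_atLeast_integral(1)[of "bernstein x - c" 0] x by auto
      show "AE s in lborel. norm (indicator {0<..} s * \<bar>h s\<bar> * exp (- s * bernstein x) / x)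
        \<le> norm (C / x * (indicator {0..} s * exp (- (bernstein x - c) * s)))"
      proof (rule AE_I2)
        fix s
        show "norm (indicator {0<..} s * \<bar>h s\<bar> * exp (- s * bernstein x) / x)
          \<le> norm (C / x * (indicator {0..} s * exp (- (bernstein x - c) * s)))"
        proof (cases "0 < s")
          case True
          have "\<bar>h s\<bar> * exp (- s * bernstein x) \<le> C * exp (c * s) * exp (- s * bernstein x)"
            using h True by (intro mult_right_mono) (auto simp: exp_bounded_def)
          also have "\<dots> = C * exp (- (bernstein x - c) * s)" by (simp add: exp_add[symmetric] algebra_simps)
          finally show ?thesis using True x C_nonneg by (simp add: divide_right_mono)
        qed simp
      qed
    qed measurable
    also have "(\<lambda>s. indicator {0<..} s * \<bar>h s\<bar> * exp (- s * bernstein x) / x)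
      = (\<lambda>s. \<integral>t. norm (case (s, t) of (s, t) \<Rightarrow> exp (- x * t) * (h s * p s t)) \<partial>lborel)"
      unfolding inner[symmetric] by (simp add: abs_mult p_abs)
    finally show "integrable lborel (\<lambda>s. \<integral>t. norm (case (s, t) of (s, t) \<Rightarrow> exp (- x * t) * (h s * p s t)) \<partial>lborel)" .
  qed
  note pr = this
  show "integrable lborel (\<lambda>t. exp (- x * t) * occ h t)"
    using lborel_pair.integrable_snd[OF pr] by (simp add: occ_def)
  have "(\<integral>t. exp (- x * t) * occ h t \<partial>lborel) = (\<integral>t. (\<integral>s. exp (- x * t) * (h s * p s t) \<partial>lborel) \<partial>lborel)"
    by (simp add: occ_def)
  also have "\<dots> = (\<integral>s. (\<integral>t. exp (- x * t) * (h s * p s t) \<partial>lborel) \<partial>lborel)"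
    by (rule lborel_pair.Fubini_integral[OF pr])
  also have "\<dots> = (\<integral>s. indicator {0<..} s * h s * exp (- s * bernstein x) \<partial>lborel) / x"
    unfolding inner by simp
  finally show "(\<integral>t. exp (- x * t) * occ h t \<partial>lborel) = (\<integral>s. indicator {0<..} s * h s * exp (- s * bernstein x) \<partial>lborel) / x" .
qed

end

text \<open>
  With \<open>f\<close> the Laplace exponent and \<open>H\<close> the Laplace transform of \<open>h\<close>, both sides have at \<open>x\<close> the transform
  \<open>f(x) H(f(x)) / x\<^sup>2\<close>; on the right this is integration by parts at \<open>f(x)\<close>. Both sides are right continuous,
  so they agree everywhere.
\<close>

theorem occ_identity:
  assumes D: "\<And>s. (h has_real_derivative h' s) (at s)" and h': "\<And>s. isCont h' s"
    and hb: "exp_bounded C c h" and hb': "exp_bounded C c h'"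
  shows "b * occ h t + conv (occ h) k t = h 0 * max 0 t + conv heaviside (occ h') t"
proof -
  obtain x0 where x0: "x0 > 0" "\<And>x. x \<ge> x0 \<Longrightarrow> max c 0 < bernstein x" using bernstein_unbounded[of "max c 0"] by blast
  note wl = occ_locbdd[OF hb] occ_locbdd[OF hb']
  note [measurable] = locbddD(1)[OF wl(1)] locbddD(1)[OF wl(2)] locbddD(1)[OF heaviside_locbdd]
  define F where "F t = b * occ h t + conv (occ h) k t - h 0 * conv heaviside heaviside t - conv heaviside (occ h') t" for t
  have "F t = 0"
  proof (rule laplace_zero_imp_zero[of F x0])
    show "F \<in> borel_measurable borel" unfolding F_def[abs_def] by measurable
    show "F t = 0" if "t < 0" for t
    proof -
      have "conv (occ h) k t = 0" "conv heaviside heaviside t = 0" "conv heaviside (occ h') t = 0" "occ h t = 0"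
        using that locbddD(2)[OF wl(1)] locbddD(2)[OF wl(2)] locbddD(2)[OF heaviside_locbdd] tail_nonpos
        by (auto intro!: conv_neg)
      then show ?thesis by (simp add: F_def)
    qed
    show "continuous (at_right t) F" for t
    proof -
      have "continuous (at_right t) (conv (occ h) k)"
        by (rule conv_right_continuous[OF wl(1) tail_locint occ_rc[OF hb]])
      moreover have "continuous (at_right t) (conv heaviside heaviside)"
        by (rule conv_right_continuous[OF heaviside_locbdd locbdd_imp_locint[OF heaviside_locbdd] heaviside_rc])
      moreover have "continuous (at_right t) (conv heaviside (occ h'))"
        by (rule conv_right_continuous[OF heaviside_locbdd locbdd_imp_locint[OF wl(2)] heaviside_rc])
      ultimately show ?thesis
        unfolding F_def[abs_def] using occ_rc[OF hb, of t] by (intro continuous_intros)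
    qed
    have transform: "integrable lborel (\<lambda>t. exp (- x * t) * F t) \<and> (\<integral>t. exp (- x * t) * F t \<partial>lborel) = 0"
      if x: "x \<ge> x0" for x
    proof -
      have xp: "0 < x" "c < bernstein x" using x0 x by auto
      define A where "A = (\<integral>s. indicator {0<..} s * h s * exp (- s * bernstein x) \<partial>lborel)"
      define A' where "A' = (\<integral>s. indicator {0<..} s * h' s * exp (- s * bernstein x) \<partial>lborel)"
      have AA': "A' = bernstein x * A - h 0"
        unfolding A_def A'_def
        by (rule laplace_by_parts[OF D h' _ _ xp(2), where C=C]) (use hb hb' in \<open>auto simp: exp_bounded_def\<close>)
      define K where "K = (\<integral>z. exp (- x * z) * k z \<partial>lborel)"
      have fx: "bernstein x = x * (b + K)" unfolding K_def by (rule bernstein_eq[OF xp(1)])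
      note w1 = occ_laplace[OF hb xp, folded A_def] and w2 = occ_laplace[OF hb' xp, folded A'_def]
      note k1 = tail_laplace(1)[OF xp(1)] and H1 = laplace_heaviside[OF xp(1)]
      note c1 = laplace_conv[OF w1(1) k1] and c2 = laplace_conv[OF H1(1) H1(1)] and c3 = laplace_conv[OF H1(1) w2(1)]
      have e: "exp (- x * t) * F t = b * (exp (- x * t) * occ h t) + exp (- x * t) * conv (occ h) k t
         - h 0 * (exp (- x * t) * conv heaviside heaviside t) - exp (- x * t) * conv heaviside (occ h') t" for t
        by (simp add: F_def algebra_simps)
      have i: "integrable lborel (\<lambda>t. exp (- x * t) * F t)"
        unfolding e using w1(1) c1(1) c2(1) c3(1) by (intro Bochner_Integration.integrable_diff
          Bochner_Integration.integrable_add integrable_mult_right)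
      have "(\<integral>t. exp (- x * t) * F t \<partial>lborel) = b * (A / x) + A / x * K - h 0 * (1 / x * (1 / x)) - 1 / x * (A' / x)"
        unfolding e using w1 c1 c2 c3 H1 w2 by (simp add: K_def)
      also have "\<dots> = 0" using xp(1) unfolding AA' fx by (simp add: field_simps)
      finally show ?thesis using i by simp
    qed
    show "integrable lborel (\<lambda>t. exp (- x0 * t) * F t)" using transform[of x0] by simp
    show "(\<integral>t. exp (- x * t) * F t \<partial>lborel) = 0" if "x0 \<le> x" for x using transform[OF that] by simp
  qed
  then show ?thesis by (simp add: F_def conv_heaviside_heaviside)
qed

lemma one_exp_bounded: "exp_bounded 1 0 (\<lambda>_. 1)" and zero_exp_bounded: "exp_bounded 1 0 (\<lambda>_. 0)"
  by (auto simp: exp_bounded_def)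

abbreviation U :: "real \<Rightarrow> real" where "U \<equiv> occ (\<lambda>_. 1)"

sublocale renewal \<nu> b U
proof
  show "0 \<le> b" by (rule b)
  show "mono U"
    unfolding occ_def using weighted_law_integrable[OF one_exp_bounded]
    by (intro monoI integral_mono) (auto intro: p_mono)
  show "U t = 0" if "t < 0" for t by (rule occ_neg[OF one_exp_bounded that])
  show "continuous (at_right t) U" for t by (rule occ_rc[OF one_exp_bounded])
  show "b * U t + conv U k t = max 0 t" for t
    using occ_identity[OF _ _ one_exp_bounded zero_exp_bounded, of t]
    by (simp add: conv_def occ_def)
qed

lemma occ_zero:
  assumes h: "exp_bounded C c h"
  shows "occ h 0 = 0"
proof -
  note [measurable] = h_measurable[OF h] p_measurable_s
  have "AE s in lborel. 0 \<le> 1 * p s 0" by (rule AE_I2) (simp add: p_nonneg)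
  note zero_iff = integral_nonneg_eq_0_iff_AE[OF weighted_law_integrable[OF one_exp_bounded] this]
  have ae: "AE s in lborel. 1 * p s 0 = 0"
    by (rule zero_iff[THEN iffD1]) (use U_zero in \<open>simp only: occ_def\<close>)
  have "occ h 0 = (\<integral>s. 0 \<partial>(lborel :: real measure))"
    unfolding occ_def
  proof (rule Bochner_Integration.integral_cong_AE)
    show "AE s in lborel. h s * p s 0 = 0" using ae by eventually_elim simp
  qed measurable
  then show ?thesis by simp
qed

text \<open>
  Times \<open>s > S\<close> contribute little uniformly in the intervals, because increments of the distribution
  function \<open>p s\<close> over disjoint intervals add up to at most \<open>p s T\<close>. For \<open>s \<le> S\<close> the weight is
  bounded and the increments of the renewal function take over.
\<close>

lemma occ_abs_continuous:
  assumes ac: "\<And>x y. 0 < x \<Longrightarrow> x < y \<Longrightarrow> abs_continuous_on {x..y} k" and T: "0 \<le> T"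
    and h: "exp_bounded C c h" and c: "0 \<le> c"
  shows "abs_continuous_on {0..T} (occ h)"
  unfolding abs_continuous_on_def
proof (intro allI impI)
  fix e :: real assume e: "0 < e"
  note [measurable] = h_measurable[OF h] p_measurable_s
  have C: "0 \<le> C" by (rule C_nonneg[OF h])
  have "(\<lambda>n. \<integral>s. indicator {real n<..} s * \<bar>h s * p s T\<bar> \<partial>lborel) \<longlonglongrightarrow> (\<integral>s. 0 \<partial>(lborel :: real measure))"
  proof (rule integral_dominated_convergence[where w="\<lambda>s. \<bar>h s * p s T\<bar>"])
    show "integrable lborel (\<lambda>s. \<bar>h s * p s T\<bar>)" using weighted_law_integrable[OF h] by auto
    show "AE s in lborel. (\<lambda>n. indicator {real n<..} s * \<bar>h s * p s T\<bar>) \<longlonglongrightarrow> 0"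
    proof (rule AE_I2)
      fix s
      obtain N where "s \<le> real N" using real_arch_simple by blast
      then have "eventually (\<lambda>n. indicator {real n<..} s * \<bar>h s * p s T\<bar> = 0) sequentially"
        unfolding eventually_sequentially by (intro exI[of _ N]) (auto simp: indicator_def)
      then show "(\<lambda>n. indicator {real n<..} s * \<bar>h s * p s T\<bar>) \<longlonglongrightarrow> 0" by (rule tendsto_eventually)
    qed
  qed (auto simp: indicator_def)
  then have "eventually (\<lambda>n. (\<integral>s. indicator {real n<..} s * \<bar>h s * p s T\<bar> \<partial>lborel) < e / 2) sequentially"
    by (rule order_tendstoD(2)) (use e in auto)
  then obtain S where S: "(\<integral>s. indicator {real S<..} s * \<bar>h s * p s T\<bar> \<partial>lborel) < e / 2"
    using eventually_happens'[OF sequentially_bot] by blast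
  define B where "B = C * exp (c * real S) + 1"
  have B: "0 < B" using C by (simp add: B_def add_nonneg_pos)
  have "0 < e / (2 * B)" using e B by simp
  from abs_continuous_onE[OF U_abs_continuous[OF ac T] this]
  obtain d where d: "0 < d" "\<And>(n::nat) u v. (\<And>i. i < n \<Longrightarrow> u i \<le> v i \<and> {u i..v i} \<subseteq> {0..T}) \<Longrightarrow>
      disjoint_family_on (\<lambda>i. {u i<..<v i}) {..<n} \<Longrightarrow>
      (\<Sum>i<n. v i - u i) < d \<Longrightarrow> (\<Sum>i<n. \<bar>U (v i) - U (u i)\<bar>) < e / (2 * B)"
    by blast
  show "\<exists>\<delta>>0. \<forall>(n::nat) u v. (\<forall>i<n. u i \<le> v i \<and> {u i..v i} \<subseteq> {0..T}) \<longrightarrow>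
      disjoint_family_on (\<lambda>i. {u i<..<v i}) {..<n} \<longrightarrow>
      (\<Sum>i<n. v i - u i) < \<delta> \<longrightarrow> (\<Sum>i<n. \<bar>occ h (v i) - occ h (u i)\<bar>) < e"
  proof (intro exI[of _ d] conjI allI impI d(1))
    fix n :: nat and u v :: "nat \<Rightarrow> real"
    assume uv: "\<forall>i<n. u i \<le> v i \<and> {u i..v i} \<subseteq> {0..T}"
      and disj: "disjoint_family_on (\<lambda>i. {u i<..<v i}) {..<n}"
      and len: "(\<Sum>i<n. v i - u i) < d"
    have uv': "0 \<le> u i" "u i \<le> v i" "v i \<le> T" if "i < n" for i using uv that by auto
    define P where "P s = (\<Sum>i<n. p s (v i) - p s (u i))" for s
    have P_nonneg: "0 \<le> P s" for s unfolding P_def using uv' by (intro sum_nonneg) (auto intro: p_mono)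
    have P_le: "P s \<le> p s T" for s
    proof -
      have "P s \<le> p s T - p s 0"
        unfolding P_def using uv' disj T
        by (intro sum_increments_disjoint_le[where a=0 and b=T]) (auto intro: monoI p_mono)
      then show ?thesis using p_nonneg[of s 0] by linarith
    qed
    have hp: "integrable lborel (\<lambda>s. \<bar>h s\<bar> * p s t)" for t
      using integrable_abs[OF weighted_law_integrable[OF h, of t]] by (simp add: abs_mult p_abs)
    have "(\<Sum>i<n. \<bar>occ h (v i) - occ h (u i)\<bar>) \<le> (\<Sum>i<n. \<integral>s. \<bar>h s\<bar> * p s (v i) - \<bar>h s\<bar> * p s (u i) \<partial>lborel)"
    proof (rule sum_mono)
      fix i assume "i \<in> {..<n}"
      then have le: "p s (u i) \<le> p s (v i)" for s using uv'[of i] by (intro p_mono) auto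
      have "occ h (v i) - occ h (u i) = (\<integral>s. h s * p s (v i) - h s * p s (u i) \<partial>lborel)"
        unfolding occ_def using weighted_law_integrable[OF h] by simp
      also have "\<bar>\<dots>\<bar> \<le> (\<integral>s. \<bar>h s * p s (v i) - h s * p s (u i)\<bar> \<partial>lborel)" by (rule integral_abs_bound)
      also have "\<dots> = (\<integral>s. \<bar>h s\<bar> * p s (v i) - \<bar>h s\<bar> * p s (u i) \<partial>lborel)"
      proof (rule Bochner_Integration.integral_cong[OF refl])
        fix s
        have "\<bar>h s * p s (v i) - h s * p s (u i)\<bar> = \<bar>h s\<bar> * \<bar>p s (v i) - p s (u i)\<bar>"
          by (simp add: abs_mult[symmetric] right_diff_distrib)
        then show "\<bar>h s * p s (v i) - h s * p s (u i)\<bar> = \<bar>h s\<bar> * p s (v i) - \<bar>h s\<bar> * p s (u i)"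
          using le[of s] by (simp add: right_diff_distrib)
      qed
      finally show "\<bar>occ h (v i) - occ h (u i)\<bar> \<le> (\<integral>s. \<bar>h s\<bar> * p s (v i) - \<bar>h s\<bar> * p s (u i) \<partial>lborel)" .
    qed
    also have "\<dots> = (\<integral>s. \<bar>h s\<bar> * P s \<partial>lborel)"
      unfolding P_def sum_distrib_left right_diff_distrib using hp by (subst Bochner_Integration.integral_sum) auto
    also have "\<dots> \<le> (\<integral>s. C * exp (c * real S) * P s + indicator {real S<..} s * \<bar>h s * p s T\<bar> \<partial>lborel)"
    proof (rule integral_mono)
      have "integrable lborel (\<lambda>s. \<Sum>i<n. \<bar>h s\<bar> * p s (v i) - \<bar>h s\<bar> * p s (u i))" using hp by auto
      then show "integrable lborel (\<lambda>s. \<bar>h s\<bar> * P s)" by (simp add: P_def sum_distrib_left right_diff_distrib)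
      have Pi: "integrable lborel P"
        unfolding P_def[abs_def] using weighted_law_integrable[OF one_exp_bounded] by auto
      have "integrable lborel (\<lambda>s. indicator {real S<..} s *\<^sub>R \<bar>h s * p s T\<bar>)"
        by (rule integrable_mult_indicator) (use weighted_law_integrable[OF h] in auto)
      then show "integrable lborel (\<lambda>s. C * exp (c * real S) * P s + indicator {real S<..} s * \<bar>h s * p s T\<bar>)"
        using Pi by auto
      fix s
      consider "s \<le> 0" | "0 < s" "s \<le> real S" | "0 < s" "real S < s" by linarith
      then show "\<bar>h s\<bar> * P s \<le> C * exp (c * real S) * P s + indicator {real S<..} s * \<bar>h s * p s T\<bar>"
      proof cases
        case 1 then show ?thesis by (simp add: P_def p_nonpos)
      next
        case 2
        have "\<bar>h s\<bar> \<le> C * exp (c * s)" using h 2 by (auto simp: exp_bounded_def)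
        also have "\<dots> \<le> C * exp (c * real S)" using mult_left_mono[OF 2(2) c] C by (intro mult_left_mono) simp_all
        finally show ?thesis using 2 P_nonneg[of s] by (simp add: mult_right_mono)
      next
        case 3
        have "\<bar>h s\<bar> * P s \<le> \<bar>h s * p s T\<bar>" unfolding abs_mult p_abs by (intro mult_left_mono P_le) auto
        then show ?thesis using 3 C P_nonneg[of s] by (simp add: add_increasing)
      qed
    qed
    also have "\<dots> = C * exp (c * real S) * (\<Sum>i<n. U (v i) - U (u i))
       + (\<integral>s. indicator {real S<..} s * \<bar>h s * p s T\<bar> \<partial>lborel)"
    proof -
      have Pi: "integrable lborel P" "(\<integral>s. P s \<partial>lborel) = (\<Sum>i<n. U (v i) - U (u i))"
        unfolding P_def[abs_def] occ_def using weighted_law_integrable[OF one_exp_bounded] by auto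
      have "integrable lborel (\<lambda>s. indicator {real S<..} s *\<^sub>R \<bar>h s * p s T\<bar>)"
        by (rule integrable_mult_indicator) (use weighted_law_integrable[OF h] in auto)
      then show ?thesis using Pi by simp
    qed
    also have "\<dots> < B * (e / (2 * B)) + e / 2"
    proof (rule add_le_less_mono)
      have "C * exp (c * real S) * (\<Sum>i<n. U (v i) - U (u i)) \<le> B * (\<Sum>i<n. \<bar>U (v i) - U (u i)\<bar>)"
        using C by (intro mult_mono sum_mono) (auto simp: B_def intro!: sum_nonneg monoD[OF U_mono] uv')
      also have "\<dots> \<le> B * (e / (2 * B))"
        using d(2)[OF uv[rule_format] disj len] B by (intro mult_left_mono) auto
      finally show "C * exp (c * real S) * (\<Sum>i<n. U (v i) - U (u i)) \<le> B * (e / (2 * B))" .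
    qed (use S in auto)
    also have "\<dots> = e" using B by simp
    finally show "(\<Sum>i<n. \<bar>occ h (v i) - occ h (u i)\<bar>) < e" .
  qed
qed

end

section \<open>Entries of the matrix exponential\<close>

definition matrix_pow :: "real ^ 'n ^ 'n \<Rightarrow> nat \<Rightarrow> real ^ 'n ^ 'n" where
  "matrix_pow A m = (((**) A) ^^ m) (mat 1)"

lemma matrix_pow_0: "matrix_pow A 0 = mat 1" by (simp add: matrix_pow_def)

lemma matrix_pow_Suc: "matrix_pow A (Suc m) = A ** matrix_pow A m" by (simp add: matrix_pow_def)

lemma matrix_pow_Suc_right: "matrix_pow A (Suc m) = matrix_pow A m ** A"
  by (induction m) (simp_all add: matrix_pow_0 matrix_pow_Suc matrix_mul_assoc del: One_nat_def)

lemma matrix_mult_nth: "(A ** B) $ i $ j = (\<Sum>l\<in>UNIV. A $ i $ l * B $ l $ j)"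
  by (simp add: matrix_matrix_mult_def)

lemma matrix_pow_scaleR: "matrix_pow (s *\<^sub>R A) m $ i $ j = s ^ m * matrix_pow A m $ i $ j" for s :: real
  by (induction m arbitrary: i j)
    (auto simp: matrix_pow_0 matrix_pow_Suc matrix_mult_nth sum_distrib_left ac_simps)

text \<open>
  A crude matrix norm: it dominates all row sums, so its powers bound the entries of the matrix powers.
\<close>

definition entry_sum :: "real ^ 'n ^ 'n \<Rightarrow> real" where
  "entry_sum A = (\<Sum>i\<in>UNIV. \<Sum>j\<in>UNIV. \<bar>A $ i $ j\<bar>)"

lemma entry_sum_nonneg: "0 \<le> entry_sum A"
  unfolding entry_sum_def by (intro sum_nonneg) auto

lemma row_sum_le: "(\<Sum>j\<in>UNIV. \<bar>A $ i $ j\<bar>) \<le> entry_sum A"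
  unfolding entry_sum_def by (rule member_le_sum[where f="\<lambda>i. \<Sum>j\<in>UNIV. \<bar>A $ i $ j\<bar>"]) (auto intro: sum_nonneg)

lemma matrix_pow_bound: "\<bar>matrix_pow A m $ i $ j\<bar> \<le> entry_sum A ^ m"
proof (induction m arbitrary: i j)
  case 0
  then show ?case by (simp add: matrix_pow_0 mat_def)
next
  case (Suc m)
  have "\<bar>matrix_pow A (Suc m) $ i $ j\<bar> \<le> (\<Sum>l\<in>UNIV. \<bar>A $ i $ l * matrix_pow A m $ l $ j\<bar>)"
    unfolding matrix_pow_Suc matrix_mult_nth by (rule sum_abs)
  also have "\<dots> \<le> (\<Sum>l\<in>UNIV. \<bar>A $ i $ l\<bar> * entry_sum A ^ m)"
    unfolding abs_mult by (intro sum_mono mult_left_mono Suc) auto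
  also have "\<dots> \<le> entry_sum A ^ Suc m"
    using row_sum_le[of A i] entry_sum_nonneg[of A]
    by (simp add: sum_distrib_right[symmetric] mult_right_mono)
  finally show ?case .
qed

text \<open>
  Entries of the matrix exponential of \<open>s A\<close> as scalar power series, to which the calculus of real
  functions applies.
\<close>

definition exp_entry :: "real ^ 'n ^ 'n \<Rightarrow> 'n \<Rightarrow> 'n \<Rightarrow> real \<Rightarrow> real" where
  "exp_entry A i j s = (\<Sum>m. matrix_pow A m $ i $ j / fact m * s ^ m)"

lemma exp_entry_term_bound: "\<bar>matrix_pow A m $ i $ j / fact m * s ^ m\<bar> \<le> (entry_sum A * \<bar>s\<bar>) ^ m /\<^sub>R fact m"
proof -
  have "\<bar>matrix_pow A m $ i $ j\<bar> * (\<bar>s\<bar> ^ m / fact m) \<le> entry_sum A ^ m * (\<bar>s\<bar> ^ m / fact m)"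
    by (intro mult_right_mono matrix_pow_bound) auto
  then show ?thesis by (simp add: abs_mult power_abs power_mult_distrib field_simps)
qed

lemma exp_entry_summable: "summable (\<lambda>m. matrix_pow A m $ i $ j / fact m * s ^ m)"
  by (rule summable_comparison_test'[OF summable_exp_generic[of "entry_sum A * \<bar>s\<bar>"], of 0])
    (use exp_entry_term_bound in auto)

lemma exp_entry_sums: "(\<lambda>m. matrix_pow A m $ i $ j / fact m * s ^ m) sums exp_entry A i j s"
  unfolding exp_entry_def by (rule summable_sums[OF exp_entry_summable])

lemma exp_entry_bound: "\<bar>exp_entry A i j s\<bar> \<le> exp (entry_sum A * \<bar>s\<bar>)"
proof -
  have "norm (exp_entry A i j s) \<le> (\<Sum>m. (entry_sum A * \<bar>s\<bar>) ^ m /\<^sub>R fact m)"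
    unfolding exp_entry_def
    by (rule norm_suminf_le[OF _ summable_exp_generic]) (use exp_entry_term_bound in auto)
  then show ?thesis by (simp add: exp_def)
qed

lemma exp_entry_0: "exp_entry A i j 0 = mat 1 $ i $ j"
  unfolding exp_entry_def by (subst powser_zero) (simp add: matrix_pow_0)

text \<open>
  The two forms of the derivative, \<open>A exp (s A)\<close> and \<open>exp (s A) A\<close>, come from the two ways of splitting off
  a factor from a matrix power. Existence uses the first, uniqueness the second.
\<close>

lemma exp_entry_derivative: "(exp_entry A i j has_real_derivative (\<Sum>l\<in>UNIV. A $ i $ l * exp_entry A l j s)) (at s)"
  and exp_entry_commute: "(\<Sum>l\<in>UNIV. A $ i $ l * exp_entry A l j s) = (\<Sum>l\<in>UNIV. exp_entry A i l s * A $ l $ j)"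
proof -
  have "(exp_entry A i j has_real_derivative (\<Sum>m. diffs (\<lambda>m. matrix_pow A m $ i $ j / fact m) m * s ^ m)) (at s)"
    unfolding exp_entry_def[abs_def]
    by (rule termdiffs_strong_converges_everywhere) (rule exp_entry_summable)
  moreover have d: "diffs (\<lambda>m. matrix_pow A m $ i $ j / fact m) m = matrix_pow A (Suc m) $ i $ j / fact m" for m
    unfolding diffs_def fact_Suc of_nat_mult by (simp add: field_simps del: of_nat_Suc)
  have "(\<lambda>m. \<Sum>l\<in>UNIV. A $ i $ l * (matrix_pow A m $ l $ j / fact m * s ^ m)) sums (\<Sum>l\<in>UNIV. A $ i $ l * exp_entry A l j s)"
    by (intro sums_sum sums_mult exp_entry_sums)
  then have l: "(\<lambda>m. matrix_pow A (Suc m) $ i $ j / fact m * s ^ m) sums (\<Sum>l\<in>UNIV. A $ i $ l * exp_entry A l j s)"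
    unfolding matrix_pow_Suc matrix_mult_nth by (simp add: sum_divide_distrib sum_distrib_right mult.assoc)
  have "(\<lambda>m. \<Sum>l\<in>UNIV. (matrix_pow A m $ i $ l / fact m * s ^ m) * A $ l $ j) sums (\<Sum>l\<in>UNIV. exp_entry A i l s * A $ l $ j)"
    by (intro sums_sum sums_mult2 exp_entry_sums)
  then have r: "(\<lambda>m. matrix_pow A (Suc m) $ i $ j / fact m * s ^ m) sums (\<Sum>l\<in>UNIV. exp_entry A i l s * A $ l $ j)"
  proof -
    have "matrix_pow A (Suc m) $ i $ j / fact m * s ^ m = (\<Sum>l\<in>UNIV. (matrix_pow A m $ i $ l / fact m * s ^ m) * A $ l $ j)" for m
      unfolding matrix_pow_Suc_right matrix_mult_nth sum_divide_distrib sum_distrib_right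
      by (intro sum.cong refl) simp
    then show ?thesis
      using \<open>(\<lambda>m. \<Sum>l\<in>UNIV. (matrix_pow A m $ i $ l / fact m * s ^ m) * A $ l $ j) sums _\<close> by simp
  qed
  show "(\<Sum>l\<in>UNIV. A $ i $ l * exp_entry A l j s) = (\<Sum>l\<in>UNIV. exp_entry A i l s * A $ l $ j)"
    by (rule sums_unique2[OF l r])
  ultimately show "(exp_entry A i j has_real_derivative (\<Sum>l\<in>UNIV. A $ i $ l * exp_entry A l j s)) (at s)"
    using sums_unique[OF l] by (simp add: d)
qed

lemma matrix_exp_nth: "matrix_exp (s *\<^sub>R A) $ i $ j = exp_entry A i j s"
proof -
  have "(\<lambda>m. (1 / fact m) *\<^sub>R matrix_pow (s *\<^sub>R A) m) sums (\<chi> i j. exp_entry A i j s)"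
    unfolding sums_def
  proof (intro vec_tendstoI)
    fix i j
    have "(\<lambda>n. \<Sum>m<n. matrix_pow A m $ i $ j / fact m * s ^ m) \<longlonglongrightarrow> exp_entry A i j s"
      using exp_entry_sums unfolding sums_def .
    then show "(\<lambda>n. (\<Sum>m<n. (1 / fact m) *\<^sub>R matrix_pow (s *\<^sub>R A) m) $ i $ j) \<longlonglongrightarrow> (\<chi> i j. exp_entry A i j s) $ i $ j"
      by (simp add: matrix_pow_scaleR mult.commute)
  qed
  then have "matrix_exp (s *\<^sub>R A) = (\<chi> i j. exp_entry A i j s)"
    unfolding matrix_exp_def matrix_pow_def[symmetric] by (rule sums_unique[symmetric])
  then show ?thesis by simp
qed

lemma exp_entry_continuous: "continuous_on UNIV (exp_entry A i j)"
  by (intro continuous_at_imp_continuous_on ballI DERIV_isCont[OF exp_entry_derivative])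

lemma exp_entry_exp_bounded: "exp_bounded 1 (entry_sum A) (exp_entry A i j)"
  unfolding exp_bounded_def
proof (intro conjI allI impI)
  show "exp_entry A i j \<in> borel_measurable borel" by (rule borel_measurable_continuous_onI[OF exp_entry_continuous])
  show "\<bar>exp_entry A i j s\<bar> \<le> 1 * exp (entry_sum A * s)" if "0 \<le> s" for s
    using exp_entry_bound[of A i j s] that by simp
qed

lemma exp_bounded_sum:
  fixes h :: "'i::finite \<Rightarrow> real \<Rightarrow> real"
  assumes h: "\<And>l. exp_bounded C c (h l)" and a: "(\<Sum>l\<in>UNIV. \<bar>a l\<bar>) \<le> B"
  shows "exp_bounded (B * C) c (\<lambda>s. \<Sum>l\<in>UNIV. a l * h l s)"
  unfolding exp_bounded_def
proof (intro conjI allI impI)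
  have [measurable]: "h l \<in> borel_measurable borel" for l using h by (auto simp: exp_bounded_def)
  show "(\<lambda>s. \<Sum>l\<in>UNIV. a l * h l s) \<in> borel_measurable borel" by measurable
  fix s :: real assume s: "0 \<le> s"
  have hs: "\<bar>h l s\<bar> \<le> C * exp (c * s)" for l using h[of l] s by (auto simp: exp_bounded_def)
  have "\<bar>\<Sum>l\<in>UNIV. a l * h l s\<bar> \<le> (\<Sum>l\<in>UNIV. \<bar>a l * h l s\<bar>)" by (rule sum_abs)
  also have "\<dots> \<le> (\<Sum>l\<in>UNIV. \<bar>a l\<bar> * (C * exp (c * s)))"
    unfolding abs_mult by (intro sum_mono mult_left_mono hs) auto
  also have "\<dots> = (\<Sum>l\<in>UNIV. \<bar>a l\<bar>) * (C * exp (c * s))" by (simp add: sum_distrib_right)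
  also have "\<dots> \<le> B * (C * exp (c * s))"
    using a hs by (intro mult_right_mono) (auto intro: order_trans[OF abs_ge_zero])
  finally show "\<bar>\<Sum>l\<in>UNIV. a l * h l s\<bar> \<le> B * C * exp (c * s)" by (simp add: mult.assoc)
qed

lemma exp_bounded_mono:
  assumes "exp_bounded C c h" "C \<le> C'"
  shows "exp_bounded C' c h"
  unfolding exp_bounded_def
proof (intro conjI allI impI)
  fix s :: real assume "0 \<le> s"
  then have "\<bar>h s\<bar> \<le> C * exp (c * s)" using assms(1) by (auto simp: exp_bounded_def)
  also have "\<dots> \<le> C' * exp (c * s)" using assms(2) by (intro mult_right_mono) auto
  finally show "\<bar>h s\<bar> \<le> C' * exp (c * s)" .
qed (use assms in \<open>auto simp: exp_bounded_def\<close>)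

section \<open>The Caputo equation\<close>

lemma conv_heaviside_eq_set_integral:
  assumes "\<And>s. s < 0 \<Longrightarrow> f s = 0"
  shows "conv heaviside f t = (LINT s:{0..t}|lborel. f s)"
  unfolding conv_def set_lebesgue_integral_def
  by (intro Bochner_Integration.integral_cong) (use assms in \<open>auto simp: heaviside_def indicator_def\<close>)

lemma conv_heaviside_derivative:
  assumes f: "\<And>s. s < 0 \<Longrightarrow> f s = 0" "continuous_on {0..T} f" and t: "0 < t" "t < T"
  shows "(conv heaviside f has_real_derivative f t) (at t)"
proof -
  have e: "conv heaviside f r = integral {0..r} f" if "0 \<le> r" "r \<le> T" for r
  proof -
    have "set_integrable lborel {0..r} f"
      by (rule borel_integrable_atLeastAtMost'[OF continuous_on_subset[OF f(2)]]) (use that in auto)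
    then show ?thesis by (simp only: conv_heaviside_eq_set_integral[OF f(1)] set_borel_integral_eq_integral(2))
  qed
  have "((\<lambda>r. integral {0..r} f) has_real_derivative f t) (at t within {0..T})"
    using t by (intro integral_has_real_derivative f(2)) auto
  then have "((\<lambda>r. integral {0..r} f) has_real_derivative f t) (at t)"
    using t at_within_Icc_at[of 0 t T] by simp
  then show ?thesis
  proof (rule has_field_derivative_transform_within_open[of _ _ _ "{0<..<T}"])
    show "integral {0..x} f = conv heaviside f x" if "x \<in> {0<..<T}" for x using e[of x] that by simp
  qed (use t in auto)
qed

lemma conv_sum_right:
  fixes d :: "'i::finite \<Rightarrow> real \<Rightarrow> real"
  assumes "\<And>l. integrable lborel (\<lambda>z. f (t - z) * d l z)"
  shows "conv f (\<lambda>z. \<Sum>l\<in>UNIV. a l * d l z) t = (\<Sum>l\<in>UNIV. a l * conv f (d l) t)"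
proof -
  have "conv f (\<lambda>z. \<Sum>l\<in>UNIV. a l * d l z) t = (\<integral>z. (\<Sum>l\<in>UNIV. a l * (f (t - z) * d l z)) \<partial>lborel)"
    unfolding conv_def by (simp add: sum_distrib_left ac_simps)
  then show ?thesis using assms by (simp add: conv_def)
qed

lemma zero_of_conv_heaviside_zero:
  assumes d: "locbdd d" and rc: "\<And>t. continuous (at_right t) d" and zero: "\<And>t. conv heaviside d t = 0"
  shows "d t = 0"
proof (cases "t < 0")
  case False
  show ?thesis
  proof (rule zero_of_zero_integrals[of d])
    show "set_integrable lborel {0..t} d" for t
      by (rule set_integrable_subset[OF locintD(3)[OF locbdd_imp_locint[OF d]]]) auto
    show "(LINT s:{0..t}|lborel. d s) = 0" if "0 \<le> t" for t
      using zero[of t] conv_heaviside_eq_set_integral[of d t] locbddD(2)[OF d] by simp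
  qed (use rc False in auto)
qed (use locbddD(2)[OF d] in auto)

context subordinator_law
begin

lemma occ_sum:
  fixes h :: "'i::finite \<Rightarrow> real \<Rightarrow> real"
  assumes "\<And>l. exp_bounded (C l) (c l) (h l)"
  shows "occ (\<lambda>s. \<Sum>l\<in>UNIV. a l * h l s) t = (\<Sum>l\<in>UNIV. a l * occ (h l) t)"
proof -
  have "occ (\<lambda>s. \<Sum>l\<in>UNIV. a l * h l s) t = (\<integral>s. (\<Sum>l\<in>UNIV. a l * (h l s * p s t)) \<partial>lborel)"
    unfolding occ_def by (rule Bochner_Integration.integral_cong[OF refl]) (simp add: sum_distrib_right mult.assoc)
  then show ?thesis using weighted_law_integrable[OF assms] by (simp add: occ_def)
qed

text \<open>
  The identity for the entries of \<open>exp (s A)\<close>, with \<open>A\<close> on the right: the index \<open>i\<close> is then a spectator, and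
  the equation can be convolved with a vector on the right.
\<close>

lemma resolvent_equation:
  "b * occ (exp_entry A i j) t + conv (occ (exp_entry A i j)) k t
    = mat 1 $ i $ j * conv heaviside heaviside t + (\<Sum>l\<in>UNIV. A $ l $ j * conv heaviside (occ (exp_entry A i l)) t)"
proof -
  define h' where "h' s = (\<Sum>l\<in>UNIV. A $ l $ j * exp_entry A i l s)" for s
  define B where "B = max 1 (\<Sum>l\<in>UNIV. \<bar>A $ l $ j\<bar>)"
  have "b * occ (exp_entry A i j) t + conv (occ (exp_entry A i j)) k t = exp_entry A i j 0 * max 0 t + conv heaviside (occ h') t"
  proof (rule occ_identity[where h="exp_entry A i j" and h'=h' and C=B and c="entry_sum A"])
    show "(exp_entry A i j has_real_derivative h' s) (at s)" for s
      using exp_entry_derivative[of A i j s] unfolding exp_entry_commute h'_def by (simp add: mult.commute)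
    show "isCont h' s" for s
      unfolding h'_def[abs_def] using DERIV_isCont[OF exp_entry_derivative] by (intro continuous_intros) auto
    show "exp_bounded B (entry_sum A) (exp_entry A i j)"
      by (rule exp_bounded_mono[OF exp_entry_exp_bounded]) (simp add: B_def)
    have "exp_bounded (B * 1) (entry_sum A) h'"
      unfolding h'_def by (rule exp_bounded_sum[OF exp_entry_exp_bounded]) (simp add: B_def)
    then show "exp_bounded B (entry_sum A) h'" by simp
  qed
  moreover have "occ h' = (\<lambda>t. \<Sum>l\<in>UNIV. A $ l $ j * occ (exp_entry A i l) t)"
    unfolding h'_def by (rule ext, rule occ_sum[OF exp_entry_exp_bounded])
  moreover have "conv heaviside (\<lambda>t. \<Sum>l\<in>UNIV. A $ l $ j * occ (exp_entry A i l) t) t = (\<Sum>l\<in>UNIV. A $ l $ j * conv heaviside (occ (exp_entry A i l)) t)"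
    by (rule conv_sum_right, rule conv_integrable[OF heaviside_locbdd locbdd_imp_locint[OF occ_locbdd[OF exp_entry_exp_bounded]]])
  ultimately show ?thesis by (simp add: exp_entry_0 conv_heaviside_heaviside)
qed

text \<open>
  Evaluate the convolution of the resolvent \<open>W\<close> with \<open>b d + d * k\<close> in two ways. Moving the kernel
  onto \<open>W\<close> and using its equation gives \<open>t * d + (1 * W A) * d\<close>; using the equation of \<open>d\<close> gives
  \<open>(1 * W) * A d\<close>. The terms with \<open>A\<close> coincide, so \<open>t * d = 0\<close>, and two differentiations finish.
\<close>

lemma homogeneous_solution_zero:
  fixes A :: "real ^ 'n ^ 'n" and d :: "'n \<Rightarrow> real \<Rightarrow> real"
  assumes d: "\<And>i. locbdd (d i)" and rc: "\<And>i t. continuous (at_right t) (d i)"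
    and eq: "\<And>i t. b * d i t + conv (d i) k t = (\<Sum>l\<in>UNIV. A $ i $ l * conv heaviside (d l) t)"
  shows "d i t = 0"
proof -
  define W where "W i j = occ (exp_entry A i j)" for i j
  have W: "locbdd (W i j)" for i j unfolding W_def by (rule occ_locbdd[OF exp_entry_exp_bounded])
  note dl = locbdd_imp_locint[OF d] and Wl = locbdd_imp_locint[OF W] and Hl = locbdd_imp_locint[OF heaviside_locbdd]
  note HH = conv_locbdd[OF heaviside_locbdd Hl]
  have zero: "conv (conv heaviside heaviside) (d i) t = 0" for i t
  proof -
    have dk: "locint (conv (d j) k)" for j by (rule locbdd_imp_locint[OF conv_locbdd[OF d tail_locint]])
    have Hd: "locint (conv heaviside (d l))" for l by (rule locbdd_imp_locint[OF conv_locbdd[OF heaviside_locbdd dl]])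
    have HW: "locbdd (conv heaviside (W i l))" for l by (rule conv_locbdd[OF heaviside_locbdd Wl])
    have left: "b * conv (W i j) (d j) t + conv (W i j) (conv (d j) k) t
       = mat 1 $ i $ j * conv (conv heaviside heaviside) (d j) t + (\<Sum>l\<in>UNIV. A $ l $ j * conv (conv heaviside (W i l)) (d j) t)" for j
    proof -
      have "conv (W i j) (conv (d j) k) t = conv (W i j) (conv k (d j)) t"
        by (simp add: conv_commute[of "d j" k, abs_def])
      also have "\<dots> = conv (conv (W i j) k) (d j) t" by (rule conv_assoc[OF W tail_locint dl])
      finally have "b * conv (W i j) (d j) t + conv (W i j) (conv (d j) k) t
         = (\<integral>z. b * (W i j (t - z) * d j z) + conv (W i j) k (t - z) * d j z \<partial>lborel)"
        using conv_integrable[OF W dl, of i j t] conv_integrable[OF conv_locbdd[OF W tail_locint] dl, of i j t]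
        by (simp add: conv_def[of "W i j" "d j"] conv_def[of "conv (W i j) k"])
      also have "\<dots> = (\<integral>z. mat 1 $ i $ j * (conv heaviside heaviside (t - z) * d j z)
          + (\<Sum>l\<in>UNIV. A $ l $ j * (conv heaviside (W i l) (t - z) * d j z)) \<partial>lborel)"
      proof (rule Bochner_Integration.integral_cong[OF refl])
        fix z
        have "b * (W i j (t - z) * d j z) + conv (W i j) k (t - z) * d j z
          = (b * W i j (t - z) + conv (W i j) k (t - z)) * d j z" by (simp add: algebra_simps)
        also have "\<dots> = mat 1 $ i $ j * (conv heaviside heaviside (t - z) * d j z)
          + (\<Sum>l\<in>UNIV. A $ l $ j * (conv heaviside (W i l) (t - z) * d j z))"
          unfolding W_def resolvent_equation by (simp add: distrib_right sum_distrib_right mult.assoc)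
        finally show "b * (W i j (t - z) * d j z) + conv (W i j) k (t - z) * d j z = \<dots>" .
      qed
      also have "\<dots> = mat 1 $ i $ j * conv (conv heaviside heaviside) (d j) t + (\<Sum>l\<in>UNIV. A $ l $ j * conv (conv heaviside (W i l)) (d j) t)"
        using conv_integrable[OF HH dl, of t j] conv_integrable[OF HW dl, of _ t j]
        by (simp add: conv_def[of "conv heaviside heaviside"] conv_def[of "conv heaviside (W i l)" for l])
      finally show ?thesis .
    qed
    have right: "b * conv (W i j) (d j) t + conv (W i j) (conv (d j) k) t
       = (\<Sum>l\<in>UNIV. A $ j $ l * conv (conv heaviside (W i j)) (d l) t)" for j
    proof -
      have "b * conv (W i j) (d j) t + conv (W i j) (conv (d j) k) t
         = (\<integral>z. b * (W i j (t - z) * d j z) + W i j (t - z) * conv (d j) k z \<partial>lborel)"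
        using conv_integrable[OF W dl, of i j t j] conv_integrable[OF W dk, of i j t j] by (simp add: conv_def[of "W i j"])
      also have "\<dots> = conv (W i j) (\<lambda>z. \<Sum>l\<in>UNIV. A $ j $ l * conv heaviside (d l) z) t"
        unfolding conv_def[of "W i j"]
        by (rule Bochner_Integration.integral_cong[OF refl]) (simp add: eq[symmetric] algebra_simps)
      also have "\<dots> = (\<Sum>l\<in>UNIV. A $ j $ l * conv (W i j) (conv heaviside (d l)) t)"
        by (rule conv_sum_right, rule conv_integrable[OF W Hd])
      also have "\<dots> = (\<Sum>l\<in>UNIV. A $ j $ l * conv (conv heaviside (W i j)) (d l) t)"
      proof (intro sum.cong refl arg_cong2[where f="(*)"])
        fix l
        have "conv (W i j) (conv heaviside (d l)) t = conv (conv (W i j) heaviside) (d l) t" by (rule conv_assoc[OF W Hl dl])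
        then show "conv (W i j) (conv heaviside (d l)) t = conv (conv heaviside (W i j)) (d l) t"
          by (simp add: conv_commute[of "W i j" heaviside, abs_def])
      qed
      finally show ?thesis .
    qed
    have "(\<Sum>j\<in>UNIV. mat 1 $ i $ j * conv (conv heaviside heaviside) (d j) t + (\<Sum>l\<in>UNIV. A $ l $ j * conv (conv heaviside (W i l)) (d j) t))
      = (\<Sum>j\<in>UNIV. \<Sum>l\<in>UNIV. A $ j $ l * conv (conv heaviside (W i j)) (d l) t)"
      by (rule sum.cong[OF refl]) (simp only: left[symmetric] right)
    also have "\<dots> = (\<Sum>j\<in>UNIV. \<Sum>l\<in>UNIV. A $ l $ j * conv (conv heaviside (W i l)) (d j) t)"
      by (rule sum.swap)
    finally have "(\<Sum>j\<in>UNIV. mat 1 $ i $ j * conv (conv heaviside heaviside) (d j) t) = 0"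
      by (simp add: sum.distrib)
    moreover have "(\<Sum>j\<in>UNIV. mat 1 $ i $ j * conv (conv heaviside heaviside) (d j) t) = (\<Sum>j\<in>UNIV. if j = i then conv (conv heaviside heaviside) (d j) t else 0)"
      by (intro sum.cong) (auto simp: mat_def)
    ultimately show ?thesis by simp
  qed
  have Hd: "conv heaviside (d i) t = 0" for i t
  proof (rule zero_of_conv_heaviside_zero[of "conv heaviside (d i)"])
    show "locbdd (conv heaviside (d i))" by (rule conv_locbdd[OF heaviside_locbdd dl])
    show "continuous (at_right t) (conv heaviside (d i))" for t by (rule conv_right_continuous[OF heaviside_locbdd dl heaviside_rc])
    show "conv heaviside (conv heaviside (d i)) t = 0" for t
      using zero[of i t] conv_assoc[OF heaviside_locbdd Hl dl, of i t] by simp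
  qed
  show ?thesis by (rule zero_of_conv_heaviside_zero[OF d rc Hd])
qed

lemma caputo_integral_eq:
  "(LINT s:{0..t}|lborel. k (t - s) * (q s - q 0)) = conv (\<lambda>s. indicator {0..} s * (q s - q 0)) k t"
  using set_integral_eq_conv[of k t "\<lambda>s. q s - q 0"] tail_nonpos
  by (simp add: conv_commute[of k])

lemma locbdd_of_continuous:
  fixes f :: "real \<Rightarrow> real"
  assumes c: "\<And>T. 0 < T \<Longrightarrow> continuous_on {0..T} f"
  shows "locbdd (\<lambda>s. indicator {0..} s * f s)" "continuous (at_right t) (\<lambda>s. indicator {0..} s * f s)"
proof -
  have c': "continuous_on {0..} f"
    unfolding continuous_on_eq_continuous_within
  proof
    fix x :: real assume x: "x \<in> {0..}"
    have "continuous (at x within {0..x+1}) f"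
      using c[of "x + 1"] x by (auto simp: continuous_on_eq_continuous_within)
    moreover have "at x within {0..x+1} = at x within {0..}"
      by (rule at_within_nhd[of _ "{..<x+1}"]) auto
    ultimately show "continuous (at x within {0..}) f" by simp
  qed
  have "(\<lambda>s. indicator {0..} s *\<^sub>R f s) \<in> borel_measurable borel"
    by (rule borel_measurable_continuous_on_indicator[OF _ c']) simp
  moreover have "\<exists>C. \<forall>t\<le>T. \<bar>indicator {0..} t * f t\<bar> \<le> C" for T
  proof -
    have "compact (f ` {0..\<bar>T\<bar>})"
      by (intro compact_continuous_image continuous_on_subset[OF c']) auto
    then have "bounded (f ` {0..\<bar>T\<bar>})" by (rule compact_imp_bounded)
    then obtain C where "\<forall>y\<in>f ` {0..\<bar>T\<bar>}. norm y \<le> C" unfolding bounded_iff by blast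
    then have C: "\<bar>f t\<bar> \<le> C" if "t \<in> {0..\<bar>T\<bar>}" for t using that by auto
    have "0 \<le> C" using C[of 0] by auto
    then show ?thesis using C by (intro exI[of _ C]) (auto simp: indicator_def)
  qed
  ultimately show "locbdd (\<lambda>s. indicator {0..} s * f s)" by (simp add: locbdd_def)
  show "continuous (at_right t) (\<lambda>s. indicator {0..} s * f s)"
  proof (cases "t < 0")
    case True
    have "eventually (\<lambda>s. indicator {0..} s * f s = 0) (at_right t)"
      unfolding eventually_at_right_field using True by (intro exI[of _ 0]) auto
    then show ?thesis using True by (auto simp: continuous_within intro: tendsto_eventually)
  next
    case False
    have "(f \<longlongrightarrow> f t) (at_right t)"
      using c' False by (auto simp: continuous_on_def intro: tendsto_within_subset[where S="{0..}"])
    moreover have "eventually (\<lambda>s. f s = indicator {0..} s * f s) (at_right t)"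
      unfolding eventually_at_right_field using False by (intro exI[of _ "t+1"]) auto
    ultimately show ?thesis using False by (auto simp: continuous_within elim: Lim_transform_eventually)
  qed
qed

text \<open>
  The Caputo equation prescribes a derivative on the open half-line only; continuity of the left-hand
  side at \<open>0\<close>, where the convolution term vanishes, permits integration from \<open>0\<close>.
\<close>

lemma caputo_solution_integral_equation:
  fixes A :: "real ^ 'n ^ 'n"
  assumes sol: "caputo_solution b \<nu> A u q" and t: "0 \<le> t"
  defines "d \<equiv> \<lambda>i s. indicator {0..} s * (q s $ i - u $ i)"
  shows "b * (q t $ i - u $ i) + conv (d i) k t = (\<Sum>l\<in>UNIV. A $ i $ l * (LINT s:{0..t}|lborel. q s $ l))"
proof (cases "t = 0")
  case True
  have "conv (d i) k 0 = (\<integral>z. 0 \<partial>(lborel :: real measure))"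
    unfolding conv_def d_def
    by (intro Bochner_Integration.integral_cong) (auto simp: indicator_def tail_nonpos)
  moreover have "(LINT s:{0..0}|lborel. q s $ l) = 0" for l
    unfolding set_lebesgue_integral_def
    by (rule integral_eq_zero_AE, use AE_lborel_singleton[of 0] in eventually_elim) (auto simp: indicator_def)
  ultimately show ?thesis using True sol by (simp add: caputo_solution_def)
next
  case False
  then have t: "0 < t" using t by simp
  have qc: "continuous_on {0..T} (\<lambda>s. q s $ i)" if "0 < T" for i T
    using sol that by (intro abs_continuous_on_imp_continuous_on) (auto simp: caputo_solution_def AC_loc_def)
  have dc: "continuous_on {0..T} (\<lambda>s. q s $ i - u $ i)" if "0 < T" for i T
    by (intro continuous_intros qc that)
  have dl: "locbdd (d i)" "continuous (at_right t) (d i)" for i t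
    unfolding d_def by (rule locbdd_of_continuous[OF dc], assumption)+
  have q0: "q 0 = u" using sol by (simp add: caputo_solution_def)
  define G where "G r = b * q r $ i + conv (d i) k r" for r
  have G: "(G has_real_derivative (\<Sum>l\<in>UNIV. A $ i $ l * q r $ l)) (at r)" if "0 < r" for r
  proof -
    have "(LINT s:{0..r}|lborel. k (r - s) * (q s $ i - q 0 $ i)) = conv (d i) k r" for r
      using caputo_integral_eq[of r "\<lambda>s. q s $ i"] by (simp add: d_def q0)
    then have "(\<lambda>t. b * q t $ i + (LINT s:{0..t}|lborel. k (t - s) * (q s $ i - q 0 $ i))) = G"
      by (simp add: G_def fun_eq_iff)
    then show ?thesis
      using sol that by (auto simp: caputo_solution_def has_caputo_derivative_def matrix_vector_mult_def)
  qed
  have "continuous_on {0..t} G"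
    unfolding continuous_on_eq_continuous_within
  proof
    fix x assume x: "x \<in> {0..t}"
    show "continuous (at x within {0..t}) G"
    proof (cases "x = 0")
      case True
      have "continuous (at 0 within {0..t}) (\<lambda>s. q s $ i)"
        using qc[OF t] t by (auto simp: continuous_on_eq_continuous_within)
      moreover have "continuous (at_right 0) (conv (d i) k)"
        by (rule conv_right_continuous[OF dl(1) tail_locint dl(2)])
      then have "continuous (at 0 within {0..t}) (conv (d i) k)" using t by (simp add: at_within_Icc_at_right)
      ultimately show ?thesis unfolding True G_def[abs_def] by (intro continuous_add continuous_mult_left)
    next
      case False
      then have "0 < x" using x by simp
      then show ?thesis by (rule continuous_at_imp_continuous_at_within[OF DERIV_isCont[OF G]])
    qed
  qed
  then have "((\<lambda>r. \<Sum>l\<in>UNIV. A $ i $ l * q r $ l) has_integral (G t - G 0)) {0..t}"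
  proof (rule fundamental_theorem_of_calculus_interior[rotated])
    show "(G has_vector_derivative (\<Sum>l\<in>UNIV. A $ i $ l * q x $ l)) (at x)" if "x \<in> {0<..<t}" for x
      using G[of x] that by (simp add: has_real_derivative_iff_has_vector_derivative)
  qed (use t in auto)
  moreover have "((\<lambda>r. \<Sum>l\<in>UNIV. A $ i $ l * q r $ l) has_integral (\<Sum>l\<in>UNIV. A $ i $ l * integral {0..t} (\<lambda>s. q s $ l))) {0..t}"
    by (intro has_integral_sum has_integral_mult_right integrable_integral integrable_continuous_real qc t) auto
  ultimately have "G t - G 0 = (\<Sum>l\<in>UNIV. A $ i $ l * integral {0..t} (\<lambda>s. q s $ l))"
    by (rule has_integral_unique)
  also have "\<dots> = (\<Sum>l\<in>UNIV. A $ i $ l * (LINT s:{0..t}|lborel. q s $ l))"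
    by (intro sum.cong refl arg_cong2[where f="(*)"] set_borel_integral_eq_integral(2)[symmetric]
      borel_integrable_atLeastAtMost' qc t)
  finally have "G t - G 0 = \<dots>" .
  moreover have "conv (d i) k 0 = (\<integral>z. 0 \<partial>(lborel :: real measure))"
    unfolding conv_def d_def
    by (intro Bochner_Integration.integral_cong) (auto simp: indicator_def tail_nonpos)
  ultimately show ?thesis by (simp add: G_def q0 algebra_simps)
qed

lemma caputo_solution_unique:
  fixes A :: "real ^ 'n ^ 'n"
  assumes sol: "caputo_solution b \<nu> A u q" "caputo_solution b \<nu> A u q'" and t: "0 \<le> t"
  shows "q t = q' t"
proof -
  define d where "d i s = indicator {0..} s * (q s $ i - q' s $ i)" for i s
  define e where "e q i s = indicator {0..} s * (q s $ i - u $ i)" for q :: "real \<Rightarrow> real ^ 'n" and i s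
  have qc: "continuous_on {0..T} (\<lambda>s. q s $ i)" "continuous_on {0..T} (\<lambda>s. q' s $ i)" if "0 < T" for i T
    using sol that by (auto intro!: abs_continuous_on_imp_continuous_on simp: caputo_solution_def AC_loc_def)
  have dc: "continuous_on {0..T} (\<lambda>s. q s $ i - q' s $ i)" "continuous_on {0..T} (\<lambda>s. q s $ i - u $ i)"
     "continuous_on {0..T} (\<lambda>s. q' s $ i - u $ i)" if "0 < T" for i T
    by (intro continuous_intros qc that)+
  note dl = locbdd_of_continuous[OF dc(1), folded d_def]
  note el = locbdd_of_continuous[OF dc(2), folded e_def] locbdd_of_continuous[OF dc(3), folded e_def]
  have si: "set_integrable lborel {0..t} (\<lambda>s. q s $ l)" "set_integrable lborel {0..t} (\<lambda>s. q' s $ l)" for l t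
  proof -
    have "set_integrable lborel {0..\<bar>t\<bar>+1} (\<lambda>s. q s $ l)" "set_integrable lborel {0..\<bar>t\<bar>+1} (\<lambda>s. q' s $ l)"
      by (intro borel_integrable_atLeastAtMost' qc; simp)+
    then show "set_integrable lborel {0..t} (\<lambda>s. q s $ l)" "set_integrable lborel {0..t} (\<lambda>s. q' s $ l)"
      by (auto elim!: set_integrable_subset)
  qed
  have "d i t = 0" for i
  proof (rule homogeneous_solution_zero[of d A])
    show "locbdd (d i)" for i by (rule dl(1))
    show "continuous (at_right t) (d i)" for i t by (rule dl(2))
    show "b * d i t + conv (d i) k t = (\<Sum>l\<in>UNIV. A $ i $ l * conv heaviside (d l) t)" for i t
    proof (cases "t < 0")
      case True
      then have "conv (d i) k t = 0" "conv heaviside (d l) t = 0" for l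
        using locbddD(2)[OF dl(1)] locbddD(2)[OF heaviside_locbdd] tail_nonpos by (auto intro!: conv_neg)
      then show ?thesis using True by (simp add: d_def)
    next
      case False
      then have t: "0 \<le> t" by simp
      note s1 = caputo_solution_integral_equation[OF sol(1) t, of i, folded e_def]
      note s2 = caputo_solution_integral_equation[OF sol(2) t, of i, folded e_def]
      have "conv (d i) k t = (\<integral>z. e q i (t - z) * k z - e q' i (t - z) * k z \<partial>lborel)"
        unfolding conv_def by (intro Bochner_Integration.integral_cong) (auto simp: d_def e_def algebra_simps)
      also have "\<dots> = conv (e q i) k t - conv (e q' i) k t"
        using conv_integrable[OF el(1) tail_locint, of i t] conv_integrable[OF el(3) tail_locint, of i t]
        by (simp add: conv_def)
      finally have c: "conv (d i) k t = conv (e q i) k t - conv (e q' i) k t" .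
      have "conv heaviside (d l) t = (LINT s:{0..t}|lborel. q s $ l - q' s $ l)" for l
      proof -
        have "conv heaviside (d l) t = (LINT s:{0..t}|lborel. d l s)"
          by (rule conv_heaviside_eq_set_integral) (simp add: d_def)
        also have "\<dots> = (LINT s:{0..t}|lborel. q s $ l - q' s $ l)"
          by (rule set_lebesgue_integral_cong) (auto simp: d_def)
        finally show ?thesis .
      qed
      then have hl: "conv heaviside (d l) t = (LINT s:{0..t}|lborel. q s $ l) - (LINT s:{0..t}|lborel. q' s $ l)" for l
        using set_integral_diff(2)[OF si] by simp
      have "b * d i t + conv (d i) k t = (b * (q t $ i - u $ i) + conv (e q i) k t) - (b * (q' t $ i - u $ i) + conv (e q' i) k t)"
        using t by (simp add: c d_def algebra_simps)
      also have "\<dots> = (\<Sum>l\<in>UNIV. A $ i $ l * conv heaviside (d l) t)"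
        unfolding s1 s2 hl by (simp add: sum_subtractf right_diff_distrib)
      finally show ?thesis .
    qed
  qed
  then show ?thesis using t by (auto simp: d_def vec_eq_iff)
qed

lemma occ_caputo_solution:
  fixes A :: "real ^ 'n ^ 'n"
  assumes ac: "\<And>x y. 0 < x \<Longrightarrow> x < y \<Longrightarrow> abs_continuous_on {x..y} k"
    and D: "\<And>i s. (D i has_real_derivative (\<Sum>l\<in>UNIV. A $ i $ l * D l s)) (at s)"
    and D0: "\<And>i. D i 0 = (\<Sum>l\<in>UNIV. A $ i $ l * u $ l)"
    and Db: "\<And>i. exp_bounded C c (D i)" and c: "0 \<le> c"
    and q: "\<And>t i. 0 \<le> t \<Longrightarrow> q t $ i = u $ i + occ (D i) t"
  shows "caputo_solution b \<nu> A u q"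
  unfolding caputo_solution_def
proof (intro conjI allI impI)
  have wac: "abs_continuous_on {0..t} (occ (D i))" if "0 < t" for t i
    using occ_abs_continuous[OF ac _ Db c, of t] that by auto
  have "abs_continuous_on {0..t} (\<lambda>s. q s $ i)" if "0 < t" for t i
    by (rule abs_continuous_on_shift[OF wac[OF that]]) (simp add: q)
  then show "q \<in> AC_loc" by (simp add: AC_loc_def)
  show q0: "q 0 = u" using q[of 0] occ_zero[OF Db] by (simp add: vec_eq_iff)
  fix t :: real assume t: "0 < t"
  show "has_caputo_derivative b \<nu> q (A *v q t) t"
    unfolding has_caputo_derivative_def
  proof
    fix i
    define B where "B = max C ((\<Sum>l\<in>UNIV. \<bar>A $ i $ l\<bar>) * C)"
    define D' where "D' s = (\<Sum>l\<in>UNIV. A $ i $ l * D l s)" for s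
    have id: "b * occ (D i) r + conv (occ (D i)) k r = D i 0 * max 0 r + conv heaviside (occ D') r" for r
    proof (rule occ_identity[where h="D i" and h'=D' and C=B and c=c])
      show "(D i has_real_derivative D' s) (at s)" for s unfolding D'_def by (rule D)
      show "isCont D' s" for s
        unfolding D'_def[abs_def] using DERIV_isCont[OF D] by (intro continuous_intros) auto
      show "exp_bounded B c (D i)" by (rule exp_bounded_mono[OF Db]) (simp add: B_def)
      have "exp_bounded ((\<Sum>l\<in>UNIV. \<bar>A $ i $ l\<bar>) * C) c D'"
        unfolding D'_def by (rule exp_bounded_sum[OF Db order_refl])
      then show "exp_bounded B c D'" by (rule exp_bounded_mono) (simp add: B_def)
    qed
    have wD': "occ D' = (\<lambda>t. \<Sum>l\<in>UNIV. A $ i $ l * occ (D l) t)"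
      unfolding D'_def by (rule ext, rule occ_sum[OF Db])
    define F where "F r = b * u $ i + D i 0 * r + conv heaviside (occ D') r" for r
    have Feq: "b * q r $ i + (LINT s:{0..r}|lborel. k (r - s) * (q s $ i - q 0 $ i)) = F r" if r: "0 < r" for r
    proof -
      have "(\<lambda>s. indicator {0..} s * (q s $ i - q 0 $ i)) = occ (D i)"
        using occ_neg[OF Db] by (auto simp: fun_eq_iff indicator_def q q0)
      then show ?thesis
        using caputo_integral_eq[of r "\<lambda>s. q s $ i"] id[of r] r by (simp add: q F_def algebra_simps)
    qed
    have "continuous_on {0..t+1} (occ D')"
      unfolding wD' using t by (intro continuous_intros abs_continuous_on_imp_continuous_on wac) auto
    moreover have "occ D' s = 0" if "s < 0" for s unfolding wD' using occ_neg[OF Db that] by simp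
    ultimately have "(conv heaviside (occ D') has_real_derivative occ D' t) (at t)"
      using t by (intro conv_heaviside_derivative[where T="t+1"]) auto
    then have "(F has_real_derivative D i 0 + occ D' t) (at t)"
      unfolding F_def[abs_def] by (auto intro!: derivative_eq_intros)
    also have "D i 0 + occ D' t = (A *v q t) $ i"
      using t by (simp add: D0 wD' matrix_vector_mult_def q sum.distrib distrib_left)
    finally have "(F has_real_derivative (A *v q t) $ i) (at t)" .
    then show "((\<lambda>t. b * q t $ i + (LINT s:{0..t}|lborel. k (t - s) * (q s $ i - q 0 $ i)))
       has_real_derivative (A *v q t) $ i) (at t)"
      by (rule has_field_derivative_transform_within_open[of _ _ _ "{0<..}"]) (use t Feq in auto)
  qed
qed

end

section \<open>The inverse subordinator\<close>

text \<open>
  Path properties hold almost surely, so the inverse process is only almost everywhere equal to a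
  measurable function; that is enough for the completion.
\<close>

lemma borel_measurable_completion_AE:
  fixes f g :: "'a \<Rightarrow> 'b::topological_space"
  assumes f: "f \<in> borel_measurable M" and ae: "AE x in M. f x = g x"
  shows "g \<in> borel_measurable (completion M)"
proof (rule borel_measurableI)
  have complete: "complete_measure (completion M)" by standard
  fix S :: "'b set" assume "open S"
  then have "f -` S \<inter> space (completion M) \<in> sets (completion M)"
    using measurable_sets[OF measurable_completion[OF f], of S] by auto
  then show "g -` S \<inter> space (completion M) \<in> sets (completion M)"
  proof (rule complete_measure.in_sets_AE[OF complete, rotated])
    show "AE x in completion M. x \<in> f -` S \<inter> space (completion M) \<longleftrightarrow> x \<in> g -` S \<inter> space (completion M)"
      using AE_completion[OF ae] by eventually_elim auto
  qed auto
qed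

lemma integrable_matrix_componentwise:
  fixes F :: "'a \<Rightarrow> real ^ 'n ^ 'm"
  assumes "\<And>i j. integrable M (\<lambda>x. F x $ i $ j)"
  shows "integrable M F"
proof -
  have "F x = (\<Sum>i\<in>UNIV. \<Sum>j\<in>UNIV. (F x $ i $ j) *\<^sub>R axis i (axis j 1))" for x
  proof -
    have "(\<Sum>i\<in>UNIV. \<Sum>j\<in>UNIV. (F x $ i $ j) *\<^sub>R axis i (axis j 1)) $ c $ d
      = (\<Sum>i\<in>UNIV. if i = c then (\<Sum>j\<in>UNIV. if j = d then F x $ i $ j else 0) else 0)" for c d
      unfolding sum_component
    proof (rule sum.cong[OF refl])
      fix i
      show "(\<Sum>j\<in>UNIV. ((F x $ i $ j) *\<^sub>R axis i (axis j 1)) $ c $ d)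
        = (if i = c then (\<Sum>j\<in>UNIV. if j = d then F x $ i $ j else 0) else 0)"
        by (cases "i = c") (simp_all add: axis_def if_distrib[where f="\<lambda>v. _ * v"] cong: if_cong)
    qed
    then show ?thesis by (simp add: vec_eq_iff)
  qed
  moreover have "integrable M (\<lambda>x. \<Sum>i\<in>UNIV. \<Sum>j\<in>UNIV. (F x $ i $ j) *\<^sub>R (axis i (axis j 1) :: real ^ 'n ^ 'm))"
    using assms by (intro Bochner_Integration.integrable_sum integrable_scaleR_left) auto
  ultimately show ?thesis by simp
qed

lemma integral_matrix_nth:
  fixes F :: "'a \<Rightarrow> real ^ 'n ^ 'm"
  assumes "integrable M F"
  shows "integral\<^sup>L M F $ i $ j = (\<integral>x. F x $ i $ j \<partial>M)"
proof -
  have "bounded_linear (\<lambda>X :: real ^ 'n ^ 'm. X $ i $ j)"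
    by (rule bounded_linear_compose[OF bounded_linear_vec_nth bounded_linear_vec_nth])
  from integral_bounded_linear[OF this assms] show ?thesis by simp
qed

text \<open>
  Monotonicity of the paths ties the law of the inverse at a fixed level to the one-dimensional laws of
  the process, and those are given by their Laplace transforms.
\<close>

locale inverse_subordinator = levy_measure \<nu> + prob_space M
  for \<nu> :: "real measure" and M :: "'a measure" +
  fixes \<sigma> :: "real \<Rightarrow> 'a \<Rightarrow> real" and b :: real
  assumes drift_nonneg: "0 \<le> b"
    and \<sigma>_measurable: "\<And>s. 0 \<le> s \<Longrightarrow> \<sigma> s \<in> borel_measurable M"
    and \<sigma>_zero: "AE \<omega> in M. \<sigma> 0 \<omega> = 0"
    and \<sigma>_mono: "AE \<omega> in M. mono_on {0..} (\<lambda>s. \<sigma> s \<omega>)"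
    and \<sigma>_laplace: "\<And>s x. 0 < s \<Longrightarrow> 0 < x \<Longrightarrow>
      (\<integral>\<omega>. exp (- x * \<sigma> s \<omega>) \<partial>M) = exp (- s * (b * x + (\<integral>y. (1 - exp (- y * x)) \<partial>\<nu>)))"
begin

definition law :: "real \<Rightarrow> real \<Rightarrow> real" where
  "law s t = (if s \<le> 0 then 0 else prob {\<omega> \<in> space M. \<sigma> s \<omega> \<le> t})"

lemma \<sigma>_nonneg: "0 \<le> s \<Longrightarrow> AE \<omega> in M. 0 \<le> \<sigma> s \<omega>"
  using \<sigma>_zero \<sigma>_mono by eventually_elim (auto dest: mono_onD[of _ _ 0 s])

lemma law_sets: "0 \<le> s \<Longrightarrow> {\<omega> \<in> space M. \<sigma> s \<omega> \<le> t} \<in> events"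
  using \<sigma>_measurable[of s] by measurable

lemma law_laplace:
  assumes s: "0 < s" and x: "0 < x"
  shows "(\<integral>t. exp (- x * t) * law s t \<partial>lborel) = (\<integral>\<omega>. exp (- x * \<sigma> s \<omega>) \<partial>M) / x"
proof -
  have [measurable]: "\<sigma> s \<in> borel_measurable M" using \<sigma>_measurable s by simp
  interpret pair_sigma_finite M lborel ..
  define F where "F \<omega> t = (if \<sigma> s \<omega> \<le> t then exp (- x * t) else 0)" for \<omega> t
  have [measurable]: "(\<lambda>(\<omega>, t). F \<omega> t) \<in> borel_measurable (M \<Otimes>\<^sub>M lborel)"
    unfolding F_def by measurable
  have F1: "integrable lborel (F \<omega>)" "(\<integral>t. F \<omega> t \<partial>lborel) = exp (- x * \<sigma> s \<omega>) / x" for \<omega>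
  proof -
    have "F \<omega> = (\<lambda>t. indicator {\<sigma> s \<omega>..} t * exp (- x * t))" by (auto simp: F_def fun_eq_iff)
    then show "integrable lborel (F \<omega>)" "(\<integral>t. F \<omega> t \<partial>lborel) = exp (- x * \<sigma> s \<omega>) / x"
      using exp_atLeast_integral[OF x] by auto
  qed
  have F2: "(\<integral>\<omega>. F \<omega> t \<partial>M) = exp (- x * t) * law s t" for t
  proof -
    have "(\<integral>\<omega>. F \<omega> t \<partial>M) = (\<integral>\<omega>. exp (- x * t) * indicator {\<omega> \<in> space M. \<sigma> s \<omega> \<le> t} \<omega> \<partial>M)"
      by (intro Bochner_Integration.integral_cong) (auto simp: F_def indicator_def)
    then show ?thesis using law_sets[of s t] s by (simp add: law_def)
  qed
  have "integrable (M \<Otimes>\<^sub>M lborel) (\<lambda>(\<omega>, t). F \<omega> t)"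
  proof (rule Fubini_integrable)
    have n: "(\<integral>t. norm (F \<omega> t) \<partial>lborel) = exp (- x * \<sigma> s \<omega>) / x" for \<omega>
      using F1(2)[of \<omega>] by (simp add: F_def if_distrib cong: if_cong)
    have "integrable M (\<lambda>\<omega>. exp (- x * \<sigma> s \<omega>))"
    proof (rule integrable_const_bound[where B=1])
      show "AE \<omega> in M. norm (exp (- x * \<sigma> s \<omega>)) \<le> 1"
        using \<sigma>_nonneg[OF less_imp_le[OF s]] by eventually_elim (use x in auto)
    qed measurable
    then show "integrable M (\<lambda>\<omega>. \<integral>t. norm (case (\<omega>, t) of (\<omega>, t) \<Rightarrow> F \<omega> t) \<partial>lborel)" by (simp add: n[unfolded real_norm_def])
  qed (use F1 in auto)
  from Fubini_integral[OF this] show ?thesis by (simp add: F1 F2)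
qed

sublocale subordinator_law \<nu> b law
proof
  show "0 \<le> b" by (rule drift_nonneg)
  show "0 \<le> law s t" "law s t \<le> 1" for s t by (auto simp: law_def)
  show "law s t = 0" if "s \<le> 0" for s t using that by (simp add: law_def)
  show "law s t = 0" if "t < 0" for s t
  proof (cases "0 < s")
    case True
    have "AE \<omega> in M. \<not> \<sigma> s \<omega> \<le> t" using \<sigma>_nonneg[of s] True that by (auto elim: eventually_mono)
    then have "prob {\<omega> \<in> space M. \<sigma> s \<omega> \<le> t} = 0"
      using law_sets[of s t] True by (subst prob_eq_0) (auto elim: eventually_mono)
    then show ?thesis by (simp add: law_def)
  qed (simp add: law_def)
  show "law s t \<le> law s t'" if "t \<le> t'" for s t t'
    using that law_sets[of s t'] by (auto simp: law_def intro!: finite_measure_mono)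
  show "continuous (at_right t) (law s)" for s t
  proof (cases "0 < s")
    case True
    then have [measurable]: "\<sigma> s \<in> borel_measurable M" using \<sigma>_measurable by simp
    interpret D: real_distribution "distr M borel (\<sigma> s)" by (rule real_distribution_distr) measurable
    have "law s = cdf (distr M borel (\<sigma> s))"
      using True by (auto simp: law_def cdf_def measure_distr fun_eq_iff vimage_def Int_def conj_commute
        intro!: arg_cong[where f=prob])
    then show ?thesis using D.cdf_is_right_cont by simp
  next
    case False
    then have "law s = (\<lambda>_. 0)" by (auto simp: law_def)
    then show ?thesis by simp
  qed
  show "law s' t \<le> law s t" if "0 < s" "s \<le> s'" for s s' t
  proof -
    have "AE \<omega> in M. \<omega> \<in> {\<omega> \<in> space M. \<sigma> s' \<omega> \<le> t} \<longrightarrow> \<omega> \<in> {\<omega> \<in> space M. \<sigma> s \<omega> \<le> t}"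
      using \<sigma>_mono by eventually_elim (use that in \<open>auto dest: mono_onD[of _ _ s s']\<close>)
    then have "prob {\<omega> \<in> space M. \<sigma> s' \<omega> \<le> t} \<le> prob {\<omega> \<in> space M. \<sigma> s \<omega> \<le> t}"
      using that by (intro finite_measure_mono_AE law_sets) auto
    then show ?thesis using that by (simp add: law_def)
  qed
  show "(\<integral>t. exp (- x * t) * law s t \<partial>lborel) = exp (- s * (b * x + (\<integral>y. (1 - exp (- y * x)) \<partial>\<nu>))) / x"
    if "0 < s" "0 < x" for s x
    using law_laplace[OF that] \<sigma>_laplace[OF that] by simp
qed

text \<open>
  The process stays below \<open>t\<close> up to time \<open>n\<close> with a probability that decays exponentially in \<open>n\<close>.
\<close>

lemma AE_passage: "AE \<omega> in M. \<exists>s>0. t < \<sigma> s \<omega>"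
proof -
  obtain x where x: "x > 0" "0 < bernstein x" using bernstein_unbounded[of 0] by blast
  have "(\<lambda>n. exp (x * t) * exp (- real (Suc n) * bernstein x)) \<longlonglongrightarrow> exp (x * t) * 0"
    using x by (intro tendsto_intros) real_asymp
  then have lim: "(\<lambda>n. exp (x * t) * exp (- real (Suc n) * bernstein x)) \<longlonglongrightarrow> 0" by simp
  define A where "A = (\<Inter>n. {\<omega> \<in> space M. \<sigma> (real (Suc n)) \<omega> \<le> t})"
  have A: "A \<in> events" unfolding A_def by (intro sets.countable_INT) (auto intro!: law_sets)
  have "prob A \<le> exp (x * t) * exp (- real (Suc n) * bernstein x)" for n
  proof -
    have "prob A \<le> law (real (Suc n)) t"
      using law_sets[of "real (Suc n)" t] by (auto simp: law_def A_def intro!: finite_measure_mono)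
    also have "\<dots> \<le> exp (x * t) * exp (- real (Suc n) * bernstein x)" by (rule p_chernoff) (use x in auto)
    finally show ?thesis .
  qed
  then have "prob A \<le> 0" by (intro LIMSEQ_le_const[OF lim]) auto
  then have "AE \<omega> in M. \<omega> \<notin> A" using A by (subst (asm) measure_le_0_iff) (simp add: prob_eq_0)
  moreover have "AE \<omega> in M. \<omega> \<in> space M" by simp
  ultimately show ?thesis
  proof eventually_elim
    case (elim \<omega>)
    then obtain n where "t < \<sigma> (real (Suc n)) \<omega>" by (auto simp: A_def not_le)
    then show ?case by (intro exI[of _ "real (Suc n)"]) auto
  qed
qed

text \<open>
  Off a null set \<open>N\<close> that contains all exceptional paths, monotonicity reduces the infimum to rational
  times, which gives measurability, and shows that \<open>s < L\<close> implies \<open>\<sigma>\<^sub>s \<le> t\<close>, which implies \<open>s \<le> L\<close>. The outer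
  events differ by an atom of the law of \<open>L\<close>, and there are only countably many atoms.
\<close>

lemma inverse_version:
  obtains L where "L \<in> borel_measurable M" "AE \<omega> in M. L \<omega> = inverse_process \<sigma> t \<omega>"
    "\<And>\<omega>. 0 \<le> L \<omega>" "AE s in lborel. prob {\<omega> \<in> space M. 0 < s \<and> s < L \<omega>} = law s t"
proof -
  define good where "good \<omega> \<longleftrightarrow> mono_on {0..} (\<lambda>s. \<sigma> s \<omega>) \<and> (\<exists>s>0. t < \<sigma> s \<omega>)" for \<omega>
  have "AE \<omega> in M. good \<omega>" using \<sigma>_mono AE_passage[of t] by eventually_elim (simp add: good_def)
  then obtain N where N: "{\<omega> \<in> space M. \<not> good \<omega>} \<subseteq> N" "N \<in> null_sets M"
    by (auto elim!: AE_E3)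
  define S where "S \<omega> = {s. 0 < s \<and> t < \<sigma> s \<omega>}" for \<omega>
  define L where "L \<omega> = (if \<omega> \<in> space M - N then Inf (S \<omega>) else 0)" for \<omega>
  have good: "good \<omega>" if "\<omega> \<in> space M - N" for \<omega> using that N(1) by blast
  have S: "S \<omega> \<noteq> {}" "bdd_below (S \<omega>)" if "\<omega> \<in> space M - N" for \<omega>
  proof -
    show "S \<omega> \<noteq> {}" using good[OF that] by (auto simp: S_def good_def)
    show "bdd_below (S \<omega>)" by (rule bdd_belowI[of _ 0]) (simp add: S_def)
  qed
  have mono: "\<sigma> r \<omega> \<le> \<sigma> s \<omega>" if "\<omega> \<in> space M - N" "0 \<le> r" "r \<le> s" for r s \<omega>
    using good[OF that(1)] that by (auto simp: good_def intro: mono_onD[of "{0..}" "\<lambda>s. \<sigma> s \<omega>"])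
  have L_nonneg: "0 \<le> L \<omega>" for \<omega>
    using S(1)[of \<omega>] by (auto simp: L_def S_def intro!: cInf_greatest)
  have L_less: "L \<omega> < c \<longleftrightarrow> (\<exists>r\<in>\<rat> \<inter> {0<..<c}. t < \<sigma> r \<omega>)" if \<omega>: "\<omega> \<in> space M - N" for \<omega> c
  proof -
    have "L \<omega> < c \<longleftrightarrow> (\<exists>s\<in>S \<omega>. s < c)" using \<omega> cInf_less_iff[OF S[OF \<omega>]] by (auto simp: L_def)
    also have "\<dots> \<longleftrightarrow> (\<exists>r\<in>\<rat> \<inter> {0<..<c}. t < \<sigma> r \<omega>)"
    proof
      assume "\<exists>s\<in>S \<omega>. s < c"
      then obtain s where s: "0 < s" "t < \<sigma> s \<omega>" "s < c" by (auto simp: S_def)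
      obtain r where "r \<in> \<rat>" "s < r" "r < c" using Rats_dense_in_real[OF s(3)] by auto
      then show "\<exists>r\<in>\<rat> \<inter> {0<..<c}. t < \<sigma> r \<omega>"
        using s mono[OF \<omega>, of s r] by (intro bexI[of _ r]) auto
    qed (auto simp: S_def)
    finally show ?thesis .
  qed
  have Nev: "N \<in> events" using N(2) by auto
  have L_meas: "L \<in> borel_measurable M"
    unfolding borel_measurable_iff_less
  proof
    fix c
    have passed: "(\<Union>r\<in>\<rat> \<inter> {0<..<c}. {\<omega> \<in> space M. t < \<sigma> r \<omega>}) \<in> events"
    proof (rule sets.countable_UN'')
      show "countable (\<rat> \<inter> {0<..<c} :: real set)" by (intro countable_Int1 countable_rat)
      fix r :: real assume "r \<in> \<rat> \<inter> {0<..<c}"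
      then have [measurable]: "\<sigma> r \<in> borel_measurable M" using \<sigma>_measurable[of r] by auto
      show "{\<omega> \<in> space M. t < \<sigma> r \<omega>} \<in> events" by measurable
    qed
    have "{\<omega> \<in> space M. L \<omega> < c} = (if 0 < c then N else {}) \<union>
      ((\<Union>r\<in>\<rat> \<inter> {0<..<c}. {\<omega> \<in> space M. t < \<sigma> r \<omega>}) - N)"
      using L_less sets.sets_into_space[OF Nev] by (auto simp: L_def)
    also have "\<dots> \<in> events" using Nev passed by auto
    finally show "{\<omega> \<in> space M. L \<omega> < c} \<in> events" .
  qed
  have AE_N: "AE \<omega> in M. \<omega> \<in> space M - N"
    using AE_not_in[OF N(2)] AE_space by eventually_elim auto
  have L_AE: "AE \<omega> in M. L \<omega> = inverse_process \<sigma> t \<omega>"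
    using AE_N by eventually_elim (simp add: L_def S_def inverse_process_def)
  note [measurable] = L_meas
  interpret D: prob_space "distr M borel L" by (rule prob_space_distr) measurable
  have "AE s in lborel. s \<notin> {s. measure (distr M borel L) {s} \<noteq> 0}"
    by (intro AE_not_in countable_imp_null_set_lborel D.countable_support)
  then have ae: "AE s in lborel. prob {\<omega> \<in> space M. 0 < s \<and> s < L \<omega>} = law s t"
  proof eventually_elim
    case (elim s)
    then have atom: "prob {\<omega> \<in> space M. L \<omega> = s} = 0"
      by (simp add: measure_distr vimage_def Int_def conj_commute)
    show ?case
    proof (cases "0 < s")
      case True
      have "prob {\<omega> \<in> space M. 0 < s \<and> s < L \<omega>} \<le> prob {\<omega> \<in> space M. \<sigma> s \<omega> \<le> t}"
      proof (rule finite_measure_mono_AE)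
        show "AE \<omega> in M. \<omega> \<in> {\<omega> \<in> space M. 0 < s \<and> s < L \<omega>} \<longrightarrow> \<omega> \<in> {\<omega> \<in> space M. \<sigma> s \<omega> \<le> t}"
          using AE_N
        proof eventually_elim
          case (elim \<omega>)
          have "L \<omega> \<le> s" if "t < \<sigma> s \<omega>"
            using elim cInf_lower[OF _ S(2)[OF elim], of s] True that by (simp add: L_def S_def)
          then show ?case using elim by force
        qed
      qed (use True in \<open>auto intro!: law_sets\<close>)
      moreover have "prob {\<omega> \<in> space M. \<sigma> s \<omega> \<le> t} \<le> prob ({\<omega> \<in> space M. 0 < s \<and> s < L \<omega>} \<union> {\<omega> \<in> space M. L \<omega> = s})"
      proof (rule finite_measure_mono_AE)
        show "AE \<omega> in M. \<omega> \<in> {\<omega> \<in> space M. \<sigma> s \<omega> \<le> t} \<longrightarrow>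
          \<omega> \<in> {\<omega> \<in> space M. 0 < s \<and> s < L \<omega>} \<union> {\<omega> \<in> space M. L \<omega> = s}"
          using AE_N
        proof eventually_elim
          case (elim \<omega>)
          have "s \<le> L \<omega>" if st: "\<sigma> s \<omega> \<le> t"
          proof -
            have "s \<le> r" if "r \<in> S \<omega>" for r
            proof (rule ccontr)
              assume "\<not> s \<le> r"
              then have "\<sigma> r \<omega> \<le> \<sigma> s \<omega>" using mono[OF elim, of r s] that by (auto simp: S_def)
              then show False using that st by (auto simp: S_def)
            qed
            then show ?thesis using elim S(1)[OF elim] by (auto simp: L_def intro!: cInf_greatest)
          qed
          then show ?case using elim True by force
        qed
      qed measurable
      moreover have "prob ({\<omega> \<in> space M. 0 < s \<and> s < L \<omega>} \<union> {\<omega> \<in> space M. L \<omega> = s})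
          \<le> prob {\<omega> \<in> space M. 0 < s \<and> s < L \<omega>} + prob {\<omega> \<in> space M. L \<omega> = s}"
        by (rule measure_Un_le) measurable
      ultimately show ?thesis using atom True by (simp add: law_def)
    qed (simp add: law_def)
  qed
  show thesis by (rule that[OF L_meas L_AE L_nonneg ae])
qed

text \<open>
  Write \<open>h (L \<omega>) - h 0\<close> as the integral of \<open>h'\<close> from \<open>0\<close> to \<open>L \<omega>\<close> and exchange the integrals.
\<close>

lemma expectation_of_inverse:
  assumes [measurable]: "L \<in> borel_measurable M" and L0: "\<And>\<omega>. 0 \<le> L \<omega>"
    and L: "AE s in lborel. prob {\<omega> \<in> space M. 0 < s \<and> s < L \<omega>} = law s t"
    and D: "\<And>s. (h has_real_derivative h' s) (at s)" and h': "continuous_on UNIV h'" "exp_bounded C c h'"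
  shows "integrable M (\<lambda>\<omega>. h (L \<omega>))" "expectation (\<lambda>\<omega>. h (L \<omega>)) = h 0 + occ h' t"
proof -
  interpret P: pair_sigma_finite lborel M ..
  have [measurable]: "h' \<in> borel_measurable borel" by (rule borel_measurable_continuous_onI[OF h'(1)])
  define G where "G s \<omega> = (if 0 < s \<and> s < L \<omega> then h' s else 0)" for s \<omega>
  have [measurable]: "(\<lambda>(s, \<omega>). G s \<omega>) \<in> borel_measurable (lborel \<Otimes>\<^sub>M M)"
    unfolding G_def by measurable
  have G_ind: "G s \<omega> = h' s * indicator {\<omega> \<in> space M. 0 < s \<and> s < L \<omega>} \<omega>" if "\<omega> \<in> space M" for s \<omega>
    using that by (simp add: G_def indicator_def)
  have G1: "(\<integral>\<omega>. G s \<omega> \<partial>M) = h' s * prob {\<omega> \<in> space M. 0 < s \<and> s < L \<omega>}"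
    "(\<integral>\<omega>. norm (G s \<omega>) \<partial>M) = \<bar>h' s\<bar> * prob {\<omega> \<in> space M. 0 < s \<and> s < L \<omega>}"
    "integrable M (G s)" for s
  proof -
    have "(\<integral>\<omega>. G s \<omega> \<partial>M) = (\<integral>\<omega>. h' s * indicator {\<omega> \<in> space M. 0 < s \<and> s < L \<omega>} \<omega> \<partial>M)"
      by (rule Bochner_Integration.integral_cong[OF refl G_ind])
    then show "(\<integral>\<omega>. G s \<omega> \<partial>M) = h' s * prob {\<omega> \<in> space M. 0 < s \<and> s < L \<omega>}" by simp
    have "(\<integral>\<omega>. norm (G s \<omega>) \<partial>M) = (\<integral>\<omega>. \<bar>h' s\<bar> * indicator {\<omega> \<in> space M. 0 < s \<and> s < L \<omega>} \<omega> \<partial>M)"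
      by (rule Bochner_Integration.integral_cong[OF refl]) (simp add: G_ind abs_mult)
    then show "(\<integral>\<omega>. norm (G s \<omega>) \<partial>M) = \<bar>h' s\<bar> * prob {\<omega> \<in> space M. 0 < s \<and> s < L \<omega>}" by simp
    show "integrable M (G s)"
      by (rule integrable_const_bound[where B="\<bar>h' s\<bar>"]) (auto simp: G_def[abs_def])
  qed
  note p_measurable_s[measurable]
  have "integrable (lborel \<Otimes>\<^sub>M M) (\<lambda>(s, \<omega>). G s \<omega>)"
  proof (rule P.Fubini_integrable)
    have "integrable lborel (\<lambda>s. \<integral>\<omega>. norm (G s \<omega>) \<partial>M)"
    proof (rule integrable_cong_AE_imp)
      show "integrable lborel (\<lambda>s. \<bar>h' s * law s t\<bar>)" using weighted_law_integrable[OF h'(2)] by auto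
      show "AE s in lborel. \<bar>h' s * law s t\<bar> = (\<integral>\<omega>. norm (G s \<omega>) \<partial>M)"
        using L by eventually_elim (simp only: G1 abs_mult p_abs)
    qed measurable
    then show "integrable lborel (\<lambda>s. \<integral>\<omega>. norm (case (s, \<omega>) of (s, \<omega>) \<Rightarrow> G s \<omega>) \<partial>M)" by simp
  qed (use G1 in auto)
  note G_int = this
  have FTC: "(\<integral>s. G s \<omega> \<partial>lborel) = h (L \<omega>) - h 0" for \<omega>
  proof -
    have "(\<integral>s. G s \<omega> \<partial>lborel) = (\<integral>s. indicator {0..L \<omega>} s *\<^sub>R h' s \<partial>lborel)"
    proof (rule Bochner_Integration.integral_cong_AE)
      show "AE s in lborel. G s \<omega> = indicator {0..L \<omega>} s *\<^sub>R h' s"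
        using AE_lborel_singleton[of 0] AE_lborel_singleton[of "L \<omega>"]
        by eventually_elim (auto simp: G_def indicator_def)
    qed (auto simp: G_def[abs_def])
    also have "\<dots> = h (L \<omega>) - h 0"
      using D h'(1) L0 by (intro integral_FTC_atLeastAtMost)
        (auto simp: has_real_derivative_iff_has_vector_derivative[symmetric]
          intro: has_field_derivative_at_within continuous_on_subset)
    finally show ?thesis .
  qed
  have "integrable M (\<lambda>\<omega>. h (L \<omega>) - h 0)" using P.integrable_snd[OF G_int] by (simp add: FTC)
  then have "integrable M (\<lambda>\<omega>. (h (L \<omega>) - h 0) + h 0)" by (intro Bochner_Integration.integrable_add) auto
  then show i: "integrable M (\<lambda>\<omega>. h (L \<omega>))" by simp
  have "(\<integral>\<omega>. h (L \<omega>) - h 0 \<partial>M) = (\<integral>s. h' s * prob {\<omega> \<in> space M. 0 < s \<and> s < L \<omega>} \<partial>lborel)"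
    using P.Fubini_integral[OF G_int] by (simp add: FTC G1)
  also have "\<dots> = occ h' t"
    unfolding occ_def
  proof (rule Bochner_Integration.integral_cong_AE)
    show "AE s in lborel. h' s * prob {\<omega> \<in> space M. 0 < s \<and> s < L \<omega>} = h' s * law s t"
      using L by eventually_elim simp
    show "(\<lambda>s. h' s * prob {\<omega> \<in> space M. 0 < s \<and> s < L \<omega>}) \<in> borel_measurable lborel"
      unfolding G1(1)[symmetric] by measurable
  qed measurable
  finally show "expectation (\<lambda>\<omega>. h (L \<omega>)) = h 0 + occ h' t" using i by (simp add: prob_space)
qed

lemma matrix_exp_of_inverse:
  fixes A :: "real ^ 'n ^ 'n"
  shows "integrable (completion M) (\<lambda>\<omega>. matrix_exp (inverse_process \<sigma> t \<omega> *\<^sub>R A))"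
    and "(integral\<^sup>L (completion M) (\<lambda>\<omega>. matrix_exp (inverse_process \<sigma> t \<omega> *\<^sub>R A))) $ i $ j
      = mat 1 $ i $ j + occ (\<lambda>s. \<Sum>l\<in>UNIV. A $ i $ l * exp_entry A l j s) t"
proof -
  obtain L where L: "L \<in> borel_measurable M" "AE \<omega> in M. L \<omega> = inverse_process \<sigma> t \<omega>"
    "\<And>\<omega>. 0 \<le> L \<omega>" "AE s in lborel. prob {\<omega> \<in> space M. 0 < s \<and> s < L \<omega>} = law s t"
    using inverse_version[of t] by blast
  note [measurable] = L(1)
  have E: "integrable M (\<lambda>\<omega>. exp_entry A i j (L \<omega>))"
    "expectation (\<lambda>\<omega>. exp_entry A i j (L \<omega>)) = mat 1 $ i $ j + occ (\<lambda>s. \<Sum>l\<in>UNIV. A $ i $ l * exp_entry A l j s) t" for i j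
  proof -
    have c: "continuous_on UNIV (\<lambda>s. \<Sum>l\<in>UNIV. A $ i $ l * exp_entry A l j s)"
      by (intro continuous_intros exp_entry_continuous)
    note e = expectation_of_inverse[OF L(1,3,4) exp_entry_derivative c exp_bounded_sum[OF exp_entry_exp_bounded order_refl]]
    show "integrable M (\<lambda>\<omega>. exp_entry A i j (L \<omega>))"
      "expectation (\<lambda>\<omega>. exp_entry A i j (L \<omega>)) = mat 1 $ i $ j + occ (\<lambda>s. \<Sum>l\<in>UNIV. A $ i $ l * exp_entry A l j s) t"
      using e by (simp_all add: exp_entry_0)
  qed
  have I: "integrable M (\<lambda>\<omega>. matrix_exp (L \<omega> *\<^sub>R A))"
    by (rule integrable_matrix_componentwise) (simp add: matrix_exp_nth E)
  then have m: "(\<lambda>\<omega>. matrix_exp (L \<omega> *\<^sub>R A)) \<in> borel_measurable M" by auto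
  have ae: "AE \<omega> in M. matrix_exp (L \<omega> *\<^sub>R A) = matrix_exp (inverse_process \<sigma> t \<omega> *\<^sub>R A)"
    using L(2) by eventually_elim simp
  note m' = borel_measurable_completion_AE[OF m ae]
  have I': "integrable (completion M) (\<lambda>\<omega>. matrix_exp (L \<omega> *\<^sub>R A))"
    using integrable_completion[OF m] I by simp
  show "integrable (completion M) (\<lambda>\<omega>. matrix_exp (inverse_process \<sigma> t \<omega> *\<^sub>R A))"
    by (rule integrable_cong_AE_imp[OF I' m']) (use AE_completion[OF ae] in \<open>auto elim: eventually_mono\<close>)
  have "integral\<^sup>L (completion M) (\<lambda>\<omega>. matrix_exp (inverse_process \<sigma> t \<omega> *\<^sub>R A))
      = integral\<^sup>L (completion M) (\<lambda>\<omega>. matrix_exp (L \<omega> *\<^sub>R A))"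
    by (rule Bochner_Integration.integral_cong_AE[symmetric, OF measurable_completion[OF m] m' AE_completion[OF ae]])
  also have "\<dots> = expectation (\<lambda>\<omega>. matrix_exp (L \<omega> *\<^sub>R A))" by (rule integral_completion[OF m])
  finally show "(integral\<^sup>L (completion M) (\<lambda>\<omega>. matrix_exp (inverse_process \<sigma> t \<omega> *\<^sub>R A))) $ i $ j
      = mat 1 $ i $ j + occ (\<lambda>s. \<Sum>l\<in>UNIV. A $ i $ l * exp_entry A l j s) t"
    by (simp add: integral_matrix_nth[OF I] matrix_exp_nth E)
qed

text \<open>
  Here \<open>v\<close> is \<open>exp (s A) u\<close> and \<open>D\<close> its derivative \<open>A v\<close>, which solves the same linear system.
\<close>

lemma T_op_caputo_solution:
  fixes A :: "real ^ 'n ^ 'n"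
  assumes ac: "\<And>x y. 0 < x \<Longrightarrow> x < y \<Longrightarrow> abs_continuous_on {x..y} k"
  shows "caputo_solution b \<nu> A u (\<lambda>t. T_op M \<sigma> A t u)"
proof -
  define v where "v l s = (\<Sum>j\<in>UNIV. u $ j * exp_entry A l j s)" for l s
  define D where "D i s = (\<Sum>l\<in>UNIV. A $ i $ l * v l s)" for i s
  define C where "C = (\<Sum>j\<in>UNIV. \<bar>u $ j\<bar>)"
  have vb: "exp_bounded (C * 1) (entry_sum A) (v l)" for l
    unfolding v_def C_def by (rule exp_bounded_sum[OF exp_entry_exp_bounded order_refl])
  have Db: "exp_bounded (entry_sum A * (C * 1)) (entry_sum A) (D i)" for i
    unfolding D_def by (rule exp_bounded_sum[OF vb row_sum_le])
  have v': "(v l has_real_derivative D l s) (at s)" for l s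
  proof -
    have "(v l has_real_derivative (\<Sum>j\<in>UNIV. u $ j * (\<Sum>m\<in>UNIV. A $ l $ m * exp_entry A m j s))) (at s)"
      unfolding v_def[abs_def] by (intro DERIV_sum DERIV_cmult exp_entry_derivative)
    also have "(\<Sum>j\<in>UNIV. u $ j * (\<Sum>m\<in>UNIV. A $ l $ m * exp_entry A m j s)) = D l s"
      unfolding D_def v_def sum_distrib_left by (subst sum.swap) (simp add: ac_simps)
    finally show ?thesis .
  qed
  show ?thesis
  proof (rule occ_caputo_solution[where D=D and c="entry_sum A" and C="entry_sum A * (C * 1)"])
    show "(D i has_real_derivative (\<Sum>l\<in>UNIV. A $ i $ l * D l s)) (at s)" for i s
    proof -
      have "D i = (\<lambda>s. \<Sum>l\<in>UNIV. A $ i $ l * v l s)" by (rule ext) (simp add: D_def)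
      then show ?thesis by (simp only:) (intro DERIV_sum DERIV_cmult v')
    qed
    have v0: "v l 0 = u $ l" for l
    proof -
      have "v l 0 = (\<Sum>j\<in>UNIV. if j = l then u $ j else 0)"
        unfolding v_def exp_entry_0 by (intro sum.cong) (auto simp: mat_def)
      then show ?thesis by simp
    qed
    show "D i 0 = (\<Sum>l\<in>UNIV. A $ i $ l * u $ l)" for i unfolding D_def v0 ..
    show "exp_bounded (entry_sum A * (C * 1)) (entry_sum A) (D i)" for i by (rule Db)
    show "0 \<le> entry_sum A" by (rule entry_sum_nonneg)
    show "T_op M \<sigma> A t u $ i = u $ i + occ (D i) t" if "0 \<le> t" for t i
    proof -
      have "T_op M \<sigma> A t u $ i = (\<Sum>j\<in>UNIV. (mat 1 $ i $ j + occ (\<lambda>s. \<Sum>l\<in>UNIV. A $ i $ l * exp_entry A l j s) t) * u $ j)"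
        unfolding T_op_def by (simp add: matrix_vector_mult_def matrix_exp_of_inverse(2))
      also have "\<dots> = (\<Sum>j\<in>UNIV. if j = i then u $ j else 0) + (\<Sum>j\<in>UNIV. u $ j * occ (\<lambda>s. \<Sum>l\<in>UNIV. A $ i $ l * exp_entry A l j s) t)"
        unfolding sum.distrib[symmetric] by (intro sum.cong) (auto simp: mat_def algebra_simps)
      also have "(\<Sum>j\<in>UNIV. u $ j * occ (\<lambda>s. \<Sum>l\<in>UNIV. A $ i $ l * exp_entry A l j s) t)
        = occ (\<lambda>s. \<Sum>j\<in>UNIV. u $ j * (\<Sum>l\<in>UNIV. A $ i $ l * exp_entry A l j s)) t"
        by (rule occ_sum[symmetric], rule exp_bounded_sum[OF exp_entry_exp_bounded order_refl])
      also have "(\<lambda>s. \<Sum>j\<in>UNIV. u $ j * (\<Sum>l\<in>UNIV. A $ i $ l * exp_entry A l j s)) = D i"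
        unfolding D_def v_def sum_distrib_left by (rule ext, subst sum.swap) (simp add: ac_simps)
      finally show ?thesis by simp
    qed
  qed (rule ac)
qed

end

section \<open>The Caputo equation is solved by the time-changed matrix exponential\<close>

theorem theorem13:
  fixes A :: "real ^ 'n ^ 'n"
    and M :: "'a measure"
    and \<sigma> :: "real \<Rightarrow> 'a \<Rightarrow> real"
    and f :: "real \<Rightarrow> real"
    and b :: real
    and \<nu> :: "real measure"
  assumes "subordinator M \<sigma>"
    and "laplace_exponent M \<sigma> f"
    and "\<And>x. x > 0 \<Longrightarrow> f x = b * x + (\<integral>s. (1 - exp (- s * x)) \<partial>\<nu>)"
    and "b \<ge> 0"
    and "sets \<nu> = sets (restrict_space borel {0<..})"
    and "(\<integral>\<^sup>+ s. ennreal (min s 1) \<partial>\<nu>) < \<infinity>"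
    and "emeasure \<nu> {0<..} = \<infinity>"
    and "\<And>x y. 0 < x \<Longrightarrow> x < y \<Longrightarrow> abs_continuous_on {x..y} (levy_tail \<nu>)"
  shows "(\<forall>t\<ge>0. (AE \<omega> in M. \<exists>s>0. t < \<sigma> s \<omega>) \<and>
            integrable (completion M) (\<lambda>\<omega>. matrix_exp (inverse_process \<sigma> t \<omega> *\<^sub>R A))) \<and>
         (\<forall>u. (\<lambda>t. T_op M \<sigma> A t u) \<in> AC_loc) \<and>
         (\<forall>u. caputo_solution b \<nu> A u (\<lambda>t. T_op M \<sigma> A t u) \<and>
            (\<forall>q. caputo_solution b \<nu> A u q \<longrightarrow> (\<forall>t\<ge>0. q t = T_op M \<sigma> A t u)))"
proof -
  note sets_\<nu> = assms(5)
  have space_\<nu>: "space \<nu> = {0<..}"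
    using sets_eq_imp_space_eq[OF sets_\<nu>] by (simp add: space_restrict_space)
  have id_measurable: "(\<lambda>x. x) \<in> \<nu> \<rightarrow>\<^sub>M borel"
    using measurable_restrict_space1[of "\<lambda>x. x" borel borel "{0<..}"] measurable_cong_sets[OF sets_\<nu> refl] by auto
  \<comment> \<open>The same measure on all Borel sets of the line.\<close>
  define \<mu> where "\<mu> = distr \<nu> borel (\<lambda>x. x)"
  have emeasure_\<mu>: "emeasure \<mu> S = emeasure \<nu> (S \<inter> {0<..})" if "S \<in> sets borel" for S
    unfolding \<mu>_def using that id_measurable by (subst emeasure_distr) (auto simp: space_\<nu>)
  interpret \<mu>: levy_measure \<mu>
  proof
    show "sets \<mu> = sets borel" by (simp add: \<mu>_def)
    have "{..0} \<inter> {0<..} = ({} :: real set)" by auto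
    then show "emeasure \<mu> {..0} = 0" by (simp add: emeasure_\<mu>)
    show "(\<integral>\<^sup>+ y. ennreal (min y 1) \<partial>\<mu>) < \<infinity>"
      unfolding \<mu>_def using id_measurable assms(6) by (subst nn_integral_distr) auto
    show "emeasure \<mu> UNIV = \<infinity>" using assms(7) by (simp add: emeasure_\<mu>)
  qed
  have tail: "levy_tail \<mu> = levy_tail \<nu>"
  proof
    fix s
    show "levy_tail \<mu> s = levy_tail \<nu> s"
    proof (cases "s < 0")
      case True
      then have "\<not> {s<..} \<subseteq> space \<nu>" by (auto simp: space_\<nu> intro!: exI[of _ "s / 2"])
      then have "{s<..} \<notin> sets \<nu>" using sets.sets_into_space by blast
      then have "levy_tail \<nu> s = 0" by (simp add: levy_tail_def measure_def emeasure_notin_sets)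
      then show ?thesis using \<mu>.tail_nonpos[of s] True by simp
    next
      case False
      then have "{s<..} \<inter> {0<..} = {s<..}" by auto
      then show ?thesis by (simp add: levy_tail_def measure_def emeasure_\<mu>)
    qed
  qed
  have solution_\<mu>: "caputo_solution b \<mu> A u q \<longleftrightarrow> caputo_solution b \<nu> A u q" for u q
    by (simp add: caputo_solution_def has_caputo_derivative_def tail)
  have levy: "levy_process M \<sigma>" "AE \<omega> in M. mono_on {0..} (\<lambda>s. \<sigma> s \<omega>)"
    using assms(1) by (auto simp: subordinator_def)
  interpret prob_space M using levy(1) by (simp add: levy_process_def)
  interpret inverse_subordinator \<mu> M \<sigma> b
  proof
    show "0 \<le> b" by (rule assms(4))
    show "\<sigma> s \<in> borel_measurable M" if "0 \<le> s" for s using levy(1) that by (simp add: levy_process_def)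
    show "AE \<omega> in M. \<sigma> 0 \<omega> = 0" using levy(1) by (simp add: levy_process_def)
    show "AE \<omega> in M. mono_on {0..} (\<lambda>s. \<sigma> s \<omega>)" by (rule levy(2))
    show "(\<integral>\<omega>. exp (- x * \<sigma> s \<omega>) \<partial>M) = exp (- s * (b * x + (\<integral>y. (1 - exp (- y * x)) \<partial>\<mu>)))"
      if "0 < s" "0 < x" for s x
    proof -
      have "(\<integral>y. (1 - exp (- y * x)) \<partial>\<mu>) = (\<integral>y. (1 - exp (- y * x)) \<partial>\<nu>)"
        unfolding \<mu>_def by (subst integral_distr[OF id_measurable]) auto
      then show ?thesis using assms(2,3) that by (simp add: laplace_exponent_def)
    qed
  qed
  have ac: "abs_continuous_on {x..y} (levy_tail \<mu>)" if "0 < x" "x < y" for x y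
    using assms(8)[OF that] by (simp add: tail)
  have sol: "caputo_solution b \<nu> A u (\<lambda>t. T_op M \<sigma> A t u)" for u
    by (rule solution_\<mu>[THEN iffD1, OF T_op_caputo_solution[OF ac]])
  have unique: "q t = T_op M \<sigma> A t u" if "caputo_solution b \<nu> A u q" "0 \<le> t" for u q t
    using caputo_solution_unique[of A u q "\<lambda>t. T_op M \<sigma> A t u" t] that sol by (simp add: solution_\<mu>)
  show ?thesis
    using AE_passage matrix_exp_of_inverse(1) sol unique by (auto simp: caputo_solution_def)
qed

end
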